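(* Let $l\in L^2(0,T;L^2(\Omega))$, $d_0\in L^2(\Omega)$, and let $(\varphi,d)\in V\times X$ be the solution of the continuous state equation with data $(l,d_0)$. Assume that $\varphi\in H^1(0,T;L^2(\Omega))$. Let $(\varphi_\tau,d_\tau)\in V^0_\tau\times X^0_\tau$ be the solution of the semidiscrete (dG(0)) state equation for the same data. Then $$\|\varphi-\varphi_\tau\|_{I\times\Omega}+\|d-d_\tau\|_{I\times\Omega}\le C\tau\{\|\partial_t\varphi\|_{I\times\Omega}+\|\partial_t d\|_{I\times\Omega}\}$$ with a constant $C$ independent of the temporal discretization parameter $\tau$.
   Context: Setting: $\Omega\subset\mathbb{R}^N$, $N\in\{2,3\}$, is a convex polygonal (bounded) domain, $T>0$, $I=(0,T)$, and $\alpha,\beta,\delta>0$ are fixed. $(\cdot,\cdot)$, $\|\cdot\|$ denote the inner product and norm of $L^2(\Omega)$; $(\cdot,\cdot)_{I\times\Omega}$, $\|\cdot\|_{I\times\Omega}$ those of $L^2(0,T;L^2(\Omega))$; $(\cdot,\cdot)_{I_m\times\Omega}$ that of $L^2(I_m;L^2(\Omega))$. $V=L^2(0,T;H^1_0(\Omega))$, $X=H^1(0,T;L^2(\Omega))$. Continuous state equation: find $(\varphi,d)\in V\times X$ with $d(0)=d_0$ and, for all $(\psi,\lambda)\in V\times X$, $\alpha(\nabla\varphi,\nabla\psi)_{I\times\Omega}-\beta(d-\varphi,\psi)_{I\times\Omega}+(\partial_t d,\lambda)_{I\times\Omega}+\frac{\beta}{\delta}(d-\varphi,\lambda)_{I\times\Omega}=(l,\psi)_{I\times\Omega}$.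 It is uniquely solvable. Time discretization: $0=t_0<t_1<\dots<t_M=T$, $I_m=(t_{m-1},t_m]$, $\tau_m=t_m-t_{m-1}$, $\tau=\max_m\tau_m$. $V^0_\tau$ (resp. $X^0_\tau$): functions constant in time on each $I_m$ with values in $H^1_0(\Omega)$ (resp. $L^2(\Omega)$). $v^\pm_m=\lim_{s\to0^+}v(t_m\pm s)$, $[v]_m=v_m^+-v_m^-$. Bilinear form: $$\mathbf{B}((\varphi,d),(\psi,\lambda))=\alpha(\nabla\varphi,\nabla\psi)_{I\times\Omega}-\beta(d-\varphi,\psi)_{I\times\Omega}+\sum_{m=1}^M(\partial_t d,\lambda)_{I_m\times\Omega}+\frac{\beta}{\delta}(d-\varphi,\lambda)_{I\times\Omega}+\sum_{m=2}^M([d]_{m-1},\lambda^+_{m-1})+(d_0^+,\lambda_0^+)$$ (in the last term $d_0^+$ is the right limit of the function $d$ at $t_0=0$). Semidiscrete state equation: find $(\varphi_\tau,d_\tau)\in V^0_\tau\times X^0_\tau$ with $\mathbf{B}((\varphi_\tau,d_\tau),(\psi,\lambda))=(l,\psi)_{I\times\Omega}+(d_0,\lambda_0^+)$ for all $(\psi,\lambda)\in V^0_\tau\times X^0_\tau$, where $d_0$ is the initial datum; it is uniquely solvable. Generic constants $C$ depend only on the problem data $\Omega,T,\alpha,\beta,\delta$, not on $l,d_0$ or the solutions. *)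

theory Defs
  imports "HOL-Analysis.Analysis"
begin

section \<open>The spatial domain and test functions\<close>

definition convex_polytopal_domain :: "'a::euclidean_space set \<Rightarrow> bool" where
  "convex_polytopal_domain \<Omega> \<longleftrightarrow> open \<Omega> \<and> convex \<Omega> \<and> \<Omega> \<noteq> {} \<and> polytope (closure \<Omega>)"

definition partial_deriv :: "'a::euclidean_space \<Rightarrow> ('a \<Rightarrow> real) \<Rightarrow> 'a \<Rightarrow> real" where
  "partial_deriv b f = (\<lambda>x. frechet_derivative f (at x) b)"

fun Ck :: "nat \<Rightarrow> ('a::euclidean_space \<Rightarrow> real) \<Rightarrow> bool" where
  "Ck 0 f \<longleftrightarrow> continuous_on UNIV f"
| "Ck (Suc k) f \<longleftrightarrow> (\<forall>x. f differentiable (at x)) \<and> (\<forall>b\<in>Basis. Ck k (partial_deriv b f))"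

text \<open>The space of smooth functions with compact support in \<open>S\<close>, extended by zero
  to the whole space. It is used with \<open>S = \<Omega>\<close> and with \<open>S\<close> an open time interval.\<close>

definition Cc_infty :: "'a::euclidean_space set \<Rightarrow> ('a \<Rightarrow> real) set" where
  "Cc_infty S = {f. (\<forall>k. Ck k f) \<and> (\<exists>K. compact K \<and> K \<subseteq> S \<and> (\<forall>x. x \<notin> K \<longrightarrow> f x = 0))}"

section \<open>Lebesgue and Sobolev spaces on the spatial domain\<close>

text \<open>Elements of \<open>L\<^sup>2\<close>, \<open>H\<^sup>1\<close>, \<open>H\<^sup>1\<^sub>0\<close> are represented by functions, not by
  classes of functions equal almost everywhere; values outside \<open>\<Omega>\<close> are irrelevant. Equality
  in \<open>L\<^sup>2(\<Omega>)\<close> is expressed by the vanishing of the norm of the difference, and a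
  choice operator is only used for objects that are unique almost everywhere.\<close>

definition L2 :: "'a::euclidean_space set \<Rightarrow> ('a \<Rightarrow> 'b::euclidean_space) set" where
  "L2 \<Omega> = {f. f \<in> borel_measurable (lebesgue_on \<Omega>)
              \<and> integrable (lebesgue_on \<Omega>) (\<lambda>x. (norm (f x))\<^sup>2)}"

definition L2_inner ::
    "'a::euclidean_space set \<Rightarrow> ('a \<Rightarrow> 'b::euclidean_space) \<Rightarrow> ('a \<Rightarrow> 'b) \<Rightarrow> real" where
  "L2_inner \<Omega> f g = integral\<^sup>L (lebesgue_on \<Omega>) (\<lambda>x. f x \<bullet> g x)"

definition L2_norm :: "'a::euclidean_space set \<Rightarrow> ('a \<Rightarrow> 'b::euclidean_space) \<Rightarrow> real" where
  "L2_norm \<Omega> f = sqrt (L2_inner \<Omega> f f)"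

definition is_weak_grad ::
    "'a::euclidean_space set \<Rightarrow> ('a \<Rightarrow> real) \<Rightarrow> ('a \<Rightarrow> 'a) \<Rightarrow> bool" where
  "is_weak_grad \<Omega> u g \<longleftrightarrow> g \<in> L2 \<Omega> \<and>
     (\<forall>\<eta>\<in>Cc_infty \<Omega>. \<forall>b\<in>Basis.
        L2_inner \<Omega> u (partial_deriv b \<eta>) = - L2_inner \<Omega> (\<lambda>x. g x \<bullet> b) \<eta>)"

definition weak_grad :: "'a::euclidean_space set \<Rightarrow> ('a \<Rightarrow> real) \<Rightarrow> 'a \<Rightarrow> 'a" where
  "weak_grad \<Omega> u = (SOME g. is_weak_grad \<Omega> u g)"

definition H1 :: "'a::euclidean_space set \<Rightarrow> ('a \<Rightarrow> real) set" where
  "H1 \<Omega> = {u \<in> L2 \<Omega>. \<exists>g. is_weak_grad \<Omega> u g}"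

definition H1_norm :: "'a::euclidean_space set \<Rightarrow> ('a \<Rightarrow> real) \<Rightarrow> real" where
  "H1_norm \<Omega> u = sqrt ((L2_norm \<Omega> u)\<^sup>2 + (L2_norm \<Omega> (weak_grad \<Omega> u))\<^sup>2)"

text \<open>The closure of the test functions in \<open>H\<^sup>1(\<Omega>)\<close>.\<close>

definition H10 :: "'a::euclidean_space set \<Rightarrow> ('a \<Rightarrow> real) set" where
  "H10 \<Omega> = {u \<in> H1 \<Omega>. \<forall>e>0. \<exists>\<eta>\<in>Cc_infty \<Omega>. H1_norm \<Omega> (\<lambda>x. u x - \<eta> x) < e}"

section \<open>Bochner spaces\<close>

text \<open>\<open>bochner_L2 J Y nrm\<close> is \<open>L\<^sup>2(J;Y)\<close> for a space \<open>Y\<close> of functions on the spatial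
  domain with norm \<open>nrm\<close>: strongly measurable functions, that is, limits almost everywhere of
  \<open>Y\<close>-valued simple functions, with square integrable norm.\<close>

definition bochner_L2 ::
    "real set \<Rightarrow> ('a \<Rightarrow> real) set \<Rightarrow> (('a \<Rightarrow> real) \<Rightarrow> real) \<Rightarrow> (real \<Rightarrow> 'a \<Rightarrow> real) set" where
  "bochner_L2 J Y nrm = {u.
     (AE t in lebesgue_on J. u t \<in> Y) \<and>
     (\<exists>s :: nat \<Rightarrow> real \<Rightarrow> 'a \<Rightarrow> real.
        (\<forall>k. simple_function (lebesgue_on J) (s k) \<and> (\<forall>t\<in>J. s k t \<in> Y)) \<and>
        (AE t in lebesgue_on J. (\<lambda>k. nrm (\<lambda>x. s k t x - u t x)) \<longlonglongrightarrow> 0)) \<and>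
     integrable (lebesgue_on J) (\<lambda>t. (nrm (u t))\<^sup>2)}"

abbreviation L2_L2 ::
    "real set \<Rightarrow> 'a::euclidean_space set \<Rightarrow> (real \<Rightarrow> 'a \<Rightarrow> real) set" where
  "L2_L2 J \<Omega> \<equiv> bochner_L2 J (L2 \<Omega>) (L2_norm \<Omega>)"

abbreviation L2_H10 ::
    "real set \<Rightarrow> 'a::euclidean_space set \<Rightarrow> (real \<Rightarrow> 'a \<Rightarrow> real) set" where
  "L2_H10 J \<Omega> \<equiv> bochner_L2 J (H10 \<Omega>) (H1_norm \<Omega>)"

definition st_inner :: "real set \<Rightarrow> 'a::euclidean_space set \<Rightarrow>
    (real \<Rightarrow> 'a \<Rightarrow> 'b::euclidean_space) \<Rightarrow> (real \<Rightarrow> 'a \<Rightarrow> 'b) \<Rightarrow> real" where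
  "st_inner J \<Omega> u v = integral\<^sup>L (lebesgue_on J) (\<lambda>t. L2_inner \<Omega> (u t) (v t))"

definition st_norm :: "real set \<Rightarrow> 'a::euclidean_space set \<Rightarrow>
    (real \<Rightarrow> 'a \<Rightarrow> 'b::euclidean_space) \<Rightarrow> real" where
  "st_norm J \<Omega> u = sqrt (st_inner J \<Omega> u u)"

text \<open>The weak time derivative in \<open>L\<^sup>2(J;L\<^sup>2(\<Omega>))\<close>. The identity
  \<open>\<integral> \<theta>' u dt = - \<integral> \<theta> w dt\<close> between Bochner integrals in \<open>L\<^sup>2(\<Omega>)\<close> is stated by taking the
  inner product of both sides with every \<open>v \<in> L\<^sup>2(\<Omega>)\<close>.\<close>

definition is_weak_dt :: "real set \<Rightarrow> 'a::euclidean_space set \<Rightarrow>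
    (real \<Rightarrow> 'a \<Rightarrow> real) \<Rightarrow> (real \<Rightarrow> 'a \<Rightarrow> real) \<Rightarrow> bool" where
  "is_weak_dt J \<Omega> u w \<longleftrightarrow> w \<in> L2_L2 J \<Omega> \<and>
     (\<forall>\<theta>\<in>Cc_infty J. \<forall>v\<in>L2 \<Omega>.
        integral\<^sup>L (lebesgue_on J) (\<lambda>t. deriv \<theta> t * L2_inner \<Omega> (u t) v)
        = - integral\<^sup>L (lebesgue_on J) (\<lambda>t. \<theta> t * L2_inner \<Omega> (w t) v))"

definition weak_dt :: "real set \<Rightarrow> 'a::euclidean_space set \<Rightarrow>
    (real \<Rightarrow> 'a \<Rightarrow> real) \<Rightarrow> real \<Rightarrow> 'a \<Rightarrow> real" where
  "weak_dt J \<Omega> u = (SOME w. is_weak_dt J \<Omega> u w)"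

definition H1_L2 :: "real set \<Rightarrow> 'a::euclidean_space set \<Rightarrow> (real \<Rightarrow> 'a \<Rightarrow> real) set" where
  "H1_L2 J \<Omega> = {u \<in> L2_L2 J \<Omega>. \<exists>w. is_weak_dt J \<Omega> u w}"

text \<open>\<open>d(0) = d\<^sub>0\<close> is understood through the representative \<open>D\<close> of \<open>d\<close> in
  \<open>C([0,T];L\<^sup>2(\<Omega>))\<close>.\<close>

definition has_initial_value :: "real \<Rightarrow> 'a::euclidean_space set \<Rightarrow>
    (real \<Rightarrow> 'a \<Rightarrow> real) \<Rightarrow> ('a \<Rightarrow> real) \<Rightarrow> bool" where
  "has_initial_value T \<Omega> d d0 \<longleftrightarrow> (\<exists>D.
     (\<forall>t\<in>{0..T}. D t \<in> L2 \<Omega> \<and>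
        ((\<lambda>s. L2_norm \<Omega> (\<lambda>x. D s x - D t x)) \<longlongrightarrow> 0) (at t within {0..T})) \<and>
     (AE t in lebesgue_on {0<..<T}. L2_norm \<Omega> (\<lambda>x. d t x - D t x) = 0) \<and>
     L2_norm \<Omega> (\<lambda>x. D 0 x - d0 x) = 0)"

section \<open>The continuous state equation\<close>

definition continuous_state ::
    "'a::euclidean_space set \<Rightarrow> real \<Rightarrow> real \<Rightarrow> real \<Rightarrow> real \<Rightarrow>
     (real \<Rightarrow> 'a \<Rightarrow> real) \<Rightarrow> ('a \<Rightarrow> real) \<Rightarrow>
     (real \<Rightarrow> 'a \<Rightarrow> real) \<Rightarrow> (real \<Rightarrow> 'a \<Rightarrow> real) \<Rightarrow> bool" where
  "continuous_state \<Omega> T \<alpha> \<beta> \<delta> l d0 \<phi> d \<longleftrightarrow>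
     (let I = {0<..<T} in
      \<phi> \<in> L2_H10 I \<Omega> \<and> d \<in> H1_L2 I \<Omega> \<and> has_initial_value T \<Omega> d d0 \<and>
      (\<forall>\<psi>\<in>L2_H10 I \<Omega>. \<forall>\<mu>\<in>H1_L2 I \<Omega>.
         \<alpha> * st_inner I \<Omega> (\<lambda>t. weak_grad \<Omega> (\<phi> t)) (\<lambda>t. weak_grad \<Omega> (\<psi> t))
         - \<beta> * st_inner I \<Omega> (\<lambda>t x. d t x - \<phi> t x) \<psi>
         + st_inner I \<Omega> (weak_dt I \<Omega> d) \<mu>
         + \<beta> / \<delta> * st_inner I \<Omega> (\<lambda>t x. d t x - \<phi> t x) \<mu>
         = st_inner I \<Omega> l \<psi>))"

section \<open>The dG(0) time discretization\<close>

text \<open>Time meshes \<open>0 = t\<^sub>0 < \<dots> < t\<^sub>M = T\<close>, with \<open>I\<^sub>m = (t\<^sub>m\<^sub>-\<^sub>1, t\<^sub>m]\<close> for \<open>1 \<le> m \<le> M\<close>.\<close>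

definition time_mesh :: "real \<Rightarrow> nat \<Rightarrow> (nat \<Rightarrow> real) \<Rightarrow> bool" where
  "time_mesh T M t \<longleftrightarrow> 1 \<le> M \<and> t 0 = 0 \<and> t M = T \<and> (\<forall>m\<in>{1..M}. t (m - 1) < t m)"

definition mesh_size :: "nat \<Rightarrow> (nat \<Rightarrow> real) \<Rightarrow> real" where
  "mesh_size M t = Max ((\<lambda>m. t m - t (m - 1)) ` {1..M})"

definition piecewise_const ::
    "nat \<Rightarrow> (nat \<Rightarrow> real) \<Rightarrow> ('a \<Rightarrow> real) set \<Rightarrow> (real \<Rightarrow> 'a \<Rightarrow> real) set" where
  "piecewise_const M t Y = {u. \<forall>m\<in>{1..M}. \<exists>v\<in>Y. \<forall>s\<in>{t (m - 1)<..t m}. u s = v}"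

text \<open>One-sided limits in \<open>L\<^sup>2(\<Omega>)\<close>.\<close>

definition L2_lim ::
    "'a::euclidean_space set \<Rightarrow> real filter \<Rightarrow> (real \<Rightarrow> 'a \<Rightarrow> real) \<Rightarrow> 'a \<Rightarrow> real" where
  "L2_lim \<Omega> F u =
     (SOME v. v \<in> L2 \<Omega> \<and> ((\<lambda>s. L2_norm \<Omega> (\<lambda>x. u s x - v x)) \<longlongrightarrow> 0) F)"

definition trace_plus ::
    "'a::euclidean_space set \<Rightarrow> (real \<Rightarrow> 'a \<Rightarrow> real) \<Rightarrow> real \<Rightarrow> 'a \<Rightarrow> real" where
  "trace_plus \<Omega> u s = L2_lim \<Omega> (at_right s) u"

definition trace_minus ::
    "'a::euclidean_space set \<Rightarrow> (real \<Rightarrow> 'a \<Rightarrow> real) \<Rightarrow> real \<Rightarrow> 'a \<Rightarrow> real" where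
  "trace_minus \<Omega> u s = L2_lim \<Omega> (at_left s) u"

definition jump ::
    "'a::euclidean_space set \<Rightarrow> (real \<Rightarrow> 'a \<Rightarrow> real) \<Rightarrow> real \<Rightarrow> 'a \<Rightarrow> real" where
  "jump \<Omega> u s = (\<lambda>x. trace_plus \<Omega> u s x - trace_minus \<Omega> u s x)"

text \<open>Weak time derivatives are taken on the interior of \<open>I\<^sub>m\<close>.\<close>

definition dG_form ::
    "'a::euclidean_space set \<Rightarrow> real \<Rightarrow> real \<Rightarrow> real \<Rightarrow> real \<Rightarrow> nat \<Rightarrow> (nat \<Rightarrow> real) \<Rightarrow>
     (real \<Rightarrow> 'a \<Rightarrow> real) \<times> (real \<Rightarrow> 'a \<Rightarrow> real) \<Rightarrow>
     (real \<Rightarrow> 'a \<Rightarrow> real) \<times> (real \<Rightarrow> 'a \<Rightarrow> real) \<Rightarrow> real" where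
  "dG_form \<Omega> T \<alpha> \<beta> \<delta> M t = (\<lambda>(\<phi>, d) (\<psi>, \<mu>).
     let I = {0<..<T} in
     \<alpha> * st_inner I \<Omega> (\<lambda>s. weak_grad \<Omega> (\<phi> s)) (\<lambda>s. weak_grad \<Omega> (\<psi> s))
     - \<beta> * st_inner I \<Omega> (\<lambda>s x. d s x - \<phi> s x) \<psi>
     + (\<Sum>m=1..M. st_inner {t (m - 1)<..t m} \<Omega> (weak_dt {t (m - 1)<..<t m} \<Omega> d) \<mu>)
     + \<beta> / \<delta> * st_inner I \<Omega> (\<lambda>s x. d s x - \<phi> s x) \<mu>
     + (\<Sum>m=2..M. L2_inner \<Omega> (jump \<Omega> d (t (m - 1))) (trace_plus \<Omega> \<mu> (t (m - 1))))
     + L2_inner \<Omega> (trace_plus \<Omega> d (t 0)) (trace_plus \<Omega> \<mu> (t 0)))"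

definition dG0_state ::
    "'a::euclidean_space set \<Rightarrow> real \<Rightarrow> real \<Rightarrow> real \<Rightarrow> real \<Rightarrow> nat \<Rightarrow> (nat \<Rightarrow> real) \<Rightarrow>
     (real \<Rightarrow> 'a \<Rightarrow> real) \<Rightarrow> ('a \<Rightarrow> real) \<Rightarrow>
     (real \<Rightarrow> 'a \<Rightarrow> real) \<Rightarrow> (real \<Rightarrow> 'a \<Rightarrow> real) \<Rightarrow> bool" where
  "dG0_state \<Omega> T \<alpha> \<beta> \<delta> M t l d0 \<phi>\<tau> d\<tau> \<longleftrightarrow>
     \<phi>\<tau> \<in> piecewise_const M t (H10 \<Omega>) \<and> d\<tau> \<in> piecewise_const M t (L2 \<Omega>) \<and>
     (\<forall>\<psi>\<in>piecewise_const M t (H10 \<Omega>). \<forall>\<mu>\<in>piecewise_const M t (L2 \<Omega>).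
        dG_form \<Omega> T \<alpha> \<beta> \<delta> M t (\<phi>\<tau>, d\<tau>) (\<psi>, \<mu>)
        = st_inner {0<..<T} \<Omega> l \<psi> + L2_inner \<Omega> d0 (trace_plus \<Omega> \<mu> (t 0)))"

end

theory Submission
  imports Defs "HOL-Real_Asymp.Real_Asymp"
begin

text \<open>Write \<open>e\<^sub>m = d(t\<^sub>m) - d\<^sub>\<tau>(t\<^sub>m)\<close> and let \<open>\<epsilon>\<^sub>m\<close> be the difference of the mean value of \<open>\<phi>\<close> on \<open>I\<^sub>m\<close> and
  the value of \<open>\<phi>\<^sub>\<tau>\<close> there. Integrating both state equations over \<open>I\<^sub>m\<close>, subtracting, and testing the
  elliptic equation with \<open>\<epsilon>\<^sub>m\<close> and the evolution equation with \<open>\<delta> e\<^sub>m\<close>, the coupling terms add up to a square: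
  with \<open>\<rho>\<^sub>m\<close> the difference of the mean value of \<open>d\<close> on \<open>I\<^sub>m\<close> and \<open>d(t\<^sub>m)\<close>,
  \<open>\<delta>/2 (\<parallel>e\<^sub>m\<parallel>\<^sup>2 - \<parallel>e\<^bsub>m-1\<^esub>\<parallel>\<^sup>2) + \<beta> \<tau>\<^sub>m \<parallel>e\<^sub>m - \<epsilon>\<^sub>m\<parallel>\<^sup>2 + \<alpha> \<tau>\<^sub>m \<parallel>\<nabla>\<epsilon>\<^sub>m\<parallel>\<^sup>2 \<le> \<beta> \<tau>\<^sub>m \<parallel>\<rho>\<^sub>m\<parallel> \<parallel>e\<^sub>m - \<epsilon>\<^sub>m\<parallel>\<close>.
  As \<open>\<parallel>\<rho>\<^sub>m\<parallel>\<^sup>2\<close> is at most \<open>\<tau>\<^sub>m\<close> times the integral of \<open>\<parallel>\<partial>\<^sub>t d\<parallel>\<^sup>2\<close> over \<open>I\<^sub>m\<close>, summation over \<open>m\<close> bounds the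
  nodal errors, and neither Gronwall's lemma nor Poincare's inequality is needed. Mean values with values in
  \<open>H\<^sup>1\<^sub>0(\<Omega>)\<close> are only used approximately, so that no completeness of the function spaces enters.\<close>

section \<open>Smooth cutoff functions\<close>

text \<open>Two features of the setting shape the proof. Functions stand for classes, and weak
  gradients, weak time derivatives and one-sided limits are picked by a choice operator, so none of
  them is linear or zero on the nose; they are used only through inner products, norms and almost
  everywhere identities, which do not depend on the choice. Moreover the evolution equation may only
  be tested with functions that are weakly differentiable in time, so it reaches a single slab
  through the fundamental lemma of the calculus of variations, which needs smooth cutoffs. The nodal
  values of \<open>d\<close> come from the continuous representative that the initial condition
  supplies. For \<open>\<phi>\<close> no such representative is built: its oscillation over a slab
  is controlled on a set of full measure. The approximate mean values of \<open>\<phi>\<close> carry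
  an accuracy k > 0. The gradient term of the energy inequality absorbs the gradient defect that k
  causes, and k is removed afterwards by letting it tend to 0.\<close>

lemma partial_deriv_eqI: "(f has_derivative D) (at x) \<Longrightarrow> partial_deriv b f x = D b"
  unfolding partial_deriv_def by (metis frechet_derivative_at)

lemma Ck_imp_continuous: "Ck k f \<Longrightarrow> continuous_on UNIV f"
  by (cases k) (auto intro: continuous_at_imp_continuous_on differentiable_imp_continuous_within)

lemma Ck_SucD: "Ck (Suc k) f \<Longrightarrow> Ck k f"
proof (induction k arbitrary: f)
  case 0 then show ?case using Ck_imp_continuous by (auto simp del: Ck.simps(2))
qed auto

lemma Ck_const: "Ck k (\<lambda>x. c)"
proof (induction k arbitrary: c)
  case (Suc k)
  have "partial_deriv b (\<lambda>x. c) = (\<lambda>x. 0)" for b :: 'a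
    by (rule ext, rule partial_deriv_eqI) simp
  with Suc show ?case by simp
qed simp

lemma partial_deriv_lincomb:
  assumes "f differentiable (at x)" "g differentiable (at x)"
  shows "partial_deriv b (\<lambda>x. r * f x + s * g x) x = r * partial_deriv b f x + s * partial_deriv b g x"
proof (rule partial_deriv_eqI)
  show "((\<lambda>x. r * f x + s * g x) has_derivative
     (\<lambda>b. r * partial_deriv b f x + s * partial_deriv b g x)) (at x)"
    unfolding partial_deriv_def
    using assms[unfolded frechet_derivative_works] by (auto intro!: derivative_eq_intros)
qed

lemma partial_deriv_mult:
  assumes "f differentiable (at x)" "g differentiable (at x)"
  shows "partial_deriv b (\<lambda>x. f x * g x) x = f x * partial_deriv b g x + partial_deriv b f x * g x"
proof (rule partial_deriv_eqI)
  show "((\<lambda>x. f x * g x) has_derivative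
     (\<lambda>b. f x * partial_deriv b g x + partial_deriv b f x * g x)) (at x)"
    unfolding partial_deriv_def
    using assms[unfolded frechet_derivative_works] by (auto intro!: derivative_eq_intros)
qed

lemma Ck_lincomb: "Ck k f \<Longrightarrow> Ck k g \<Longrightarrow> Ck k (\<lambda>x. r * f x + s * g x)"
proof (induction k arbitrary: f g)
  case 0 then show ?case by (auto intro!: continuous_intros)
next
  case (Suc k)
  have "partial_deriv b (\<lambda>x. r * f x + s * g x) = (\<lambda>x. r * partial_deriv b f x + s * partial_deriv b g x)" for b
    using Suc.prems by (auto intro!: ext partial_deriv_lincomb)
  with Suc show ?case by (auto intro!: derivative_intros)
qed

lemma Ck_add: "Ck k f \<Longrightarrow> Ck k g \<Longrightarrow> Ck k (\<lambda>x. f x + g x)"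
  using Ck_lincomb[of k f g 1 1] by simp

lemma Ck_mult: "Ck k f \<Longrightarrow> Ck k g \<Longrightarrow> Ck k (\<lambda>x. f x * g x)"
proof (induction k arbitrary: f g)
  case 0 then show ?case by (auto intro!: continuous_intros)
next
  case (Suc k)
  have "partial_deriv b (\<lambda>x. f x * g x) = (\<lambda>x. f x * partial_deriv b g x + partial_deriv b f x * g x)" for b
    using Suc.prems by (auto intro!: ext partial_deriv_mult)
  with Suc show ?case
    using Suc.prems[THEN Ck_SucD] by (auto intro!: derivative_intros Ck_add)
qed

lemma Ck_prod:
  assumes "\<And>i. i \<in> A \<Longrightarrow> Ck k (f i)"
  shows "Ck k (\<lambda>x. \<Prod>i\<in>A. f i x)"
  using assms by (induction A rule: infinite_finite_induct) (auto intro: Ck_const Ck_mult)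

lemma partial_deriv_real: "(f has_real_derivative D) (at x) \<Longrightarrow> partial_deriv b f x = D * b"
  by (rule partial_deriv_eqI) (simp add: has_field_derivative_def)

lemma Ck_Suc_real:
  assumes "\<And>x. (f has_real_derivative f' x) (at x)"
  shows "Ck (Suc k) f \<longleftrightarrow> Ck k f'"
proof -
  have "partial_deriv 1 f = f'" using partial_deriv_real[OF assms, of 1] by auto
  then show ?thesis
    using assms by (auto simp: Basis_real_def real_differentiable_def)
qed

lemma Ck_compose_affine:
  fixes f :: "real \<Rightarrow> real" and c :: "'a::euclidean_space"
  shows "Ck k f \<Longrightarrow> Ck k (\<lambda>x. f (x \<bullet> c + d))"
proof (induction k arbitrary: f)
  case 0 then show ?case
    by (auto intro!: continuous_intros intro: continuous_on_compose2)
next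
  case (Suc k)
  have df: "(f has_real_derivative partial_deriv 1 f x) (at x)" for x
    using Suc.prems partial_deriv_real[of f _ x 1] by (auto simp: real_differentiable_def)
  have der: "((\<lambda>x. f (x \<bullet> c + d)) has_derivative (\<lambda>h. partial_deriv 1 f (x \<bullet> c + d) * (h \<bullet> c))) (at x)" for x
  proof -
    have "((\<lambda>x. x \<bullet> c + d) has_derivative (\<lambda>h. h \<bullet> c)) (at x)"
      by (auto intro!: derivative_eq_intros)
    from has_derivative_compose[OF this df[unfolded has_field_derivative_def]] show ?thesis .
  qed
  \<comment> \<open>The spurious summand \<open>0 * 0\<close> gives the expression the shape
    required by \<open>Ck_lincomb\<close>.\<close>
  have "partial_deriv b (\<lambda>x. f (x \<bullet> c + d)) = (\<lambda>x. (b \<bullet> c) * (partial_deriv 1 f (x \<bullet> c + d)) + 0 * 0)" for b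
    by (rule ext) (simp add: partial_deriv_eqI[OF der])
  moreover have "Ck k (\<lambda>x. partial_deriv 1 f (x \<bullet> c + d))"
    using Suc.prems by (intro Suc.IH) (auto simp: Basis_real_def)
  ultimately show ?case
    using der Ck_lincomb[OF _ Ck_const[of k 0], of _ _ 0] by (auto simp: differentiable_def)
qed

text \<open>The derivative of exp(-1/y) is not a multiple of it, but the functions exp(-1/y) / y^n,
  extended by 0, are closed under differentiation up to linear combinations. Carrying the exponent
  \<open>n\<close> makes smoothness a plain induction on the order.\<close>

definition cutoff :: "nat \<Rightarrow> real \<Rightarrow> real" where
  "cutoff n y = (if y > 0 then exp (- 1 / y) / y ^ n else 0)"

lemma cutoff_at_right_0: "(cutoff n \<longlongrightarrow> 0) (at_right 0)"
proof -
  have "((\<lambda>y::real. inverse y ^ n / exp (inverse y)) \<longlongrightarrow> 0) (at_right 0)"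
    by (rule filterlim_compose[OF tendsto_power_div_exp_0 filterlim_inverse_at_top_right])
  moreover have "\<forall>\<^sub>F y in at_right (0::real). inverse y ^ n / exp (inverse y) = cutoff n y"
    using eventually_at_right_less[of "0::real"]
    by eventually_elim (auto simp: cutoff_def exp_minus field_simps)
  ultimately show ?thesis by (rule Lim_transform_eventually)
qed

lemma cutoff_has_derivative:
  "(cutoff n has_real_derivative (1 * cutoff (n + 2) y + (- real n) * cutoff (n + 1) y)) (at y)"
proof (cases y "0::real" rule: linorder_cases)
  case greater
  have "((\<lambda>y. exp (- 1 / y) / y ^ n) has_real_derivative (1 * cutoff (n + 2) y + (- real n) * cutoff (n + 1) y)) (at y)"
    using greater
    apply (auto intro!: derivative_eq_intros simp: cutoff_def)
    apply (cases n)
    apply (auto simp: field_simps power2_eq_square)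
    done
  then show ?thesis
    by (rule has_field_derivative_transform_within_open[of _ _ _ "{0<..}"]) (use greater in \<open>auto simp: cutoff_def\<close>)
next
  case less
  have "((\<lambda>y. 0) has_real_derivative (1 * cutoff (n + 2) y + (- real n) * cutoff (n + 1) y)) (at y)"
    using less by (auto simp: cutoff_def)
  then show ?thesis
    by (rule has_field_derivative_transform_within_open[of _ _ _ "{..<0}"]) (use less in \<open>auto simp: cutoff_def\<close>)
next
  \<comment> \<open>From the right, the difference quotient at 0 is itself a member of the family,
    with \<open>n\<close> raised by one, and therefore tends to 0.\<close>
  case equal
  have "((\<lambda>h. (cutoff n (0 + h) - cutoff n 0) / h) \<longlongrightarrow> 0) (at 0)"
    unfolding filterlim_at_split
  proof
    show "((\<lambda>h. (cutoff n (0 + h) - cutoff n 0) / h) \<longlongrightarrow> 0) (at_left 0)"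
      by (rule tendsto_eventually) (auto simp: eventually_at_filter cutoff_def)
    have "\<forall>\<^sub>F h in at_right 0. cutoff (n + 1) h = (cutoff n (0 + h) - cutoff n 0) / h"
      by (auto simp: eventually_at_filter cutoff_def)
    with cutoff_at_right_0[of "n + 1"]
    show "((\<lambda>h. (cutoff n (0 + h) - cutoff n 0) / h) \<longlongrightarrow> 0) (at_right 0)"
      by (rule Lim_transform_eventually)
  qed
  then show ?thesis using equal by (simp add: DERIV_def cutoff_def)
qed

lemma Ck_cutoff: "Ck k (cutoff n)"
proof (induction k arbitrary: n)
  case 0
  show ?case using Ck_imp_continuous[of "Suc 0"] cutoff_has_derivative
    by (auto intro!: continuous_at_imp_continuous_on DERIV_isCont)
next
  case (Suc k)
  show ?case
    unfolding Ck_Suc_real[OF cutoff_has_derivative] by (intro Ck_lincomb Suc)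
qed

text \<open>In each coordinate the arguments are k (x_i - a_i) - 1 and k (b_i - x_i) - 1. For k > 0
  both are positive exactly on the interval shrunk by 1/k at either end. They are spelled as affine
  functions of an inner product to fit \<open>Ck_compose_affine\<close>.\<close>

definition box_cutoff :: "'a::euclidean_space \<Rightarrow> 'a \<Rightarrow> nat \<Rightarrow> 'a \<Rightarrow> real" where
  "box_cutoff a b k x = (\<Prod>i\<in>Basis. cutoff 0 (x \<bullet> (real k *\<^sub>R i) + (- real k * (a \<bullet> i) - 1))
       * cutoff 0 (x \<bullet> ((- real k) *\<^sub>R i) + (real k * (b \<bullet> i) - 1)))"

lemma cutoff_bounds: "0 \<le> cutoff 0 y" "cutoff 0 y \<le> 1"
  by (auto simp: cutoff_def)

lemma box_cutoff_bounds: "0 \<le> box_cutoff a b k x" "box_cutoff a b k x \<le> 1"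
  unfolding box_cutoff_def
  by (auto intro!: prod_nonneg prod_le_1 mult_le_one cutoff_bounds mult_nonneg_nonneg)

lemma box_cutoff_Cc_infty:
  assumes "box a b \<subseteq> S"
  shows "box_cutoff a b k \<in> Cc_infty S"
proof -
  have "Ck j (box_cutoff a b k)" for j
    unfolding box_cutoff_def[abs_def] by (intro Ck_prod Ck_mult Ck_compose_affine Ck_cutoff)
  moreover have "\<exists>K. compact K \<and> K \<subseteq> S \<and> (\<forall>x. x \<notin> K \<longrightarrow> box_cutoff a b k x = 0)"
  proof (cases "k = 0")
    \<comment> \<open>For k = 0 the margin 1/k is meaningless; all arguments equal -1, the function
      vanishes and the empty set serves as support.\<close>
    case True
    have "box_cutoff a b k x = 0" for x
      using True nonempty_Basis by (auto simp: box_cutoff_def cutoff_def prod_zero_iff)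
    then show ?thesis by (intro exI[of _ "{}"]) auto
  next
    case False
    define K where "K = cbox (a + (1 / real k) *\<^sub>R One) (b - (1 / real k) *\<^sub>R One)"
    have "K \<subseteq> box a b"
    proof
      fix x assume x: "x \<in> K"
      have p: "1 / real k > 0" using False by simp
      show "x \<in> box a b"
        unfolding mem_box
      proof
        fix i :: 'a assume "i \<in> Basis"
        with x have "a \<bullet> i + 1 / real k \<le> x \<bullet> i \<and> x \<bullet> i \<le> b \<bullet> i - 1 / real k"
          by (auto simp: K_def mem_box inner_simps)
        then show "a \<bullet> i < x \<bullet> i \<and> x \<bullet> i < b \<bullet> i" using p by linarith
      qed
    qed
    moreover have "box_cutoff a b k x = 0" if "x \<notin> K" for x
    proof -
      from that obtain i :: 'a where i: "i \<in> Basis"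
        "\<not> (a \<bullet> i + 1 / real k \<le> x \<bullet> i \<and> x \<bullet> i \<le> b \<bullet> i - 1 / real k)"
        by (auto simp: K_def mem_box inner_simps)
      then have "cutoff 0 (x \<bullet> (real k *\<^sub>R i) + (- real k * (a \<bullet> i) - 1))
       * cutoff 0 (x \<bullet> ((- real k) *\<^sub>R i) + (real k * (b \<bullet> i) - 1)) = 0"
        using False by (auto simp: cutoff_def field_simps)
      with i(1) show ?thesis by (auto simp: box_cutoff_def prod_zero_iff)
    qed
    ultimately show ?thesis using assms by (intro exI[of _ K]) (auto simp: K_def)
  qed
  ultimately show ?thesis by (auto simp: Cc_infty_def)
qed

text \<open>Outside the box some argument is at most -1 for every \<open>k\<close>; inside, all
  arguments tend to infinity, where \<open>cutoff 0\<close> tends to 1.\<close>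

lemma box_cutoff_tendsto: "(\<lambda>k. box_cutoff a b k x) \<longlonglongrightarrow> indicator (box a b) x"
proof (cases "x \<in> box a b")
  case True
  have cut: "(\<lambda>k. cutoff 0 (real k * c - 1)) \<longlonglongrightarrow> 1" if "c > 0" for c
  proof -
    have lim: "filterlim (\<lambda>k. real k * c - 1) at_top sequentially"
      using that by real_asymp
    have "((\<lambda>y. exp (- 1 / y)) \<longlongrightarrow> (1::real)) at_top" by real_asymp
    moreover have "\<forall>\<^sub>F y in at_top. exp (- 1 / y) = cutoff 0 y"
      using eventually_gt_at_top[of 0] by eventually_elim (auto simp: cutoff_def)
    ultimately have "(cutoff 0 \<longlongrightarrow> 1) at_top" by (rule Lim_transform_eventually)
    from filterlim_compose[OF this lim] show ?thesis by simp
  qed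
  have "(\<lambda>k. \<Prod>i\<in>Basis. cutoff 0 (real k * (x \<bullet> i - a \<bullet> i) - 1) * cutoff 0 (real k * (b \<bullet> i - x \<bullet> i) - 1))
     \<longlonglongrightarrow> (\<Prod>i\<in>(Basis::'a set). 1 * 1)"
    using True by (intro tendsto_prod tendsto_mult cut) (auto simp: mem_box)
  then show ?thesis using True by (simp add: box_cutoff_def algebra_simps)
next
  case False
  then obtain i :: 'a where i: "i \<in> Basis" "\<not> (a \<bullet> i < x \<bullet> i \<and> x \<bullet> i < b \<bullet> i)"
    by (auto simp: mem_box)
  have "box_cutoff a b k x = 0" for k
  proof -
    have "real k * (x \<bullet> i) \<le> real k * (a \<bullet> i) \<or> real k * (b \<bullet> i) \<le> real k * (x \<bullet> i)"
      using i(2) by (meson mult_left_mono not_le of_nat_0_le_iff)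
    then have "cutoff 0 (x \<bullet> (real k *\<^sub>R i) + (- real k * (a \<bullet> i) - 1))
       * cutoff 0 (x \<bullet> ((- real k) *\<^sub>R i) + (real k * (b \<bullet> i) - 1)) = 0"
      by (auto simp: cutoff_def)
    with i(1) show ?thesis by (auto simp: box_cutoff_def prod_zero_iff)
  qed
  then show ?thesis using False by simp
qed

section \<open>The fundamental lemma of the calculus of variations\<close>

lemmas LINT_cong = Bochner_Integration.integral_cong and LINT_bound = Bochner_Integration.integrable_bound

text \<open>A Borel version \<open>g\<close> of \<open>f\<close> reduces the claim to Borel sets.
  Boxes form a generator stable under intersection, so the integral of \<open>g\<close> vanishes
  over every Borel set by induction over complements and disjoint unions, and these integrals
  determine a density. As \<open>f\<close> vanishes outside a box, the integral over the whole space
  is one of the box integrals; the step to complements relies on this.\<close>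

lemma box_integrals_zero_imp_AE_zero:
  fixes f :: "'a::euclidean_space \<Rightarrow> real"
  assumes f: "integrable lebesgue f" and supp: "\<And>x. x \<notin> box p q \<Longrightarrow> f x = 0"
    and zero: "\<And>a b. (LINT x|lebesgue. indicator (box a b) x * f x) = 0"
  shows "AE x in lebesgue. f x = 0"
proof -
  obtain g where g[measurable]: "g \<in> borel_measurable lborel" and fg: "AE x in lborel. f x = g x"
    using completion_ex_borel_measurable_real[of f lborel] f by auto
  have fg': "AE x in lebesgue. f x = g x" using fg by (rule AE_completion)
  have "integrable lebesgue g"
    by (rule integrable_cong_AE_imp[OF f]) (use g fg' in \<open>auto intro: measurable_completion\<close>)
  then have gi: "integrable lborel g" by (simp add: integrable_completion)
  have eq: "(LINT x|lborel. indicator A x * g x) = (LINT x|lebesgue. indicator A x * f x)"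
    if A[measurable]: "A \<in> sets borel" for A
  proof -
    have [measurable]: "(indicator A :: 'a \<Rightarrow> real) \<in> borel_measurable lebesgue"
      by (intro borel_measurable_indicator) simp
    have "(LINT x|lborel. indicator A x * g x) = (LINT x|lebesgue. indicator A x * g x)"
      by (rule integral_completion[symmetric]) simp
    also have "\<dots> = (LINT x|lebesgue. indicator A x * f x)"
      using f fg' by (intro integral_cong_AE) (auto intro: measurable_completion)
    finally show ?thesis .
  qed
  have "(LINT x|lborel. g x) = (LINT x|lborel. indicator (box p q) x * g x)"
    unfolding eq[OF box_borel] eq[of UNIV, simplified]
    by (rule LINT_cong) (use supp in \<open>auto simp: indicator_def\<close>)
  then have UN: "(LINT x|lborel. g x) = 0" by (simp add: eq zero)
  have Z: "(LINT x:A|lborel. g x) = 0" if "A \<in> sets borel" for A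
  proof -
    have mem: "B \<in> sets borel" if "B \<in> sigma_sets UNIV (range (\<lambda>(a, b). box a b :: 'a set))" for B
      using that unfolding borel_eq_box by (simp add: sets_measure_of)
    have "Int_stable (range (\<lambda>(a, b). box a b :: 'a set))"
      by (auto simp: Int_stable_def box_Int_box)
    moreover have "range (\<lambda>(a, b). box a b :: 'a set) \<subseteq> Pow UNIV" by simp
    moreover have "A \<in> sigma_sets UNIV (range (\<lambda>(a, b). box a b :: 'a set))"
      using that unfolding borel_eq_box by (simp add: sets_measure_of)
    ultimately show ?thesis
    proof (induction A rule: sigma_sets_induct_disjoint)
      case (basic A)
      then show ?case by (auto simp: set_lebesgue_integral_def eq zero)
    next
      case (compl A)
      then have [measurable]: "A \<in> sets borel" by (auto intro: mem)
      have "(LINT x:UNIV - A|lborel. g x) = (LINT x|lborel. g x - indicator A x *\<^sub>R g x)"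
        unfolding set_lebesgue_integral_def
        by (rule LINT_cong) (auto simp: indicator_def)
      also have "\<dots> = (LINT x|lborel. g x) - (LINT x:A|lborel. g x)"
        unfolding set_lebesgue_integral_def
        by (rule Bochner_Integration.integral_diff) (use gi integrable_mult_indicator[of A lborel g] in auto)
      finally show ?case using compl UN by simp
    next
      case (union A)
      then have [measurable]: "\<And>i. A i \<in> sets borel" by (auto intro: mem)
      have "(LINT x:(\<Union>i. A i)|lborel. g x) = (\<Sum>i. (LINT x:(A i)|lborel. g x))"
        using union(1) by (intro lebesgue_integral_countable_add)
          (use gi integrable_mult_indicator[of _ lborel g] in
            \<open>auto simp: disjoint_family_on_def set_integrable_def\<close>)
      with union show ?case by simp
    qed (auto simp: set_lebesgue_integral_def)
  qed
  have "AE x in lborel. g x = (\<lambda>_. 0) x"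
    by (rule density_unique_real) (auto simp: gi Z)
  then have "AE x in lebesgue. g x = 0" by (intro AE_completion) simp
  with fg' show ?thesis by eventually_elim simp
qed

text \<open>Box cutoffs are bounded by 1 and converge to the indicator of the box, so dominated
  convergence gives \<open>g\<close> integral zero over every box inside \<open>S\<close>. Countably
  many such boxes cover \<open>S\<close>, and on each of them the preceding lemma applies because
  the intersection of two boxes is a box.\<close>

proposition fundamental_lemma:
  fixes g :: "'a::euclidean_space \<Rightarrow> real"
  assumes S: "open S" and g: "integrable (lebesgue_on S) g"
    and zero: "\<And>\<eta>. \<eta> \<in> Cc_infty S \<Longrightarrow> (LINT x|lebesgue_on S. g x * \<eta> x) = 0"
  shows "AE x in lebesgue_on S. g x = 0"
proof -
  have Sl[simp]: "S \<in> sets lebesgue" using S by simp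
  have box: "(LINT x|lebesgue_on S. g x * indicator (box a b) x) = 0" if "box a b \<subseteq> S" for a b
  proof -
    have c: "box_cutoff a b k \<in> Cc_infty S" for k by (rule box_cutoff_Cc_infty[OF that])
    have [measurable]: "box_cutoff a b k \<in> borel_measurable (lebesgue_on S)" for k
      using c[of k] Sl Ck_imp_continuous[of 0 "box_cutoff a b k"]
      by (intro continuous_imp_measurable_on_sets_lebesgue)
         (auto simp: Cc_infty_def intro: continuous_on_subset)
    have [measurable]: "(indicator (box a b) :: 'a \<Rightarrow> real) \<in> borel_measurable (lebesgue_on S)"
      by (intro measurable_restrict_space1 borel_measurable_indicator) simp
    have "(\<lambda>k. LINT x|lebesgue_on S. g x * box_cutoff a b k x)
        \<longlonglongrightarrow> (LINT x|lebesgue_on S. g x * indicator (box a b) x)"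
    proof (rule integral_dominated_convergence[where w = "\<lambda>x. \<bar>g x\<bar>"])
      show "AE x in lebesgue_on S. (\<lambda>k. g x * box_cutoff a b k x) \<longlonglongrightarrow> g x * indicator (box a b) x"
        by (auto intro!: tendsto_intros box_cutoff_tendsto)
      show "AE x in lebesgue_on S. norm (g x * box_cutoff a b k x) \<le> \<bar>g x\<bar>" for k
        using box_cutoff_bounds[of a b k] by (auto simp: abs_mult intro!: mult_left_le)
    qed (use g in auto)
    then show ?thesis using zero[OF c] by (simp add: LIMSEQ_const_iff)
  qed
  obtain \<D> where \<D>: "countable \<D>" "\<D> \<subseteq> Pow S" "\<And>X. X \<in> \<D> \<Longrightarrow> \<exists>a b. X = box a b" "\<Union>\<D> = S"
    using open_countable_Union_open_box[OF S] by metis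
  have "AE x in lebesgue. \<forall>X\<in>\<D>. x \<in> X \<longrightarrow> g x = 0"
  proof (subst AE_ball_countable[OF \<D>(1)], intro ballI)
    fix X assume "X \<in> \<D>"
    with \<D> obtain p q where X: "X = box p q" "box p q \<subseteq> S" by blast
    have i: "integrable lebesgue (\<lambda>x. indicator S x * g x)"
      using g by (simp add: integrable_restrict_space)
    have "AE x in lebesgue. indicator X x * (indicator S x * g x) = 0"
    proof (rule box_integrals_zero_imp_AE_zero[of _ p q])
      show "integrable lebesgue (\<lambda>x. indicator X x * (indicator S x * g x))"
        using integrable_mult_indicator[of "box p q" lebesgue, OF _ i] X by simp
      fix a b
      obtain c d where cd: "box a b \<inter> box p q = box c d" using box_Int_box[of a b p q] that by blast
      have "(LINT x|lebesgue. indicator (box a b) x * (indicator X x * (indicator S x * g x)))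
         = (LINT x|lebesgue. indicator S x *\<^sub>R (g x * indicator (box c d) x))"
        by (rule LINT_cong)
           (auto simp: X(1) cd[symmetric] indicator_def)
      also have "\<dots> = (LINT x|lebesgue_on S. g x * indicator (box c d) x)"
        by (rule integral_restrict_space[symmetric]) simp
      also have "\<dots> = 0" using cd X by (intro box) blast
      finally show "(LINT x|lebesgue. indicator (box a b) x * (indicator X x * (indicator S x * g x))) = 0" .
    qed (auto simp: X)
    then show "AE x in lebesgue. x \<in> X \<longrightarrow> g x = 0"
      by eventually_elim (use X in \<open>auto simp: indicator_def split: if_splits\<close>)
  qed
  then have "AE x in lebesgue. x \<in> S \<longrightarrow> g x = 0"
    by eventually_elim (use \<D>(4) in blast)
  then show ?thesis by (simp add: AE_restrict_space_iff)
qed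

section \<open>The spaces $L^2$, $H^1$ and $H^1_0$\<close>

text \<open>One algebra for four forms: the L^2 product, the gradient form, and the H^1 product on
  H^1 and on H^1_0. Only semidefiniteness is assumed, since functions stand for classes and the
  gradient form does not see constants. \<open>nonneg\<close> is free of membership, so
  \<open>N\<close> is a genuine square root of \<open>q u u\<close> for every function.\<close>

locale ip_form =
  fixes Y :: "('a \<Rightarrow> real) set" and q :: "('a \<Rightarrow> real) \<Rightarrow> ('a \<Rightarrow> real) \<Rightarrow> real"
  assumes zero_mem: "(\<lambda>x. 0) \<in> Y"
    and lincomb_mem: "u \<in> Y \<Longrightarrow> v \<in> Y \<Longrightarrow> (\<lambda>x. a * u x + b * v x) \<in> Y"
    and lincomb_left: "u \<in> Y \<Longrightarrow> v \<in> Y \<Longrightarrow> w \<in> Y \<Longrightarrow> q (\<lambda>x. a * u x + b * v x) w = a * q u w + b * q v w"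
    and sym: "u \<in> Y \<Longrightarrow> v \<in> Y \<Longrightarrow> q u v = q v u"
    and nonneg: "0 \<le> q u u"
begin

definition N :: "('a \<Rightarrow> real) \<Rightarrow> real" where "N u = sqrt (q u u)"

lemma N_nonneg: "0 \<le> N u" by (simp add: N_def nonneg)

lemma N_power2: "(N u)\<^sup>2 = q u u" by (simp add: N_def nonneg)

lemma lincomb_right:
  "u \<in> Y \<Longrightarrow> v \<in> Y \<Longrightarrow> w \<in> Y \<Longrightarrow> q w (\<lambda>x. a * u x + b * v x) = a * q w u + b * q w v"
  using lincomb_left[of u v w a b] sym[of w "\<lambda>x. a * u x + b * v x"] sym[of w u] sym[of w v]
    lincomb_mem[of u v a b] by simp

lemma scale_mem: "u \<in> Y \<Longrightarrow> (\<lambda>x. a * u x) \<in> Y"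
  using lincomb_mem[of u u a 0] by simp

lemma diff_mem: "u \<in> Y \<Longrightarrow> v \<in> Y \<Longrightarrow> (\<lambda>x. u x - v x) \<in> Y"
  using lincomb_mem[of u v 1 "-1"] by simp

lemma scale_left: "u \<in> Y \<Longrightarrow> w \<in> Y \<Longrightarrow> q (\<lambda>x. a * u x) w = a * q u w"
  using lincomb_left[of u u w a 0] by simp

lemma zero_left: "w \<in> Y \<Longrightarrow> q (\<lambda>x. 0) w = 0"
  using scale_left[OF zero_mem, of w 0] by simp

lemma zero_right: "w \<in> Y \<Longrightarrow> q w (\<lambda>x. 0) = 0"
  using zero_left zero_mem sym by metis

lemma diff_left: "u \<in> Y \<Longrightarrow> v \<in> Y \<Longrightarrow> w \<in> Y \<Longrightarrow> q (\<lambda>x. u x - v x) w = q u w - q v w"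
  using lincomb_left[of u v w 1 "-1"] by simp

lemma diff_right: "u \<in> Y \<Longrightarrow> v \<in> Y \<Longrightarrow> w \<in> Y \<Longrightarrow> q w (\<lambda>x. u x - v x) = q w u - q w v"
  using lincomb_right[of u v w 1 "-1"] by simp

lemma cauchy_schwarz:
  assumes "u \<in> Y" "v \<in> Y"
  shows "\<bar>q u v\<bar> \<le> N u * N v"
proof -
  have quad: "0 \<le> q u u * s\<^sup>2 + 2 * q u v * s + q v v" for s
  proof -
    have "0 \<le> q (\<lambda>x. s * u x + 1 * v x) (\<lambda>x. s * u x + 1 * v x)" by (rule nonneg)
    also have "\<dots> = q u u * s\<^sup>2 + 2 * q u v * s + q v v"
      using assms lincomb_mem[of u v s 1] sym[of v u]
      by (simp only: lincomb_left lincomb_right) (simp add: algebra_simps power2_eq_square)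
    finally show ?thesis .
  qed
  have "(q u v)\<^sup>2 \<le> q u u * q v v"
  proof (cases "q u u = 0")
    case True
    have "q u v = 0"
    proof (rule ccontr)
      assume "q u v \<noteq> 0"
      \<comment> \<open>At this argument the affine function \<open>2 * q u v * s + q v v\<close>
        takes the value -1.\<close>
      then show False using quad[of "- (q v v + 1) / (2 * q u v)"] True by simp
    qed
    then show ?thesis using True by simp
  next
    case False
    with nonneg[of u] have p: "q u u > 0" by simp
    have "0 \<le> q u u * (q u u * (- q u v / q u u)\<^sup>2 + 2 * q u v * (- q u v / q u u) + q v v)"
      using p quad[of "- q u v / q u u"] by simp
    also have "\<dots> = q u u * q v v - (q u v)\<^sup>2"
      using p by (simp add: field_simps power2_eq_square)
    finally show ?thesis by simp
  qed
  then have "sqrt ((q u v)\<^sup>2) \<le> sqrt (q u u * q v v)" by (rule real_sqrt_le_mono)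
  then show ?thesis by (simp add: N_def real_sqrt_mult)
qed

lemma N_lincomb_le:
  assumes "u \<in> Y" "v \<in> Y"
  shows "N (\<lambda>x. a * u x + b * v x) \<le> \<bar>a\<bar> * N u + \<bar>b\<bar> * N v"
proof (rule power2_le_imp_le)
  have "(N (\<lambda>x. a * u x + b * v x))\<^sup>2 = a\<^sup>2 * q u u + 2 * (a * b) * q u v + b\<^sup>2 * q v v"
    unfolding N_power2 using assms lincomb_mem[of u v a b] sym[of v u]
    by (simp only: lincomb_left lincomb_right) (simp add: algebra_simps power2_eq_square)
  also have "\<dots> \<le> a\<^sup>2 * q u u + 2 * (\<bar>a * b\<bar> * (N u * N v)) + b\<^sup>2 * q v v"
  proof -
    have "a * b * q u v \<le> \<bar>a * b\<bar> * \<bar>q u v\<bar>" by (metis abs_ge_self abs_mult)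
    also have "\<dots> \<le> \<bar>a * b\<bar> * (N u * N v)"
      by (intro mult_left_mono cauchy_schwarz assms) simp
    finally show ?thesis by simp
  qed
  also have "\<dots> = (\<bar>a\<bar> * N u + \<bar>b\<bar> * N v)\<^sup>2"
    by (simp add: power2_sum power_mult_distrib N_power2 abs_mult)
  finally show "(N (\<lambda>x. a * u x + b * v x))\<^sup>2 \<le> (\<bar>a\<bar> * N u + \<bar>b\<bar> * N v)\<^sup>2" .
qed (simp add: N_nonneg)

lemma N_add_le: "u \<in> Y \<Longrightarrow> v \<in> Y \<Longrightarrow> N (\<lambda>x. u x + v x) \<le> N u + N v"
  using N_lincomb_le[of u v 1 1] by simp

lemma N_diff_le: "u \<in> Y \<Longrightarrow> v \<in> Y \<Longrightarrow> N (\<lambda>x. u x - v x) \<le> N u + N v"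
  using N_lincomb_le[of u v 1 "-1"] by simp

lemma N_commute: "u \<in> Y \<Longrightarrow> v \<in> Y \<Longrightarrow> N (\<lambda>x. u x - v x) = N (\<lambda>x. v x - u x)"
  unfolding N_def by (simp add: diff_left diff_right diff_mem sym)

lemma N_triangle: "u \<in> Y \<Longrightarrow> v \<in> Y \<Longrightarrow> w \<in> Y \<Longrightarrow> N (\<lambda>x. u x - w x) \<le> N (\<lambda>x. u x - v x) + N (\<lambda>x. v x - w x)"
  using N_add_le[of "\<lambda>x. u x - v x" "\<lambda>x. v x - w x"] diff_mem by simp

lemma N_zero: "N (\<lambda>x. 0) = 0"
  by (simp add: N_def zero_left zero_mem)

lemma N_triangle_abs:
  assumes "u \<in> Y" "v \<in> Y"
  shows "\<bar>N u - N v\<bar> \<le> N (\<lambda>x. u x - v x)"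
  using N_triangle[of u v "\<lambda>x. 0"] N_triangle[of v u "\<lambda>x. 0"] N_commute[of u v] assms zero_mem
  by simp

end

section \<open>The semi-inner product of square integrable functions\<close>

lemma L2_inner_integrable:
  assumes f: "f \<in> L2 \<Omega>" and g: "g \<in> L2 \<Omega>"
  shows "integrable (lebesgue_on \<Omega>) (\<lambda>x. f x \<bullet> g x)"
proof (rule LINT_bound)
  show "integrable (lebesgue_on \<Omega>) (\<lambda>x. (norm (f x))\<^sup>2 + (norm (g x))\<^sup>2)"
    using f g by (auto simp: L2_def)
  show "(\<lambda>x. f x \<bullet> g x) \<in> borel_measurable (lebesgue_on \<Omega>)"
    using f g by (auto simp: L2_def)
  show "AE x in lebesgue_on \<Omega>. norm (f x \<bullet> g x) \<le> norm ((norm (f x))\<^sup>2 + (norm (g x))\<^sup>2)"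
  proof (rule AE_I2)
    fix x
    have "norm (f x \<bullet> g x) \<le> norm (f x) * norm (g x)" using Cauchy_Schwarz_ineq2 by simp
    also have "\<dots> \<le> (norm (f x))\<^sup>2 + (norm (g x))\<^sup>2"
      using sum_squares_bound[of "norm (f x)" "norm (g x)"]
        mult_nonneg_nonneg[OF norm_ge_zero[of "f x"] norm_ge_zero[of "g x"]] by linarith
    finally show "norm (f x \<bullet> g x) \<le> norm ((norm (f x))\<^sup>2 + (norm (g x))\<^sup>2)" by simp
  qed
qed

lemma L2_lincomb:
  assumes f: "f \<in> L2 \<Omega>" and g: "g \<in> L2 \<Omega>"
  shows "(\<lambda>x. a *\<^sub>R f x + b *\<^sub>R g x) \<in> L2 \<Omega>"
proof -
  have [measurable]: "f \<in> borel_measurable (lebesgue_on \<Omega>)" "g \<in> borel_measurable (lebesgue_on \<Omega>)"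
    using f g by (auto simp: L2_def)
  have "integrable (lebesgue_on \<Omega>) (\<lambda>x. a\<^sup>2 * (f x \<bullet> f x) + (2 * a * b) * (f x \<bullet> g x) + b\<^sup>2 * (g x \<bullet> g x))"
    using f g by (auto intro!: Bochner_Integration.integrable_add L2_inner_integrable)
  moreover have "(norm (a *\<^sub>R f x + b *\<^sub>R g x))\<^sup>2
      = a\<^sup>2 * (f x \<bullet> f x) + (2 * a * b) * (f x \<bullet> g x) + b\<^sup>2 * (g x \<bullet> g x)" for x
    unfolding power2_norm_eq_inner
    by (simp add: inner_simps algebra_simps power2_eq_square inner_commute)
  ultimately show ?thesis by (simp add: L2_def)
qed

lemma L2_inner_lincomb_left:
  assumes "f \<in> L2 \<Omega>" "g \<in> L2 \<Omega>" "h \<in> L2 \<Omega>"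
  shows "L2_inner \<Omega> (\<lambda>x. a *\<^sub>R f x + b *\<^sub>R g x) h = a * L2_inner \<Omega> f h + b * L2_inner \<Omega> g h"
proof -
  have "L2_inner \<Omega> (\<lambda>x. a *\<^sub>R f x + b *\<^sub>R g x) h
      = (LINT x|lebesgue_on \<Omega>. a * (f x \<bullet> h x) + b * (g x \<bullet> h x))"
    by (simp add: L2_inner_def inner_simps)
  also have "\<dots> = a * L2_inner \<Omega> f h + b * L2_inner \<Omega> g h"
    using assms by (simp add: L2_inner_integrable L2_inner_def)
  finally show ?thesis .
qed

lemma L2_inner_commute: "L2_inner \<Omega> f g = L2_inner \<Omega> g f"
  by (simp add: L2_inner_def inner_commute)

lemma L2_inner_nonneg: "0 \<le> L2_inner \<Omega> f f"
  by (simp add: L2_inner_def integral_nonneg_AE)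

lemma zero_in_L2: "(\<lambda>x. 0) \<in> L2 \<Omega>"
  by (simp add: L2_def)

interpretation L2: ip_form "L2 \<Omega>" "L2_inner \<Omega>" for \<Omega> :: "'a::euclidean_space set"
proof
  fix u v w :: "'a \<Rightarrow> real" and a b :: real
  assume "u \<in> L2 \<Omega>" "v \<in> L2 \<Omega>"
  then show "(\<lambda>x. a * u x + b * v x) \<in> L2 \<Omega>" using L2_lincomb[of u \<Omega> v a b] by simp
  assume "w \<in> L2 \<Omega>"
  then show "L2_inner \<Omega> (\<lambda>x. a * u x + b * v x) w = a * L2_inner \<Omega> u w + b * L2_inner \<Omega> v w"
    using L2_inner_lincomb_left[of u \<Omega> v w a b] \<open>u \<in> L2 \<Omega>\<close> \<open>v \<in> L2 \<Omega>\<close> by simp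
qed (auto simp: zero_in_L2 L2_inner_nonneg intro: L2_inner_commute)

lemma L2_N_eq: "L2.N \<Omega> = L2_norm \<Omega>"
  by (auto simp: L2.N_def L2_norm_def)

section \<open>Test functions and the integrals of their derivatives\<close>

lemma Cc_infty_lincomb:
  assumes "\<eta> \<in> Cc_infty S" "\<xi> \<in> Cc_infty S"
  shows "(\<lambda>x. a * \<eta> x + b * \<xi> x) \<in> Cc_infty S"
proof -
  obtain K K' where "compact K" "K \<subseteq> S" "\<forall>x. x \<notin> K \<longrightarrow> \<eta> x = 0" "compact K'" "K' \<subseteq> S" "\<forall>x. x \<notin> K' \<longrightarrow> \<xi> x = 0"
    using assms by (auto simp: Cc_infty_def)
  then have "compact (K \<union> K') \<and> K \<union> K' \<subseteq> S \<and> (\<forall>x. x \<notin> K \<union> K' \<longrightarrow> a * \<eta> x + b * \<xi> x = 0)"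
    by auto
  with assms show ?thesis
    unfolding Cc_infty_def by (blast intro: Ck_lincomb)
qed

lemma Cc_infty_mult:
  assumes "\<eta> \<in> Cc_infty S" "\<xi> \<in> Cc_infty S"
  shows "(\<lambda>x. \<eta> x * \<xi> x) \<in> Cc_infty S"
  using assms unfolding Cc_infty_def by (auto intro!: Ck_mult)

lemma Cc_infty_differentiable: "\<eta> \<in> Cc_infty S \<Longrightarrow> \<eta> differentiable (at x)"
  using Ck.simps(2)[of 0 \<eta>] by (auto simp: Cc_infty_def simp del: Ck.simps)

lemma Cc_infty_continuous: "\<eta> \<in> Cc_infty S \<Longrightarrow> continuous_on A \<eta>"
  using Ck_imp_continuous[of 0 \<eta>] by (auto simp: Cc_infty_def intro: continuous_on_subset)

lemma Cc_infty_partial_deriv_continuous: "\<eta> \<in> Cc_infty S \<Longrightarrow> b \<in> Basis \<Longrightarrow> continuous_on A (partial_deriv b \<eta>)"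
  using Ck.simps(2)[of 0 \<eta>] by (auto simp: Cc_infty_def simp del: Ck.simps(2) intro: continuous_on_subset)

lemma partial_deriv_eq_0:
  assumes "compact K" "\<And>x. x \<notin> K \<Longrightarrow> f x = 0" "x \<notin> K"
  shows "partial_deriv b f x = 0"
proof (rule partial_deriv_eqI)
  have "((\<lambda>x. 0) has_derivative (\<lambda>b. 0)) (at x)" by simp
  then show "(f has_derivative (\<lambda>b. 0)) (at x)"
    by (rule has_derivative_transform_within_open[of _ _ _ _ "- K"])
       (use assms compact_imp_closed in \<open>auto\<close>)
qed

lemma has_real_derivative_along:
  assumes "f differentiable (at (x + s *\<^sub>R b))"
  shows "((\<lambda>s. f (x + s *\<^sub>R b)) has_real_derivative partial_deriv b f (x + s *\<^sub>R b)) (at s)"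
proof -
  have 1: "((\<lambda>s. x + s *\<^sub>R b) has_derivative (\<lambda>h. h *\<^sub>R b)) (at s)"
    by (auto intro!: derivative_eq_intros)
  let ?D = "frechet_derivative f (at (x + s *\<^sub>R b))"
  have 2: "(f has_derivative ?D) (at (x + s *\<^sub>R b))"
    using assms frechet_derivative_works by blast
  have "?D (h *\<^sub>R b) = partial_deriv b f (x + s *\<^sub>R b) * h" for h
    using 2 by (simp add: partial_deriv_def has_derivative_linear linear_cmul)
  with has_derivative_compose[OF 1 2] show ?thesis
    by (simp add: has_field_derivative_def mult_commute_abs)
qed

text \<open>By translation invariance all difference quotients of \<open>f\<close> have integral zero.\<close>

lemma integral_partial_deriv_eq_0:
  fixes f :: "'a::euclidean_space \<Rightarrow> real"
  assumes S: "S \<in> sets lebesgue" and f: "f \<in> Cc_infty S" and b: "b \<in> Basis"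
  shows "(LINT x|lebesgue_on S. partial_deriv b f x) = 0"
proof -
  obtain K where K: "compact K" "K \<subseteq> S" "\<And>x. x \<notin> K \<Longrightarrow> f x = 0"
    using f by (auto simp: Cc_infty_def)
  note cont = Cc_infty_partial_deriv_continuous[OF f b]
  have D0: "partial_deriv b f x = 0" if "x \<notin> K" for x
    using partial_deriv_eq_0[OF K(1) K(3) that] by simp
  obtain B0 where "\<And>x. x \<in> K \<Longrightarrow> norm (partial_deriv b f x) \<le> B0"
    using compact_continuous_image[OF cont K(1), THEN compact_imp_bounded]
    by (auto simp: bounded_iff)
  then have B: "\<bar>partial_deriv b f x\<bar> \<le> max 0 B0" for x
    using D0 by (cases "x \<in> K") fastforce+
  obtain R where R: "\<And>x. x \<in> K \<Longrightarrow> norm x \<le> R"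
    using compact_imp_bounded[OF K(1)] by (auto simp: bounded_iff)
  define h where "h n = 1 / real (Suc n)" for n
  have h: "0 < h n" "h n \<le> 1" for n by (auto simp: h_def)
  define Q where "Q n x = (f (x + h n *\<^sub>R b) - f x) / h n" for n x
  have [measurable]: "f \<in> borel_measurable borel"
    by (intro borel_measurable_continuous_onI Cc_infty_continuous[OF f])
  have [measurable]: "partial_deriv b f \<in> borel_measurable borel"
    by (intro borel_measurable_continuous_onI cont)
  have fi: "integrable lborel f"
  proof -
    have "integrable lborel (\<lambda>x. indicator K x *\<^sub>R f x)"
      by (rule borel_integrable_compact[OF K(1) Cc_infty_continuous[OF f]])
    moreover have "(\<lambda>x. indicator K x *\<^sub>R f x) = f"
      using K(3) by (auto simp: indicator_def fun_eq_iff)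
    ultimately show ?thesis by simp
  qed
  have trans: "integrable lborel (\<lambda>x. f (x + c))" "(LINT x|lborel. f (x + c)) = (LINT x|lborel. f x)" for c
  proof -
    have "integrable (distr lborel borel ((+) c)) f" using fi by (simp add: lborel_distr_plus)
    then show "integrable lborel (\<lambda>x. f (x + c))" by (simp add: integrable_distr_eq add.commute)
    have "(LINT x|lborel. f (x + c)) = (LINT x|distr lborel borel ((+) c). f x)"
      by (simp add: integral_distr add.commute)
    then show "(LINT x|lborel. f (x + c)) = (LINT x|lborel. f x)" by (simp add: lborel_distr_plus)
  qed
  have Qz: "(LINT x|lborel. Q n x) = 0" for n
    unfolding Q_def using trans fi by simp
  \<comment> \<open>The mean value theorem bounds the difference quotients by the maximum of the
    derivative and lets them vanish at all points farther than \<open>h n\<close> from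
    \<open>K\<close>; this provides the integrable majorant.\<close>
  have MV: "\<exists>s. 0 < s \<and> s < h n \<and> Q n x = partial_deriv b f (x + s *\<^sub>R b)" for n x
  proof -
    have "\<exists>s>0. s < h n \<and> f (x + h n *\<^sub>R b) - f (x + 0 *\<^sub>R b) = (h n - 0) * partial_deriv b f (x + s *\<^sub>R b)"
      by (rule MVT2) (auto intro!: h has_real_derivative_along Cc_infty_differentiable[OF f])
    then show ?thesis using h(1)[of n] by (auto simp: Q_def field_simps)
  qed
  have "(\<lambda>n. LINT x|lborel. Q n x) \<longlonglongrightarrow> (LINT x|lborel. partial_deriv b f x)"
  proof (rule integral_dominated_convergence[where w = "\<lambda>x. indicator (cball 0 (R + 1)) x * max 0 B0"])
    show "integrable lborel (\<lambda>x::'a. indicator (cball 0 (R + 1)) x * max 0 B0)"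
      using borel_integrable_compact[of "cball (0::'a) (R + 1)" "\<lambda>_. max 0 B0"] by simp
    show "AE x in lborel. (\<lambda>n. Q n x) \<longlonglongrightarrow> partial_deriv b f x"
    proof (rule AE_I2)
      fix x
      have "((\<lambda>s. (f (x + (0 + s) *\<^sub>R b) - f (x + 0 *\<^sub>R b)) / s) \<longlongrightarrow> partial_deriv b f (x + 0 *\<^sub>R b)) (at 0)"
        using has_real_derivative_along[of f x 0 b] Cc_infty_differentiable[OF f]
        unfolding DERIV_def by blast
      moreover have "filterlim h (at 0) sequentially"
      proof (rule filterlim_atI)
        show "h \<longlonglongrightarrow> 0" unfolding h_def by (rule LIMSEQ_Suc[OF lim_1_over_n])
        show "\<forall>\<^sub>F n in sequentially. h n \<noteq> 0" using h(1) by (auto simp: less_le)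
      qed
      ultimately show "(\<lambda>n. Q n x) \<longlonglongrightarrow> partial_deriv b f x"
        using filterlim_compose by (fastforce simp: Q_def)
    qed
    show "AE x in lborel. norm (Q n x) \<le> indicator (cball 0 (R + 1)) x * max 0 B0" for n
    proof (rule AE_I2)
      fix x
      obtain s where s: "0 < s" "s < h n" "Q n x = partial_deriv b f (x + s *\<^sub>R b)" using MV by blast
      show "norm (Q n x) \<le> indicator (cball 0 (R + 1)) x * max 0 B0"
      proof (cases "norm x \<le> R + 1")
        case True then show ?thesis using B s(3) by simp
      next
        case False
        have "norm x \<le> norm (x + s *\<^sub>R b) + norm (s *\<^sub>R b)" by (metis add_diff_cancel norm_triangle_ineq4)
        moreover have "norm (s *\<^sub>R b) \<le> 1" using s h(2)[of n] b by simp
        ultimately have "x + s *\<^sub>R b \<notin> K" using R False by force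
        then show ?thesis using s(3) D0 by simp
      qed
    qed
  qed (auto simp: Q_def)
  then have "(LINT x|lborel. partial_deriv b f x) = 0"
    using Qz by (simp add: LIMSEQ_const_iff)
  moreover have "(LINT x|lebesgue_on S. partial_deriv b f x) = (LINT x|lebesgue. indicator S x *\<^sub>R partial_deriv b f x)"
    using S by (intro integral_restrict_space) auto
  moreover have "\<dots> = (LINT x|lebesgue. partial_deriv b f x)"
    by (rule LINT_cong) (use D0 K(2) in \<open>auto simp: indicator_def\<close>)
  moreover have "\<dots> = (LINT x|lborel. partial_deriv b f x)"
    by (intro integral_completion) simp
  ultimately show ?thesis by simp
qed


text \<open>Instantiated with the spatial domain and also with open time intervals, so that the same
  facts about test functions serve in space and in time. Boundedness makes continuous functions
  square integrable.\<close>

locale bounded_open_domain =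
  fixes \<Omega> :: "'a::euclidean_space set"
  assumes op: "open \<Omega>" and bd: "bounded \<Omega>"
begin

section \<open>Square integrability and weak gradients on a bounded open set\<close>

lemma lebesgue_set[simp]: "\<Omega> \<in> sets lebesgue" using op by simp

lemma finite_measure: "finite_measure (lebesgue_on \<Omega>)"
  by (rule finite_measure_lebesgue_on[OF bounded_set_imp_lmeasurable[OF bd lebesgue_set]])

lemma continuous_in_L2:
  fixes f :: "'a \<Rightarrow> 'b::euclidean_space"
  assumes "continuous_on UNIV f"
  shows "f \<in> L2 \<Omega>"
proof -
  interpret finite_measure "lebesgue_on \<Omega>" by (rule finite_measure)
  have [measurable]: "f \<in> borel_measurable (lebesgue_on \<Omega>)"
    using assms by (intro continuous_imp_measurable_on_sets_lebesgue) (auto intro: continuous_on_subset)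
  have "bounded (f ` closure \<Omega>)"
    using assms bd by (intro compact_imp_bounded compact_continuous_image) (auto intro: continuous_on_subset)
  then obtain B where B: "\<And>x. x \<in> closure \<Omega> \<Longrightarrow> norm (f x) \<le> B" by (auto simp: bounded_iff)
  have "integrable (lebesgue_on \<Omega>) (\<lambda>x. (norm (f x))\<^sup>2)"
  proof (rule integrable_const_bound)
    show "AE x in lebesgue_on \<Omega>. norm ((norm (f x))\<^sup>2) \<le> B\<^sup>2"
      using B closure_subset[of \<Omega>] by (auto intro!: AE_I2 power_mono)
  qed simp
  then show ?thesis by (simp add: L2_def)
qed

lemma Cc_infty_L2: "\<eta> \<in> Cc_infty S \<Longrightarrow> \<eta> \<in> L2 \<Omega>"
  by (intro continuous_in_L2 Cc_infty_continuous)

lemma Cc_infty_partial_deriv_L2: "\<eta> \<in> Cc_infty S \<Longrightarrow> b \<in> Basis \<Longrightarrow> partial_deriv b \<eta> \<in> L2 \<Omega>"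
  by (intro continuous_in_L2 Cc_infty_partial_deriv_continuous)

lemma L2_component: "g \<in> L2 \<Omega> \<Longrightarrow> (\<lambda>x. g x \<bullet> b) \<in> L2 \<Omega>"
proof -
  assume g: "g \<in> L2 \<Omega>"
  have [measurable]: "g \<in> borel_measurable (lebesgue_on \<Omega>)" using g by (simp add: L2_def)
  have "integrable (lebesgue_on \<Omega>) (\<lambda>x. (norm (g x \<bullet> b))\<^sup>2)"
  proof (rule LINT_bound)
    show "integrable (lebesgue_on \<Omega>) (\<lambda>x. (norm b)\<^sup>2 * (norm (g x))\<^sup>2)"
      using g by (simp add: L2_def)
    show "AE x in lebesgue_on \<Omega>. norm ((norm (g x \<bullet> b))\<^sup>2) \<le> norm ((norm b)\<^sup>2 * (norm (g x))\<^sup>2)"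
    proof (rule AE_I2)
      fix x
      have "(norm (g x \<bullet> b))\<^sup>2 \<le> (norm (g x) * norm b)\<^sup>2"
        using Cauchy_Schwarz_ineq2[of "g x" b] by (intro power_mono) auto
      then show "norm ((norm (g x \<bullet> b))\<^sup>2) \<le> norm ((norm b)\<^sup>2 * (norm (g x))\<^sup>2)"
        by (simp add: power_mult_distrib mult.commute)
    qed
  qed simp
  then show ?thesis by (simp add: L2_def)
qed

text \<open>The fundamental lemma is applied to each of the finitely many components. Uniqueness
  makes up for \<open>weak_grad\<close> being a choice: the chosen gradients are linear almost
  everywhere, which is enough under integrals.\<close>

lemma is_weak_grad_unique:
  assumes g: "is_weak_grad \<Omega> u g" and h: "is_weak_grad \<Omega> u h"
  shows "AE x in lebesgue_on \<Omega>. g x = h x"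
proof -
  have gL: "g \<in> L2 \<Omega>" and hL: "h \<in> L2 \<Omega>" using g h by (auto simp: is_weak_grad_def)
  have "AE x in lebesgue_on \<Omega>. (g x - h x) \<bullet> b = 0" if b: "b \<in> Basis" for b
  proof (rule fundamental_lemma[OF op])
    have "(\<lambda>x. g x - h x) \<in> L2 \<Omega>" using L2_lincomb[OF gL hL, of 1 "-1"] by simp
    then show "integrable (lebesgue_on \<Omega>) (\<lambda>x. (g x - h x) \<bullet> b)"
      by (rule L2_inner_integrable) (auto intro: continuous_in_L2)
    fix \<eta> assume eta: "\<eta> \<in> Cc_infty \<Omega>"
    have "L2_inner \<Omega> (\<lambda>x. g x \<bullet> b - h x \<bullet> b) \<eta> = 0"
      using L2.diff_left[OF L2_component[OF gL] L2_component[OF hL] Cc_infty_L2[OF eta]] g h eta b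
      by (simp add: is_weak_grad_def)
    then show "(LINT x|lebesgue_on \<Omega>. (g x - h x) \<bullet> b * \<eta> x) = 0"
      by (simp add: L2_inner_def inner_diff_left)
  qed
  then have "AE x in lebesgue_on \<Omega>. \<forall>b\<in>Basis. (g x - h x) \<bullet> b = 0"
    by (subst AE_ball_countable) (auto intro: countable_finite)
  then show ?thesis
    by eventually_elim (simp add: euclidean_eq_iff[where 'a='a] inner_diff_left)
qed

lemma is_weak_grad_lincomb:
  assumes u: "u \<in> L2 \<Omega>" "is_weak_grad \<Omega> u g" and v: "v \<in> L2 \<Omega>" "is_weak_grad \<Omega> v h"
  shows "is_weak_grad \<Omega> (\<lambda>x. a * u x + b * v x) (\<lambda>x. a *\<^sub>R g x + b *\<^sub>R h x)"
proof -
  have gL: "g \<in> L2 \<Omega>" and hL: "h \<in> L2 \<Omega>" using u v by (auto simp: is_weak_grad_def)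
  have "L2_inner \<Omega> (\<lambda>x. a * u x + b * v x) (partial_deriv c \<eta>)
      = - L2_inner \<Omega> (\<lambda>x. (a *\<^sub>R g x + b *\<^sub>R h x) \<bullet> c) \<eta>"
    if "\<eta> \<in> Cc_infty \<Omega>" "c \<in> Basis" for \<eta> c
    using L2.lincomb_left[OF u(1) v(1) Cc_infty_partial_deriv_L2[OF that], of a b]
      L2.lincomb_left[OF L2_component[OF gL] L2_component[OF hL] Cc_infty_L2[OF that(1)], of a c b c] u(2) v(2) that
    by (simp add: is_weak_grad_def inner_add_left)
  with L2_lincomb[OF gL hL] show ?thesis by (simp add: is_weak_grad_def)
qed

lemma is_weak_grad_weak_grad: "u \<in> H1 \<Omega> \<Longrightarrow> is_weak_grad \<Omega> u (weak_grad \<Omega> u)"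
  unfolding H1_def weak_grad_def using someI_ex[of "is_weak_grad \<Omega> u"] by auto

lemma weak_grad_L2: "u \<in> H1 \<Omega> \<Longrightarrow> weak_grad \<Omega> u \<in> L2 \<Omega>"
  using is_weak_grad_weak_grad by (auto simp: is_weak_grad_def)

lemma H1_lincomb: "u \<in> H1 \<Omega> \<Longrightarrow> v \<in> H1 \<Omega> \<Longrightarrow> (\<lambda>x. a * u x + b * v x) \<in> H1 \<Omega>"
  using is_weak_grad_lincomb L2.lincomb_mem unfolding H1_def by blast

lemma weak_grad_lincomb:
  assumes "u \<in> H1 \<Omega>" "v \<in> H1 \<Omega>"
  shows "AE x in lebesgue_on \<Omega>. weak_grad \<Omega> (\<lambda>x. a * u x + b * v x) x
    = a *\<^sub>R weak_grad \<Omega> u x + b *\<^sub>R weak_grad \<Omega> v x"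
  using assms by (intro is_weak_grad_unique[OF is_weak_grad_weak_grad[OF H1_lincomb]] is_weak_grad_lincomb
    is_weak_grad_weak_grad) (auto simp: H1_def)

section \<open>The gradient form, the H^1 form and the closure of the test functions\<close>

definition grad_inner :: "('a \<Rightarrow> real) \<Rightarrow> ('a \<Rightarrow> real) \<Rightarrow> real" where
  "grad_inner u v = L2_inner \<Omega> (weak_grad \<Omega> u) (weak_grad \<Omega> v)"

definition H1_inner :: "('a \<Rightarrow> real) \<Rightarrow> ('a \<Rightarrow> real) \<Rightarrow> real" where
  "H1_inner u v = L2_inner \<Omega> u v + grad_inner u v"

text \<open>The product of two test functions is a test function, so the integral of its derivative
  vanishes, which is integration by parts against the classical gradient. Applied to the zero
  function it also provides \<open>zero_mem\<close> for H^1.\<close>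

lemma Cc_infty_H1:
  assumes e: "\<eta> \<in> Cc_infty \<Omega>"
  shows "\<eta> \<in> H1 \<Omega>"
proof -
  define g where "g x = (\<Sum>b\<in>Basis. partial_deriv b \<eta> x *\<^sub>R b)" for x
  have gb: "g x \<bullet> b = partial_deriv b \<eta> x" if "b \<in> Basis" for x b
    using that by (simp add: g_def inner_sum_left inner_Basis if_distrib cong: if_cong)
  have "g \<in> L2 \<Omega>"
    unfolding g_def[abs_def]
    by (intro continuous_in_L2 continuous_intros Cc_infty_partial_deriv_continuous[OF e])
  moreover have "L2_inner \<Omega> \<eta> (partial_deriv b \<xi>) = - L2_inner \<Omega> (\<lambda>x. g x \<bullet> b) \<xi>"
    if xi: "\<xi> \<in> Cc_infty \<Omega>" and b: "b \<in> Basis" for \<xi> b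
  proof -
    have "partial_deriv b (\<lambda>x. \<eta> x * \<xi> x) = (\<lambda>x. \<eta> x * partial_deriv b \<xi> x + partial_deriv b \<eta> x * \<xi> x)"
      using e xi by (intro ext partial_deriv_mult Cc_infty_differentiable)
    then have "0 = (LINT x|lebesgue_on \<Omega>. \<eta> x \<bullet> partial_deriv b \<xi> x + partial_deriv b \<eta> x \<bullet> \<xi> x)"
      using integral_partial_deriv_eq_0[OF lebesgue_set Cc_infty_mult[OF e xi] b] by simp
    also have "\<dots> = L2_inner \<Omega> \<eta> (partial_deriv b \<xi>) + L2_inner \<Omega> (partial_deriv b \<eta>) \<xi>"
      unfolding L2_inner_def
      by (intro Bochner_Integration.integral_add L2_inner_integrable Cc_infty_L2 Cc_infty_partial_deriv_L2 e xi b)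
        (auto intro: e xi)
    finally show ?thesis by (simp add: gb b)
  qed
  ultimately have "is_weak_grad \<Omega> \<eta> g" by (simp add: is_weak_grad_def)
  then show ?thesis using Cc_infty_L2[OF e] by (auto simp: H1_def)
qed

lemma grad_inner_lincomb_left:
  assumes "u \<in> H1 \<Omega>" "v \<in> H1 \<Omega>" "w \<in> H1 \<Omega>"
  shows "grad_inner (\<lambda>x. a * u x + b * v x) w = a * grad_inner u w + b * grad_inner v w"
proof -
  note L = assms[THEN weak_grad_L2]
  have "grad_inner (\<lambda>x. a * u x + b * v x) w
      = L2_inner \<Omega> (\<lambda>x. a *\<^sub>R weak_grad \<Omega> u x + b *\<^sub>R weak_grad \<Omega> v x) (weak_grad \<Omega> w)"
    unfolding grad_inner_def L2_inner_def
  proof (rule integral_cong_AE)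
    show "AE x in lebesgue_on \<Omega>. weak_grad \<Omega> (\<lambda>x. a * u x + b * v x) x \<bullet> weak_grad \<Omega> w x =
            (a *\<^sub>R weak_grad \<Omega> u x + b *\<^sub>R weak_grad \<Omega> v x) \<bullet> weak_grad \<Omega> w x"
      using weak_grad_lincomb[OF assms(1,2), of a b] by eventually_elim simp
  qed (use L weak_grad_L2[OF H1_lincomb[OF assms(1,2), of a b]] in \<open>auto simp: L2_def\<close>)
  then show ?thesis using L2_inner_lincomb_left[OF L, of a b] by (simp add: grad_inner_def)
qed

lemma H1_sub_L2: "H1 \<Omega> \<subseteq> L2 \<Omega>" by (auto simp: H1_def)

lemma zero_in_Cc_infty: "(\<lambda>x. 0) \<in> Cc_infty S"
  by (auto simp: Cc_infty_def intro: Ck_const)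

sublocale grad: ip_form "H1 \<Omega>" grad_inner
proof
  show "grad_inner u v = grad_inner v u" for u v unfolding grad_inner_def by (rule L2_inner_commute)
qed (auto intro: H1_lincomb Cc_infty_H1[OF zero_in_Cc_infty] simp: grad_inner_lincomb_left,
  simp add: grad_inner_def L2_inner_nonneg)

sublocale H1: ip_form "H1 \<Omega>" H1_inner
proof
  fix u v w :: "'a \<Rightarrow> real" and a b :: real
  assume "u \<in> H1 \<Omega>" "v \<in> H1 \<Omega>" "w \<in> H1 \<Omega>"
  then show "H1_inner (\<lambda>x. a * u x + b * v x) w = a * H1_inner u w + b * H1_inner v w"
    using H1_sub_L2 by (simp add: H1_inner_def grad.lincomb_left L2.lincomb_left subset_iff algebra_simps)
next
  fix u v :: "'a \<Rightarrow> real"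
  assume "u \<in> H1 \<Omega>" "v \<in> H1 \<Omega>"
  then show "H1_inner u v = H1_inner v u"
    unfolding H1_inner_def using grad.sym[of u v] L2_inner_commute[of \<Omega> u v] by simp
qed (auto simp: H1_inner_def grad.nonneg L2.nonneg grad.zero_mem H1_lincomb)

lemma H1_N_eq: "H1.N = H1_norm \<Omega>"
  by (auto simp: H1.N_def H1_norm_def H1_inner_def grad_inner_def L2_norm_def L2_inner_nonneg)

lemma H10_lincomb:
  assumes u: "u \<in> H10 \<Omega>" and v: "v \<in> H10 \<Omega>"
  shows "(\<lambda>x. a * u x + b * v x) \<in> H10 \<Omega>"
proof -
  have H: "u \<in> H1 \<Omega>" "v \<in> H1 \<Omega>" using u v by (auto simp: H10_def)
  have "\<exists>\<zeta>\<in>Cc_infty \<Omega>. H1_norm \<Omega> (\<lambda>x. (a * u x + b * v x) - \<zeta> x) < e" if "e > 0" for e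
  proof -
    \<comment> \<open>The summand 1 keeps the denominator positive for a = b = 0 and makes the final
      inequality strict.\<close>
    define e' where "e' = e / (\<bar>a\<bar> + \<bar>b\<bar> + 1)"
    have e': "e' > 0" using that by (auto simp: e'_def)
    obtain \<eta> \<xi> where ex: "\<eta> \<in> Cc_infty \<Omega>" "H1.N (\<lambda>x. u x - \<eta> x) < e'" "\<xi> \<in> Cc_infty \<Omega>" "H1.N (\<lambda>x. v x - \<xi> x) < e'"
      using u v e' unfolding H10_def H1_N_eq by blast
    have "H1.N (\<lambda>x. (a * u x + b * v x) - (a * \<eta> x + b * \<xi> x))
        = H1.N (\<lambda>x. a * (u x - \<eta> x) + b * (v x - \<xi> x))" by (simp add: algebra_simps)
    also have "\<dots> \<le> \<bar>a\<bar> * H1.N (\<lambda>x. u x - \<eta> x) + \<bar>b\<bar> * H1.N (\<lambda>x. v x - \<xi> x)"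
      using ex H by (intro H1.N_lincomb_le H1.diff_mem) (auto intro: Cc_infty_H1)
    also have "\<dots> \<le> \<bar>a\<bar> * e' + \<bar>b\<bar> * e'"
      using ex by (intro add_mono mult_left_mono) auto
    also have "\<dots> < (\<bar>a\<bar> + \<bar>b\<bar> + 1) * e'" using e' by (simp add: algebra_simps)
    also have "\<dots> = e" by (simp add: e'_def)
    finally show ?thesis
      using Cc_infty_lincomb[OF ex(1,3), of a b] by (auto simp: H1_N_eq intro!: bexI[of _ "\<lambda>x. a * \<eta> x + b * \<xi> x"])
  qed
  then show ?thesis using H1_lincomb[OF H] by (auto simp: H10_def)
qed

lemma H10_sub_H1: "H10 \<Omega> \<subseteq> H1 \<Omega>" by (auto simp: H10_def)

lemma zero_in_H10: "(\<lambda>x. 0) \<in> H10 \<Omega>"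
  using zero_in_Cc_infty[of \<Omega>] Cc_infty_H1[OF zero_in_Cc_infty] H1.N_zero
  by (auto simp: H10_def H1_N_eq intro!: bexI[of _ "\<lambda>x. 0"])

text \<open>This instance is the value space of \<open>\<phi>\<close> and of the elliptic test
  functions; linear combinations staying inside it is what keeps the approximate mean values of
  \<open>\<phi>\<close> in H^1_0.\<close>

sublocale H10: ip_form "H10 \<Omega>" H1_inner
  using H10_sub_H1 H10_lincomb zero_in_H10
  by unfold_locales (simp_all add: H1.lincomb_left H1.nonneg subset_iff, metis H1.sym)

end

section \<open>Bochner spaces\<close>

text \<open>Completeness of Lebesgue measure, transported to a subset by extension with zero. It
  replaces measurability proofs for expressions that are known only almost everywhere.\<close>

lemma borel_measurable_lebesgue_on_AE:
  fixes f :: "'a::euclidean_space \<Rightarrow> 'b::euclidean_space"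
  assumes S: "S \<in> sets lebesgue" and f: "f \<in> borel_measurable (lebesgue_on S)"
    and ae: "AE x in lebesgue_on S. f x = g x"
  shows "g \<in> borel_measurable (lebesgue_on S)"
proof (rule borel_measurable_if_D)
  show "(\<lambda>x. if x \<in> S then g x else 0) \<in> borel_measurable lebesgue"
  proof (rule borel_measurable_AE[OF borel_measurable_if_I[OF f S]])
    show "AE x in lebesgue. (if x \<in> S then f x else 0) = (if x \<in> S then g x else 0)"
      using ae S by (simp add: AE_restrict_space_iff)
  qed
qed

lemma borel_measurable_lebesgue_on_LIMSEQ_AE:
  fixes f :: "nat \<Rightarrow> 'a::euclidean_space \<Rightarrow> real"
  assumes S: "S \<in> sets lebesgue" and f: "\<And>i. f i \<in> borel_measurable (lebesgue_on S)"
    and ae: "AE x in lebesgue_on S. (\<lambda>i. f i x) \<longlonglongrightarrow> g x"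
  shows "g \<in> borel_measurable (lebesgue_on S)"
proof (rule borel_measurable_lebesgue_on_AE[OF S borel_measurable_lim_metric[of f, OF f]])
  show "AE x in lebesgue_on S. lim (\<lambda>i. f i x) = g x"
    using ae by eventually_elim (rule limI)
qed

locale bochner = ip_form Y q for Y :: "('a \<Rightarrow> real) set" and q +
  fixes J :: "real set"
  assumes J: "J \<in> lmeasurable"
begin

text \<open>Linearity and the explicit bound \<open>c\<close> are asked for on \<open>Y\<close>
  only. Such functionals stand in for vector-valued integration: measurability, integrability and
  integrals of \<open>u\<close> are phrased through the scalar function
  \<open>L (u t)\<close>.\<close>

definition bdd_functional :: "(('a \<Rightarrow> real) \<Rightarrow> real) \<Rightarrow> real \<Rightarrow> bool" where
  "bdd_functional L c \<longleftrightarrow> 0 \<le> c \<and> (\<forall>u\<in>Y. \<bar>L u\<bar> \<le> c * N u) \<and>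
     (\<forall>u\<in>Y. \<forall>v\<in>Y. \<forall>a b. L (\<lambda>x. a * u x + b * v x) = a * L u + b * L v)"

lemma J_sets: "J \<in> sets lebesgue" using J by (rule fmeasurableD)

lemma finite_measure_J: "finite_measure (lebesgue_on J)"
  using J by (rule finite_measure_lebesgue_on)

abbreviation "space_L2 \<equiv> bochner_L2 J Y N"

section \<open>Measurability and approximate integration of vector-valued functions\<close>

lemma bochner_L2_approx:
  assumes "u \<in> space_L2"
  obtains s where "\<And>k. simple_function (lebesgue_on J) (s k)" "\<And>k t. t \<in> J \<Longrightarrow> s k t \<in> Y"
    "AE t in lebesgue_on J. (\<lambda>k. N (\<lambda>x. s k t x - u t x)) \<longlonglongrightarrow> 0"
  using assms unfolding bochner_L2_def by blast

lemma bochner_L2_AE: "u \<in> space_L2 \<Longrightarrow> AE t in lebesgue_on J. u t \<in> Y"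
  by (simp add: bochner_L2_def)

lemma bochner_L2_power2_integrable: "u \<in> space_L2 \<Longrightarrow> integrable (lebesgue_on J) (\<lambda>t. (N (u t))\<^sup>2)"
  by (simp add: bochner_L2_def)

lemma N_integrable:
  assumes "u \<in> space_L2"
  shows "integrable (lebesgue_on J) (\<lambda>t. N (u t))"
proof (rule LINT_bound)
  interpret finite_measure "lebesgue_on J" by (rule finite_measure_J)
  note i = bochner_L2_power2_integrable[OF assms]
  show "integrable (lebesgue_on J) (\<lambda>t. 1 + (N (u t))\<^sup>2)" using i by simp
  have "(\<lambda>t. sqrt ((N (u t))\<^sup>2)) \<in> borel_measurable (lebesgue_on J)" using i by measurable
  then show "(\<lambda>t. N (u t)) \<in> borel_measurable (lebesgue_on J)" by (simp add: N_nonneg)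
  show "AE t in lebesgue_on J. norm (N (u t)) \<le> norm (1 + (N (u t))\<^sup>2)"
  proof (rule AE_I2)
    fix t
    show "norm (N (u t)) \<le> norm (1 + (N (u t))\<^sup>2)"
      using sum_squares_bound[of 1 "N (u t)"] N_nonneg[of "u t"] by simp
  qed
qed

lemma bdd_functional_bound: "bdd_functional L c \<Longrightarrow> u \<in> Y \<Longrightarrow> \<bar>L u\<bar> \<le> c * N u"
  by (simp add: bdd_functional_def)

lemma bdd_functional_lincomb: "bdd_functional L c \<Longrightarrow> u \<in> Y \<Longrightarrow> v \<in> Y \<Longrightarrow>
    L (\<lambda>x. a * u x + b * v x) = a * L u + b * L v"
  unfolding bdd_functional_def by (elim conjE) (drule (1) bspec, drule (1) bspec, blast)

lemma bdd_functional_diff: "bdd_functional L c \<Longrightarrow> u \<in> Y \<Longrightarrow> v \<in> Y \<Longrightarrow> L (\<lambda>x. u x - v x) = L u - L v"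
  using bdd_functional_lincomb[of L c u v 1 "-1"] by simp

lemma bdd_functional_zero: "bdd_functional L c \<Longrightarrow> L (\<lambda>x. 0) = 0"
  using bdd_functional_diff[of L c "\<lambda>x. 0" "\<lambda>x. 0"] zero_mem by simp

lemma bdd_functional_tendsto:
  assumes L: "bdd_functional L c" and "\<And>k. s k \<in> Y" "u \<in> Y" "(\<lambda>k. N (\<lambda>x. s k x - u x)) \<longlonglongrightarrow> 0"
  shows "(\<lambda>k. L (s k)) \<longlonglongrightarrow> L u"
proof -
  have "(\<lambda>k. L (s k) - L u) \<longlonglongrightarrow> 0"
  proof (rule Lim_null_comparison)
    show "\<forall>\<^sub>F k in sequentially. norm (L (s k) - L u) \<le> c * N (\<lambda>x. s k x - u x)"
      using bdd_functional_bound[OF L diff_mem[OF assms(2,3)]] bdd_functional_diff[OF L assms(2,3)]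
      by (intro always_eventually allI) simp
    show "(\<lambda>k. c * N (\<lambda>x. s k x - u x)) \<longlonglongrightarrow> 0" using tendsto_mult_right_zero[OF assms(4)] .
  qed
  then show ?thesis by (simp add: LIM_zero_iff)
qed

text \<open>Composed with a simple function, \<open>L\<close> gives a simple function again, and
  boundedness of \<open>L\<close> turns convergence of the approximants in norm into convergence of
  these scalar functions.\<close>

lemma functional_measurable:
  assumes u: "u \<in> space_L2" and L: "bdd_functional L c"
  shows "(\<lambda>t. L (u t)) \<in> borel_measurable (lebesgue_on J)"
proof -
  obtain s where s: "\<And>k. simple_function (lebesgue_on J) (s k)" "\<And>k t. t \<in> J \<Longrightarrow> s k t \<in> Y"
    "AE t in lebesgue_on J. (\<lambda>k. N (\<lambda>x. s k t x - u t x)) \<longlonglongrightarrow> 0"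
    by (rule bochner_L2_approx[OF u]) (rule that)
  show ?thesis
  proof (rule borel_measurable_lebesgue_on_LIMSEQ_AE[OF J_sets])
    show "(\<lambda>t. L (s k t)) \<in> borel_measurable (lebesgue_on J)" for k
      by (rule borel_measurable_simple_function[OF simple_function_compose1[OF s(1)]])
    show "AE t in lebesgue_on J. (\<lambda>k. L (s k t)) \<longlonglongrightarrow> L (u t)"
      using s(3) bochner_L2_AE[OF u] AE_space
      by eventually_elim (simp add: bdd_functional_tendsto[OF L] s(2))
  qed
qed

lemma functional_integrable:
  assumes u: "u \<in> space_L2" and L: "bdd_functional L c"
  shows "integrable (lebesgue_on J) (\<lambda>t. L (u t))"
proof (rule LINT_bound)
  show "integrable (lebesgue_on J) (\<lambda>t. c * N (u t))" using N_integrable[OF u] by simp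
  show "AE t in lebesgue_on J. norm (L (u t)) \<le> norm (c * N (u t))"
    using bochner_L2_AE[OF u]
  proof eventually_elim
    fix t assume "u t \<in> Y"
    then have "\<bar>L (u t)\<bar> \<le> c * N (u t)" using L by (simp add: bdd_functional_def)
    then show "norm (L (u t)) \<le> norm (c * N (u t))" by (metis abs_ge_self order_trans real_norm_def)
  qed
qed (rule functional_measurable[OF u L])

lemma bdd_functional_inner: "v \<in> Y \<Longrightarrow> bdd_functional (\<lambda>u. q u v) (N v)"
  unfolding bdd_functional_def
  by (auto simp: N_nonneg lincomb_left intro: order_trans[OF cauchy_schwarz] simp: mult.commute)

text \<open>The simple functions of the definition of \<open>bochner_L2\<close> need not be dominated; they are
  cut off where they are at distance more than 1 from \<open>u\<close>.\<close>

lemma simple_approx: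
  assumes u: "u \<in> space_L2" and e: "e > 0"
  obtains s where "simple_function (lebesgue_on J) s" "\<And>t. t \<in> J \<Longrightarrow> s t \<in> Y"
    "integrable (lebesgue_on J) (\<lambda>t. N (\<lambda>x. s t x - u t x))"
    "(LINT t|lebesgue_on J. N (\<lambda>x. s t x - u t x)) < e"
proof -
  interpret finite_measure "lebesgue_on J" by (rule finite_measure_J)
  obtain s where s: "\<And>k. simple_function (lebesgue_on J) (s k)" "\<And>k t. t \<in> J \<Longrightarrow> s k t \<in> Y"
    "AE t in lebesgue_on J. (\<lambda>k. N (\<lambda>x. s k t x - u t x)) \<longlonglongrightarrow> 0"
    by (rule bochner_L2_approx[OF u]) (rule that)
  \<comment> \<open>The definition says nothing about measurability of the distance to
    \<open>u\<close>. It is the limit, as j grows, of the simple functions that measure the distance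
    of \<open>s k\<close> to \<open>s j\<close>.\<close>
  have m[measurable]: "(\<lambda>t. N (\<lambda>x. s k t x - u t x)) \<in> borel_measurable (lebesgue_on J)" for k
  proof (rule borel_measurable_lebesgue_on_LIMSEQ_AE[OF J_sets])
    show "(\<lambda>t. N (\<lambda>x. s k t x - s j t x)) \<in> borel_measurable (lebesgue_on J)" for j
      by (rule borel_measurable_simple_function[OF simple_function_compose2[where h = "\<lambda>y z. N (\<lambda>x. y x - z x)"]])
        (rule s)+
    show "AE t in lebesgue_on J. (\<lambda>j. N (\<lambda>x. s k t x - s j t x)) \<longlonglongrightarrow> N (\<lambda>x. s k t x - u t x)"
      using s(3) bochner_L2_AE[OF u] AE_space
    proof eventually_elim
      case (elim t)
      then have t: "t \<in> J" "u t \<in> Y" by auto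
      have "(\<lambda>j. N (\<lambda>x. s k t x - s j t x) - N (\<lambda>x. s k t x - u t x)) \<longlonglongrightarrow> 0"
      proof (rule Lim_null_comparison[OF _ elim(1)], intro always_eventually allI)
        fix j
        show "norm (N (\<lambda>x. s k t x - s j t x) - N (\<lambda>x. s k t x - u t x)) \<le> N (\<lambda>x. s j t x - u t x)"
          using N_triangle_abs[OF diff_mem[OF s(2)[OF t(1), of k] s(2)[OF t(1), of j]]
              diff_mem[OF s(2)[OF t(1), of k] t(2)]]
            N_commute[OF s(2)[OF t(1), of j] t(2)] by simp
      qed
      then show ?case by (simp add: LIM_zero_iff)
    qed
  qed
  define r where "r k t = (if N (\<lambda>x. s k t x - u t x) \<le> 1 then s k t else (\<lambda>x. 0))" for k t
  have r1: "simple_function (lebesgue_on J) (r k)" for k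
  proof -
    have "{t \<in> space (lebesgue_on J). N (\<lambda>x. s k t x - u t x) \<le> 1} \<in> sets (lebesgue_on J)"
      by measurable
    then show ?thesis
      unfolding r_def by (intro simple_function_If s simple_function_const)
  qed
  have r2: "r k t \<in> Y" if "t \<in> J" for k t
    using s(2)[OF that] zero_mem by (simp add: r_def)
  have Nu: "N (\<lambda>x. - u t x) = N (u t)" if "u t \<in> Y" for t
    using N_commute[OF that zero_mem] by simp
  have m2[measurable]: "(\<lambda>t. N (\<lambda>x. r k t x - u t x)) \<in> borel_measurable (lebesgue_on J)" for k
  proof (rule borel_measurable_lebesgue_on_AE[OF J_sets])
    show "(\<lambda>t. if N (\<lambda>x. s k t x - u t x) \<le> 1 then N (\<lambda>x. s k t x - u t x) else N (u t))
       \<in> borel_measurable (lebesgue_on J)"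
      using N_integrable[OF u] by measurable
    show "AE t in lebesgue_on J. (if N (\<lambda>x. s k t x - u t x) \<le> 1 then N (\<lambda>x. s k t x - u t x) else N (u t))
        = N (\<lambda>x. r k t x - u t x)"
      using bochner_L2_AE[OF u] by eventually_elim (auto simp: r_def Nu)
  qed
  \<comment> \<open>Either the distance is at most 1, or the approximant has been replaced by zero
    and the distance is \<open>N (u t)\<close>.\<close>
  have bound: "AE t in lebesgue_on J. norm (N (\<lambda>x. r k t x - u t x)) \<le> 1 + N (u t)" for k
    using bochner_L2_AE[OF u]
    by eventually_elim (auto simp: r_def Nu N_nonneg add_increasing2)
  have ib: "integrable (lebesgue_on J) (\<lambda>t. 1 + N (u t))" using N_integrable[OF u] by simp
  have "(\<lambda>k. LINT t|lebesgue_on J. N (\<lambda>x. r k t x - u t x)) \<longlonglongrightarrow> (LINT t|lebesgue_on J. 0)"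
  proof (rule integral_dominated_convergence[OF _ m2 ib _ bound])
    show "AE t in lebesgue_on J. (\<lambda>k. N (\<lambda>x. r k t x - u t x)) \<longlonglongrightarrow> 0"
      using s(3)
    proof eventually_elim
      case (elim t)
      have "\<forall>\<^sub>F k in sequentially. N (\<lambda>x. s k t x - u t x) < 1"
        using order_tendstoD(2)[OF elim, of 1] by simp
      then have "\<forall>\<^sub>F k in sequentially. N (\<lambda>x. s k t x - u t x) = N (\<lambda>x. r k t x - u t x)"
        by eventually_elim (simp add: r_def)
      with elim show ?case by (rule Lim_transform_eventually)
    qed
  qed simp
  then have "\<forall>\<^sub>F k in sequentially. (LINT t|lebesgue_on J. N (\<lambda>x. r k t x - u t x)) < e"
    using e by (intro order_tendstoD) auto
  then obtain k where k: "(LINT t|lebesgue_on J. N (\<lambda>x. r k t x - u t x)) < e"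
    by (auto simp: eventually_sequentially)
  have "integrable (lebesgue_on J) (\<lambda>t. N (\<lambda>x. r k t x - u t x))"
  proof (rule LINT_bound[OF ib m2])
    show "AE t in lebesgue_on J. norm (N (\<lambda>x. r k t x - u t x)) \<le> norm (1 + N (u t))"
      using bound[of k] by eventually_elim (simp add: N_nonneg add_nonneg_nonneg)
  qed
  then show thesis using k r1 r2 that by blast
qed

lemma sum_mem_functional:
  assumes "finite R" "R \<subseteq> Y"
  shows "(\<lambda>x. \<Sum>z\<in>R. a z * z x) \<in> Y \<and> (\<forall>L c. bdd_functional L c \<longrightarrow> L (\<lambda>x. \<Sum>z\<in>R. a z * z x) = (\<Sum>z\<in>R. a z * L z))"
  using assms
proof (induction R)
  case empty
  then show ?case using zero_mem bdd_functional_zero by auto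
next
  case (insert z R)
  let ?w = "\<lambda>x. \<Sum>z\<in>R. a z * z x"
  have w: "?w \<in> Y" "z \<in> Y" using insert by auto
  have eq: "(\<lambda>x. \<Sum>z\<in>insert z R. a z * z x) = (\<lambda>x. a z * z x + 1 * ?w x)"
    using insert by simp
  have "L (\<lambda>x. a z * z x + 1 * ?w x) = a z * L z + 1 * L ?w" if "bdd_functional L c" for L c
    by (rule bdd_functional_lincomb[OF that w(2,1)])
  with insert show ?case
    unfolding eq using lincomb_mem[OF w(2,1), of "a z" 1] by auto
qed

text \<open>A substitute for the Bochner integral of \<open>u\<close> over \<open>A\<close>, which does not require
  completeness of \<open>Y\<close>.\<close>

lemma approx_integral:
  assumes u: "u \<in> space_L2" and A: "A \<in> sets (lebesgue_on J)" and e: "e > 0"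
  obtains v where "v \<in> Y" "\<And>L c. bdd_functional L c \<Longrightarrow>
     \<bar>(LINT t|lebesgue_on J. indicator A t * L (u t)) - L v\<bar> \<le> c * e"
proof -
  interpret finite_measure "lebesgue_on J" by (rule finite_measure_J)
  obtain s where s: "simple_function (lebesgue_on J) s" "\<And>t. t \<in> J \<Longrightarrow> s t \<in> Y"
    "integrable (lebesgue_on J) (\<lambda>t. N (\<lambda>x. s t x - u t x))"
    "(LINT t|lebesgue_on J. N (\<lambda>x. s t x - u t x)) < e"
    by (rule simple_approx[OF u e]) (rule that)
  define R where "R = s ` J"
  have R: "finite R" "R \<subseteq> Y" using s(1,2) by (auto simp: R_def simple_function_def)
  define B where "B z = {t \<in> J. s t = z} \<inter> A" for z
  have B[measurable]: "B z \<in> sets (lebesgue_on J)" for z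
  proof -
    have "s -` {z} \<inter> space (lebesgue_on J) \<in> sets (lebesgue_on J)"
      by (rule simple_functionD(2)[OF s(1)])
    moreover have "B z = (s -` {z} \<inter> space (lebesgue_on J)) \<inter> A" by (auto simp: B_def)
    ultimately show ?thesis using A by auto
  qed
  have B_space: "B z \<inter> J = B z" for z by (auto simp: B_def)
  let ?a = "\<lambda>z. measure (lebesgue_on J) (B z)"
  \<comment> \<open>\<open>v\<close> is the integral of the simple function over \<open>A\<close>:
    each value is weighted with the measure of its level set in \<open>A\<close>.\<close>
  define v where "v = (\<lambda>x. \<Sum>z\<in>R. ?a z * z x)"
  note v = sum_mem_functional[OF R, of ?a, folded v_def]
  show thesis
  proof
    show "v \<in> Y" using v by simp
    fix L c assume L: "bdd_functional L c"
    have "(LINT t|lebesgue_on J. indicator A t * L (s t)) = (LINT t|lebesgue_on J. (\<Sum>z\<in>R. indicator (B z) t * L z))"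
    proof (rule LINT_cong)
      fix t assume "t \<in> space (lebesgue_on J)"
      then have t: "t \<in> J" by simp
      have "(\<Sum>z\<in>R. indicator (B z) t * L z) = (\<Sum>z\<in>R. if z = s t then indicator A t * L z else 0)"
        using t by (intro sum.cong) (auto simp: B_def indicator_def)
      also have "\<dots> = indicator A t * L (s t)" using t R(1) by (simp add: R_def)
      finally show "indicator A t * L (s t) = (\<Sum>z\<in>R. indicator (B z) t * L z)" by simp
    qed simp
    also have "\<dots> = (\<Sum>z\<in>R. ?a z * L z)"
    proof (subst Bochner_Integration.integral_sum)
      show "(\<Sum>z\<in>R. LINT t|lebesgue_on J. indicator (B z) t * L z) = (\<Sum>z\<in>R. ?a z * L z)"
        by (simp add: B_space)
    qed (auto intro!: integrable_mult_left integrable_real_indicator emeasure_finite simp: less_top[symmetric])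
    finally have Ls: "(LINT t|lebesgue_on J. indicator A t * L (s t)) = L v" using v L by auto
    have i1: "integrable (lebesgue_on J) (\<lambda>t. L (u t))" by (rule functional_integrable[OF u L])
    have i2: "integrable (lebesgue_on J) (\<lambda>t. L (s t))"
      using simple_function_compose1[OF s(1), of L] by (intro integrable_simple_function) auto
    have i3: "integrable (lebesgue_on J) (\<lambda>t. indicator A t * L (u t))"
      "integrable (lebesgue_on J) (\<lambda>t. indicator A t * L (s t))"
      using integrable_mult_indicator[OF A i1] integrable_mult_indicator[OF A i2] by simp_all
    have "\<bar>(LINT t|lebesgue_on J. indicator A t * L (u t)) - L v\<bar>
        = \<bar>LINT t|lebesgue_on J. indicator A t * L (u t) - indicator A t * L (s t)\<bar>"
      unfolding Ls[symmetric] using i3 by simp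
    also have "\<dots> \<le> (LINT t|lebesgue_on J. c * N (\<lambda>x. s t x - u t x))"
    proof (rule integral_abs_bound[THEN order_trans], rule integral_mono_AE)
      show "AE t in lebesgue_on J. \<bar>indicator A t * L (u t) - indicator A t * L (s t)\<bar> \<le> c * N (\<lambda>x. s t x - u t x)"
        using bochner_L2_AE[OF u] AE_space
      proof eventually_elim
        case (elim t)
        then have t: "t \<in> J" "u t \<in> Y" "s t \<in> Y" using s(2) by auto
        have "\<bar>L (\<lambda>x. s t x - u t x)\<bar> \<le> c * N (\<lambda>x. s t x - u t x)"
          using L diff_mem[OF t(3,2)] by (simp add: bdd_functional_def)
        moreover have "L (\<lambda>x. s t x - u t x) = L (s t) - L (u t)"
          by (rule bdd_functional_diff[OF L t(3,2)])
        moreover have "0 \<le> c * N (\<lambda>x. s t x - u t x)"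
          using L by (simp add: bdd_functional_def N_nonneg)
        ultimately show ?case by (auto simp: indicator_def)
      qed
    qed (use i3 s(3) in auto)
    also have "\<dots> \<le> c * e"
      using s(4) L by (simp add: bdd_functional_def mult_left_mono)
    finally show "\<bar>(LINT t|lebesgue_on J. indicator A t * L (u t)) - L v\<bar> \<le> c * e" .
  qed
qed

end

section \<open>Weak derivatives on an interval\<close>

abbreviation leb :: "real \<Rightarrow> real \<Rightarrow> real measure" where "leb a b \<equiv> lebesgue_on {a<..<b}"

lemma bounded_open_domain_interval: "bounded_open_domain {a<..<b::real}"
  by standard (auto simp: bounded_subset[of "{a..b}"])

lemma (in bounded_open_domain) continuous_integrable:
  fixes f :: "'a \<Rightarrow> real"
  assumes "continuous_on UNIV f"
  shows "integrable (lebesgue_on \<Omega>) f"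
  using L2_inner_integrable[OF continuous_in_L2[OF assms], of "\<lambda>_. 1"]
  by (simp add: continuous_in_L2)

lemma (in bounded_open_domain) continuous_mult_integrable:
  fixes f g :: "'a \<Rightarrow> real"
  assumes g: "continuous_on UNIV g" and f: "integrable (lebesgue_on \<Omega>) f"
  shows "integrable (lebesgue_on \<Omega>) (\<lambda>x. g x * f x)"
proof -
  have "compact (closure \<Omega>)" using bd by simp
  then have "bounded (g ` closure \<Omega>)"
    using g by (intro compact_imp_bounded compact_continuous_image) (auto intro: continuous_on_subset)
  then obtain B where B: "\<forall>x\<in>g ` closure \<Omega>. norm x \<le> B" unfolding bounded_iff by blast
  show ?thesis
  proof (rule LINT_bound)
    show "integrable (lebesgue_on \<Omega>) (\<lambda>x. B * f x)" using f by simp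
    show "AE x in lebesgue_on \<Omega>. norm (g x * f x) \<le> norm (B * f x)"
    proof (rule AE_I2)
      fix x assume "x \<in> space (lebesgue_on \<Omega>)"
      then have "x \<in> closure \<Omega>" using closure_subset by auto
      then have "norm (g x) \<le> B" using B by blast
      then have "\<bar>g x\<bar> \<le> \<bar>B\<bar>" by simp
      then show "norm (g x * f x) \<le> norm (B * f x)" by (auto simp: abs_mult intro: mult_right_mono)
    qed
    show "(\<lambda>x. g x * f x) \<in> borel_measurable (lebesgue_on \<Omega>)"
      using f continuous_integrable[OF g] by auto
  qed
qed

lemma Cc_infty_has_real_derivative:
  fixes \<theta> :: "real \<Rightarrow> real"
  assumes "\<theta> \<in> Cc_infty S"
  shows "(\<theta> has_real_derivative deriv \<theta> x) (at x)"
  using Cc_infty_differentiable[OF assms, of x] DERIV_deriv_iff_real_differentiable by blast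

lemma Cc_infty_deriv:
  fixes \<theta> :: "real \<Rightarrow> real"
  assumes \<theta>: "\<theta> \<in> Cc_infty S"
  shows "deriv \<theta> \<in> Cc_infty S"
proof -
  note d = Cc_infty_has_real_derivative[OF \<theta>]
  have eq: "deriv \<theta> = partial_deriv 1 \<theta>"
    using partial_deriv_real[OF d, of 1] by auto
  obtain K where K: "compact K" "K \<subseteq> S" "\<And>x. x \<notin> K \<Longrightarrow> \<theta> x = 0"
    using \<theta> by (auto simp: Cc_infty_def)
  then have "\<And>x. x \<notin> K \<Longrightarrow> deriv \<theta> x = 0"
    unfolding eq by (auto intro: partial_deriv_eq_0)
  moreover have "Ck k (deriv \<theta>)" for k
    using \<theta> Ck_Suc_real[OF d, of k] by (auto simp: Cc_infty_def simp del: Ck.simps)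
  ultimately show ?thesis using K unfolding Cc_infty_def by blast
qed

lemma integral_FTC_interval:
  fixes \<theta> \<zeta> :: "real \<Rightarrow> real"
  assumes "a \<le> b" and d: "\<And>x. (\<theta> has_real_derivative \<zeta> x) (at x)" and c: "continuous_on UNIV \<zeta>"
  shows "(LINT t|leb a b. \<zeta> t) = \<theta> b - \<theta> a"
proof -
  interpret bounded_open_domain "{a<..<b}" by (rule bounded_open_domain_interval)
  have "(LINT t|leb a b. \<zeta> t) = integral {a<..<b} \<zeta>"
    by (intro lebesgue_integral_eq_integral continuous_integrable c) simp
  also have "\<dots> = integral {a..b} \<zeta>" using integral_open_interval_real by metis
  also have "\<dots> = \<theta> b - \<theta> a"
    using assms(1) d by (intro integral_unique fundamental_theorem_of_calculus)
      (auto simp: has_real_derivative_iff_has_vector_derivative[symmetric] intro: DERIV_subset)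
  finally show ?thesis .
qed

text \<open>Zero mean makes the antiderivative that starts at 0 in \<open>a\<close> return to 0 in
  \<open>b\<close>. To the left and to the right of the support of \<open>\<zeta>\<close> it is
  constant, hence zero, so its support is compact as well.\<close>

lemma Cc_infty_antiderivative:
  assumes \<zeta>: "\<zeta> \<in> Cc_infty {a<..<b::real}" and ab: "a < b"
    and z: "(LINT t|leb a b. \<zeta> t) = 0"
  obtains \<theta> where "\<theta> \<in> Cc_infty {a<..<b}" "deriv \<theta> = \<zeta>"
proof -
  have c: "continuous_on UNIV \<zeta>" by (rule Cc_infty_continuous[OF \<zeta>])
  have "\<exists>F. \<forall>x. (F has_vector_derivative \<zeta> x) (at x)"
    using einterval_antiderivative[of "-\<infinity>" "\<infinity>" \<zeta>] c by (auto simp: continuous_on_eq_continuous_at)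
  then obtain F where F: "\<And>x. (F has_real_derivative \<zeta> x) (at x)"
    by (auto simp: has_real_derivative_iff_has_vector_derivative)
  define \<theta> where "\<theta> x = F x - F a" for x
  have d: "(\<theta> has_real_derivative \<zeta> x) (at x)" for x
    unfolding \<theta>_def by (auto intro!: derivative_eq_intros F)
  have ends: "\<theta> a = 0" "\<theta> b = 0"
    using integral_FTC_interval[OF less_imp_le[OF ab] d c] z by (auto simp: \<theta>_def)
  obtain K0 where K0: "compact K0" "K0 \<subseteq> {a<..<b}" "\<And>x. x \<notin> K0 \<Longrightarrow> \<zeta> x = 0"
    using \<zeta> by (auto simp: Cc_infty_def)
  \<comment> \<open>The midpoint makes the set nonempty, so that a minimum and a maximum exist even
    when \<open>\<zeta>\<close> vanishes.\<close>
  define K where "K = insert ((a + b) / 2) K0"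
  have K: "compact K" "K \<noteq> {}" "K \<subseteq> {a<..<b}" using K0 ab by (auto simp: K_def)
  obtain p where p: "p \<in> K" "\<And>x. x \<in> K \<Longrightarrow> p \<le> x" using compact_attains_inf[OF K(1,2)] by blast
  obtain r where r: "r \<in> K" "\<And>x. x \<in> K \<Longrightarrow> x \<le> r" using compact_attains_sup[OF K(1,2)] by blast
  have z0: "\<zeta> x = 0" if "x < p \<or> r < x" for x
  proof -
    have "x \<notin> K" using that p(2)[of x] r(2)[of x] by linarith
    then show ?thesis using K0(3) by (simp add: K_def)
  qed
  have ab': "a < p" "r < b" using p(1) r(1) K(3) by auto
  have const: "\<theta> x = \<theta> y" if "x < y" "y < p \<or> r < x" for x y
  proof -
    have "\<exists>w>x. w < y \<and> \<theta> y - \<theta> x = (y - x) * \<zeta> w"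
      using that(1) d by (rule MVT2)
    then obtain w where "x < w" "w < y" "\<theta> y - \<theta> x = (y - x) * \<zeta> w" by blast
    then show ?thesis using z0[of w] that by auto
  qed
  have "\<theta> x = 0" if "x < p" for x
    using const[of x a] const[of a x] that ab' ends by (cases x a rule: linorder_cases) auto
  moreover have "\<theta> x = 0" if "r < x" for x
    using const[of x b] const[of b x] that ab' ends by (cases x b rule: linorder_cases) auto
  ultimately have supp: "\<theta> x = 0" if "x \<notin> {p..r}" for x using that by auto
  have "Ck k \<theta>" for k
    using Ck_Suc_real[OF d, of k] \<zeta> Ck_SucD[of k \<theta>] by (auto simp: Cc_infty_def simp del: Ck.simps)
  moreover have "{p..r} \<subseteq> {a<..<b}" using ab' by auto
  ultimately have "\<theta> \<in> Cc_infty {a<..<b}"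
    unfolding Cc_infty_def using supp by (auto intro!: exI[of _ "{p..r}"])
  moreover have "deriv \<theta> = \<zeta>" using d by (auto intro: DERIV_imp_deriv)
  ultimately show thesis using that by blast
qed

lemma lebesgue_on_nested_integral:
  fixes f :: "real \<Rightarrow> real"
  assumes "A \<subseteq> B" "A \<in> sets lebesgue" "B \<in> sets lebesgue"
  shows "(LINT t|lebesgue_on B. indicator A t * f t) = (LINT t|lebesgue_on A. f t)"
proof -
  have "(LINT t|lebesgue_on B. indicator A t * f t) = (LINT t|lebesgue. indicator B t *\<^sub>R (indicator A t * f t))"
    using assms by (intro integral_restrict_space) auto
  also have "\<dots> = (LINT t|lebesgue. indicator A t *\<^sub>R f t)"
    using assms by (intro LINT_cong) (auto simp: indicator_def)
  also have "\<dots> = (LINT t|lebesgue_on A. f t)"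
    using assms by (intro integral_restrict_space[symmetric]) auto
  finally show ?thesis .
qed

text \<open>Since \<open>h\<close> is merely integrable, the classical product rule does not apply.
  Instead the order of integration is exchanged over the triangle s < t, and the inner integral of
  the derivative of \<open>\<theta>\<close> from s to \<open>b\<close> is
  \<open>- \<theta> s\<close>, because \<open>\<theta>\<close> vanishes at \<open>b\<close>.\<close>

lemma integral_by_parts_primitive:
  fixes h \<theta> :: "real \<Rightarrow> real"
  assumes ab: "a < b" and h: "integrable (leb a b) h" and \<theta>: "\<theta> \<in> Cc_infty {a<..<b}"
  shows "(LINT s|leb a b. \<theta> s * h s)
    = - (LINT t|leb a b. deriv \<theta> t * (LINT s|leb a b. indicator {a<..<t} s * h s))"
proof -
  interpret dom: bounded_open_domain "{a<..<b}" by (rule bounded_open_domain_interval)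
  let ?M = "leb a b"
  interpret M: finite_measure ?M by (rule dom.finite_measure)
  interpret P: pair_sigma_finite ?M ?M by standard
  note dc = Cc_infty_continuous[OF Cc_infty_deriv[OF \<theta>]]
  note d = Cc_infty_has_real_derivative[OF \<theta>]
  obtain K where K: "compact K" "K \<subseteq> {a<..<b}" "\<And>x. x \<notin> K \<Longrightarrow> \<theta> x = 0"
    using \<theta> by (auto simp: Cc_infty_def)
  then have \<theta>b: "\<theta> b = 0" by (meson greaterThanLessThan_iff less_irrefl subsetD)
  have "bounded (deriv \<theta> ` {a..b})"
    by (intro compact_imp_bounded compact_continuous_image dc) auto
  then obtain B where "\<forall>x\<in>deriv \<theta> ` {a..b}. norm x \<le> B" unfolding bounded_iff by blast
  then have B: "\<And>t. t \<in> {a..b} \<Longrightarrow> \<bar>deriv \<theta> t\<bar> \<le> B" by auto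
  \<comment> \<open>Measurability of the identity is what makes the triangle s < t measurable in the
    product space.\<close>
  have [measurable]: "(\<lambda>x. x) \<in> borel_measurable ?M" by (rule measurable_restrict_space1) (simp add: measurable_completion)
  have [measurable]: "h \<in> borel_measurable ?M" using h by auto
  have [measurable]: "deriv \<theta> \<in> borel_measurable ?M"
    using dom.continuous_integrable[OF dc] by auto
  define f where "f s t = (if s < t then deriv \<theta> t * h s else 0)" for s t
  have fm[measurable]: "case_prod f \<in> borel_measurable (?M \<Otimes>\<^sub>M ?M)"
  proof -
    have [measurable]: "(\<lambda>p. fst p) \<in> borel_measurable (?M \<Otimes>\<^sub>M ?M)"
      using measurable_compose[OF measurable_fst, of "\<lambda>x. x" ?M] by auto
    have [measurable]: "(\<lambda>p. snd p) \<in> borel_measurable (?M \<Otimes>\<^sub>M ?M)"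
      using measurable_compose[OF measurable_snd, of "\<lambda>x. x" ?M] by auto
    show ?thesis unfolding f_def split_beta' by measurable
  qed
  have hi: "integrable (?M \<Otimes>\<^sub>M ?M) (\<lambda>p. B * h (fst p))"
  proof (rule P.Fubini_integrable)
    show "integrable ?M (\<lambda>x. LINT y|?M. norm (B * h (fst (x, y))))" using h by simp
  qed auto
  have fi: "integrable (?M \<Otimes>\<^sub>M ?M) (case_prod f)"
  proof (rule LINT_bound[OF hi fm])
    show "AE p in ?M \<Otimes>\<^sub>M ?M. norm (case_prod f p) \<le> norm (B * h (fst p))"
    proof (rule AE_I2)
      fix p assume "p \<in> space (?M \<Otimes>\<^sub>M ?M)"
      then have "snd p \<in> {a..b}" by (auto simp: space_pair_measure)
      then have "\<bar>deriv \<theta> (snd p)\<bar> \<le> \<bar>B\<bar>" using B by fastforce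
      then show "norm (case_prod f p) \<le> norm (B * h (fst p))"
        by (auto simp: f_def split_beta abs_mult intro: mult_right_mono)
    qed
  qed
  have inner: "(LINT t|?M. f s t) = - \<theta> s * h s" if s: "s \<in> {a<..<b}" for s
  proof -
    have "(LINT t|?M. f s t) = (LINT t|?M. (indicator {s<..<b} t * deriv \<theta> t) * h s)"
      by (rule LINT_cong) (auto simp: f_def indicator_def)
    also have "\<dots> = (LINT t|?M. indicator {s<..<b} t * deriv \<theta> t) * h s" by simp
    also have "(LINT t|?M. indicator {s<..<b} t * deriv \<theta> t) = \<theta> b - \<theta> s"
      using s integral_FTC_interval[OF _ d dc, of s b] by (subst lebesgue_on_nested_integral) auto
    finally show ?thesis using \<theta>b by simp
  qed
  have "- (LINT s|?M. \<theta> s * h s) = (LINT s|?M. (LINT t|?M. f s t))"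
    unfolding Bochner_Integration.integral_minus[symmetric]
    by (rule LINT_cong) (auto simp: inner)
  also have "\<dots> = (LINT t|?M. (LINT s|?M. f s t))"
    by (rule P.Fubini_integral[OF fi, symmetric])
  also have "\<dots> = (LINT t|?M. deriv \<theta> t * (LINT s|?M. indicator {a<..<t} s * h s))"
  proof (rule LINT_cong)
    fix t
    have "(LINT s|?M. f s t) = (LINT s|?M. deriv \<theta> t * (indicator {a<..<t} s * h s))"
      by (rule LINT_cong) (auto simp: f_def indicator_def)
    then show "(LINT s|?M. f s t) = deriv \<theta> t * (LINT s|?M. indicator {a<..<t} s * h s)" by simp
  qed simp
  finally show ?thesis by simp
qed

text \<open>The indicators converge at every point except s = t, a null set, and the absolute value
  of \<open>h\<close> dominates.\<close>

lemma continuous_on_primitive: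
  fixes h :: "real \<Rightarrow> real"
  assumes h: "integrable (leb a b) h"
  shows "continuous_on A (\<lambda>t. LINT s|leb a b. indicator {a<..<t} s * h s)"
  unfolding continuous_on_sequentially
proof (intro allI ballI impI)
  fix x :: "nat \<Rightarrow> real" and t
  assume *: "t \<in> A" "(\<forall>n. x n \<in> A) \<and> x \<longlonglongrightarrow> t"
  have hm[measurable]: "h \<in> borel_measurable (leb a b)" using h by auto
  have im[measurable]: "(indicator {a<..<c} :: real \<Rightarrow> real) \<in> borel_measurable (leb a b)" for c
    by (intro measurable_restrict_space1 borel_measurable_indicator) simp
  have "(\<lambda>n. LINT s|leb a b. indicator {a<..<x n} s * h s)
     \<longlonglongrightarrow> (LINT s|leb a b. indicator {a<..<t} s * h s)"
  proof (rule integral_dominated_convergence[where w = "\<lambda>s. \<bar>h s\<bar>"])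
    have "AE s in lebesgue. s \<noteq> t" by (intro AE_completion AE_lborel_singleton)
    then have "AE s in leb a b. s \<noteq> t" by (auto simp: AE_restrict_space_iff)
    then show "AE s in leb a b. (\<lambda>n. indicator {a<..<x n} s * h s) \<longlonglongrightarrow> indicator {a<..<t} s * h s"
    proof eventually_elim
      case (elim s)
      have "\<forall>\<^sub>F n in sequentially. indicator {a<..<t} s * h s = indicator {a<..<x n} s * h s"
      proof (cases "s < t")
        case True
        then have "\<forall>\<^sub>F n in sequentially. s < x n" using * order_tendstoD(1) by blast
        then show ?thesis by eventually_elim (use True in \<open>auto simp: indicator_def\<close>)
      next
        case False
        then have "t < s" using elim by simp
        then have "\<forall>\<^sub>F n in sequentially. x n < s" using * order_tendstoD(2) by blast
        then show ?thesis by eventually_elim (use False in \<open>auto simp: indicator_def\<close>)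
      qed
      then show ?case by (rule Lim_transform_eventually[OF tendsto_const])
    qed
  qed (use h in \<open>auto simp: abs_mult simp del: indicator_simps split: split_indicator\<close>)
  then show "((\<lambda>t. LINT s|leb a b. indicator {a<..<t} s * h s) \<circ> x)
     \<longlonglongrightarrow> (LINT s|leb a b. indicator {a<..<t} s * h s)" by (simp add: comp_def)
qed

text \<open>The lemma of du Bois-Reymond. The difference \<open>G\<close> of \<open>g\<close> and
  the primitive of \<open>h\<close> annihilates all derivatives of test functions, which are the
  test functions of mean zero. Any test function becomes one of these after subtracting a multiple
  of a fixed \<open>\<rho>0\<close> with nonzero mean, and the mean of \<open>G\<close> weighted
  with \<open>\<rho>0\<close> is the constant.\<close>

proposition weak_derivative_imp_primitive:
  fixes g h :: "real \<Rightarrow> real"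
  assumes ab: "a < b" and g: "integrable (leb a b) g" and h: "integrable (leb a b) h"
    and weak: "\<And>\<theta>. \<theta> \<in> Cc_infty {a<..<b} \<Longrightarrow>
      (LINT t|leb a b. deriv \<theta> t * g t) = - (LINT t|leb a b. \<theta> t * h t)"
  shows "\<exists>c. AE t in leb a b. g t = c + (LINT s|leb a b. indicator {a<..<t} s * h s)"
proof -
  interpret dom: bounded_open_domain "{a<..<b}" by (rule bounded_open_domain_interval)
  let ?M = "leb a b"
  interpret M: finite_measure ?M by (rule dom.finite_measure)
  define H where "H t = (LINT s|?M. indicator {a<..<t} s * h s)" for t
  have H: "integrable ?M H"
    unfolding H_def[abs_def] by (intro dom.continuous_integrable continuous_on_primitive h)
  have bmult: "integrable ?M (\<lambda>t. \<rho> t * f t)" if "integrable ?M f" "\<rho> \<in> Cc_infty {a<..<b}" for f \<rho>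
    using that by (intro dom.continuous_mult_integrable Cc_infty_continuous)
  define G where "G t = g t - H t" for t
  have G: "integrable ?M G" unfolding G_def using g H by simp
  have Gz: "(LINT t|?M. \<zeta> t * G t) = 0" if \<zeta>: "\<zeta> \<in> Cc_infty {a<..<b}" "(LINT t|?M. \<zeta> t) = 0" for \<zeta>
  proof -
    obtain \<theta> where \<theta>: "\<theta> \<in> Cc_infty {a<..<b}" "deriv \<theta> = \<zeta>"
      by (rule Cc_infty_antiderivative[OF \<zeta>(1) ab \<zeta>(2)])
    have "(LINT t|?M. \<zeta> t * G t) = (LINT t|?M. \<zeta> t * g t) - (LINT t|?M. \<zeta> t * H t)"
      unfolding G_def right_diff_distrib using bmult[OF g \<zeta>(1)] bmult[OF H \<zeta>(1)] by simp
    then show ?thesis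
      using weak[OF \<theta>(1)] integral_by_parts_primitive[OF ab h \<theta>(1)] \<theta>(2) by (simp add: H_def)
  qed
  \<comment> \<open>If all test functions had mean zero, the fundamental lemma would make the
    constant 1 vanish almost everywhere on the interval.\<close>
  have "\<exists>\<rho>0\<in>Cc_infty {a<..<b}. (LINT t|?M. \<rho>0 t) \<noteq> 0"
  proof (rule ccontr)
    assume "\<not> ?thesis"
    then have "AE t in ?M. (1::real) = 0"
      by (intro fundamental_lemma) auto
    then have "AE t in lebesgue. t \<notin> {a<..<b}" by (simp add: AE_restrict_space_iff)
    then have "{a<..<b} \<in> null_sets lebesgue" by (simp add: AE_iff_null_sets)
    then show False using ab by (simp add: null_sets_def)
  qed
  then obtain \<rho>0 where \<rho>0: "\<rho>0 \<in> Cc_infty {a<..<b}" "(LINT t|?M. \<rho>0 t) \<noteq> 0" by blast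
  define c where "c = (LINT t|?M. \<rho>0 t * G t) / (LINT t|?M. \<rho>0 t)"
  have "AE t in ?M. G t - c = 0"
  proof (rule fundamental_lemma)
    show "integrable ?M (\<lambda>t. G t - c)" using G by simp
    fix \<rho> assume \<rho>: "\<rho> \<in> Cc_infty {a<..<b}"
    have ci: "integrable ?M \<rho>" "integrable ?M \<rho>0"
      by (intro dom.continuous_integrable Cc_infty_continuous[OF \<rho>] Cc_infty_continuous[OF \<rho>0(1)])+
    let ?r = "- (LINT t|?M. \<rho> t) / (LINT t|?M. \<rho>0 t)"
    have "(LINT t|?M. (1 * \<rho> t + ?r * \<rho>0 t) * G t) = 0"
      using \<rho>0(2) ci by (intro Gz Cc_infty_lincomb \<rho> \<rho>0(1)) simp
    moreover have "(LINT t|?M. (1 * \<rho> t + ?r * \<rho>0 t) * G t)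
       = (LINT t|?M. \<rho> t * G t) + ?r * (LINT t|?M. \<rho>0 t * G t)"
      using bmult[OF G \<rho>] bmult[OF G \<rho>0(1)] by (simp add: distrib_right mult.assoc del: divide_minus_left)
    moreover have "(LINT t|?M. (G t - c) * \<rho> t) = (LINT t|?M. \<rho> t * G t - c * \<rho> t)"
      by (simp add: algebra_simps)
    moreover have "\<dots> = (LINT t|?M. \<rho> t * G t) - c * (LINT t|?M. \<rho> t)"
      using bmult[OF G \<rho>] ci by simp
    ultimately show "(LINT t|?M. (G t - c) * \<rho> t) = 0" by (simp add: c_def)
  qed simp
  then have "AE t in ?M. g t = c + H t" by eventually_elim (simp add: G_def)
  then show ?thesis unfolding H_def by blast
qed

section \<open>Weak time derivatives\<close>

lemma bochner_L2_interval: "bochner (L2 \<Omega>) (L2_inner \<Omega>) {a<..<b}"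
  by (intro bochner.intro L2.ip_form_axioms bochner_axioms.intro) simp

context bochner
begin

lemma simple_in_bochner_L2:
  assumes u: "simple_function (lebesgue_on J) u" and Y: "\<And>t. t \<in> J \<Longrightarrow> u t \<in> Y"
  shows "u \<in> space_L2"
proof -
  interpret finite_measure "lebesgue_on J" by (rule finite_measure_J)
  have "integrable (lebesgue_on J) (\<lambda>t. (N (u t))\<^sup>2)"
    using simple_function_compose1[OF u, of "\<lambda>v. (N v)\<^sup>2"] by (intro integrable_simple_function) auto
  moreover have "AE t in lebesgue_on J. u t \<in> Y" using Y by (auto intro: AE_I2)
  ultimately show ?thesis
    using u Y N_zero by (auto simp: bochner_L2_def intro!: exI[of _ "\<lambda>_. u"])
qed

text \<open>Simple functions converging pointwise to \<open>f\<close>, multiplied by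
  \<open>v\<close>, are the required approximants. This provides test functions that separate time
  and space.\<close>

lemma scaled_in_bochner_L2:
  assumes f: "f \<in> borel_measurable (lebesgue_on J)" "\<And>t. t \<in> J \<Longrightarrow> \<bar>f t\<bar> \<le> B" and v: "v \<in> Y"
  shows "(\<lambda>t x. f t * v x) \<in> space_L2"
proof -
  interpret finite_measure "lebesgue_on J" by (rule finite_measure_J)
  obtain F where F: "\<And>i. simple_function (lebesgue_on J) (F i)" "\<And>t. t \<in> J \<Longrightarrow> (\<lambda>i. F i t) \<longlonglongrightarrow> f t"
    using borel_measurable_implies_sequence_metric[OF f(1), of 0] by auto
  have N: "N (\<lambda>x. c * v x) = \<bar>c\<bar> * N v" for c
    using scale_left[OF v scale_mem[OF v, of c], of c] sym[OF v scale_mem[OF v, of c]] scale_left[OF v v, of c]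
    by (simp add: N_def real_sqrt_mult flip: power2_eq_square mult.assoc)
  have "integrable (lebesgue_on J) (\<lambda>t. (N (\<lambda>x. f t * v x))\<^sup>2)"
  proof (rule integrable_const_bound)
    show "AE t in lebesgue_on J. norm ((N (\<lambda>x. f t * v x))\<^sup>2) \<le> (B * N v)\<^sup>2"
      using f(2) by (auto simp: N N_nonneg intro!: AE_I2 power_mono mult_right_mono)
    show "(\<lambda>t. (N (\<lambda>x. f t * v x))\<^sup>2) \<in> borel_measurable (lebesgue_on J)"
      unfolding N using f(1) by measurable
  qed
  moreover have "AE t in lebesgue_on J. (\<lambda>x. f t * v x) \<in> Y" using scale_mem[OF v] by auto
  moreover have "\<exists>s :: nat \<Rightarrow> real \<Rightarrow> 'a \<Rightarrow> real.
        (\<forall>k. simple_function (lebesgue_on J) (s k) \<and> (\<forall>t\<in>J. s k t \<in> Y)) \<and>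
        (AE t in lebesgue_on J. (\<lambda>k. N (\<lambda>x. s k t x - f t * v x)) \<longlonglongrightarrow> 0)"
  proof (intro exI[of _ "\<lambda>k t x. F k t * v x"] conjI allI ballI)
    show "simple_function (lebesgue_on J) (\<lambda>t x. F k t * v x)" for k
      using simple_function_compose1[OF F(1), of "\<lambda>c x. c * v x"] by simp
    show "(\<lambda>x. F k t * v x) \<in> Y" for k t by (rule scale_mem[OF v])
    have "(\<lambda>k. \<bar>F k t - f t\<bar> * N v) \<longlonglongrightarrow> 0" if "t \<in> J" for t
      using F(2)[OF that] by (intro tendsto_mult_left_zero tendsto_rabs_zero) (simp add: LIM_zero)
    then have "(\<lambda>k. N (\<lambda>x. F k t * v x - f t * v x)) \<longlonglongrightarrow> 0" if "t \<in> J" for t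
      using that N by (simp flip: left_diff_distrib)
    then show "AE t in lebesgue_on J. (\<lambda>k. N (\<lambda>x. F k t * v x - f t * v x)) \<longlonglongrightarrow> 0"
      by (auto intro: AE_I2)
  qed
  ultimately show ?thesis by (simp add: bochner_L2_def)
qed

end

lemma indicator_square: "(indicator A x :: real)\<^sup>2 = indicator A x"
  by (simp add: indicator_def)

text \<open>The Cauchy-Schwarz inequality of \<open>L2\<close> with the time set \<open>J\<close> in
  the role of the spatial domain, for the indicator of \<open>A\<close> and its product with
  \<open>f\<close>.\<close>

lemma set_integral_cauchy_schwarz:
  fixes f :: "'a::euclidean_space \<Rightarrow> real"
  assumes J: "J \<in> lmeasurable" and A: "A \<in> sets (lebesgue_on J)"
    and f: "integrable (lebesgue_on J) f" "integrable (lebesgue_on J) (\<lambda>t. (f t)\<^sup>2)"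
  shows "(LINT t|lebesgue_on J. indicator A t * f t)\<^sup>2
    \<le> measure (lebesgue_on J) A * (LINT t|lebesgue_on J. indicator A t * (f t)\<^sup>2)"
proof -
  let ?M = "lebesgue_on J"
  interpret finite_measure ?M by (rule finite_measure_lebesgue_on[OF J])
  have [measurable]: "A \<in> sets ?M" "f \<in> borel_measurable ?M" using A f by auto
  have i: "integrable ?M (\<lambda>t. indicator A t * (f t)\<^sup>2)"
    using integrable_mult_indicator[OF A f(2)] by simp
  then have 1: "(\<lambda>t. indicator A t * f t) \<in> L2 J"
    by (simp add: L2_def power_mult_distrib indicator_square)
  have 2: "(\<lambda>t. indicator A t :: real) \<in> L2 J"
  proof -
    have "(\<lambda>t. (norm (indicator A t :: real))\<^sup>2) = indicator A" by (auto simp: indicator_def)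
    then show ?thesis
      by (simp add: L2_def integrable_real_indicator emeasure_finite less_top[symmetric])
  qed
  have "\<bar>L2_inner J (\<lambda>t. indicator A t * f t) (\<lambda>t. indicator A t)\<bar>
      \<le> L2.N J (\<lambda>t. indicator A t * f t) * L2.N J (\<lambda>t. indicator A t)"
    by (rule L2.cauchy_schwarz[OF 1 2])
  then have "\<bar>L2_inner J (\<lambda>t. indicator A t * f t) (\<lambda>t. indicator A t)\<bar>\<^sup>2
      \<le> (L2.N J (\<lambda>t. indicator A t * f t) * L2.N J (\<lambda>t. indicator A t))\<^sup>2"
    by (intro power_mono) auto
  moreover have "L2_inner J (\<lambda>t. indicator A t * f t) (\<lambda>t. indicator A t) = (LINT t|?M. indicator A t * f t)"
    unfolding L2_inner_def by (rule LINT_cong) (auto simp: indicator_def)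
  moreover have "L2_inner J (\<lambda>t. indicator A t * f t) (\<lambda>t. indicator A t * f t) = (LINT t|?M. indicator A t * (f t)\<^sup>2)"
    unfolding L2_inner_def by (rule LINT_cong) (auto simp: indicator_def power2_eq_square)
  moreover have "L2_inner J (\<lambda>t. indicator A t :: real) (\<lambda>t. indicator A t) = measure ?M A"
  proof -
    have "L2_inner J (\<lambda>t. indicator A t :: real) (\<lambda>t. indicator A t) = (LINT t|?M. indicator A t)"
      unfolding L2_inner_def by (rule LINT_cong) (auto simp: indicator_def)
    then show ?thesis using sets.sets_into_space[OF A] by (simp add: Int_absorb2)
  qed
  ultimately show ?thesis by (simp add: power_mult_distrib L2.N_power2 mult.commute)
qed

section \<open>Pairing a time-dependent function with a fixed element of L^2\<close>

lemma L2_L2_inner_integrable: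
  assumes "u \<in> L2_L2 {a<..<b} \<Omega>" "v \<in> L2 \<Omega>"
  shows "integrable (leb a b) (\<lambda>t. L2_inner \<Omega> (u t) v)"
proof -
  interpret B: bochner "L2 \<Omega>" "L2_inner \<Omega>" "{a<..<b}" by (rule bochner_L2_interval)
  show ?thesis
    using B.functional_integrable[OF _ B.bdd_functional_inner[OF assms(2)]] assms(1) by (simp add: L2_N_eq)
qed

lemma L2_L2_AE: "u \<in> L2_L2 J \<Omega> \<Longrightarrow> AE t in lebesgue_on J. u t \<in> L2 \<Omega>"
  by (simp add: bochner_L2_def)

lemma L2_L2_norm_integrable:
  assumes "u \<in> L2_L2 {a<..<b} \<Omega>"
  shows "integrable (leb a b) (\<lambda>t. L2_norm \<Omega> (u t))"
    "integrable (leb a b) (\<lambda>t. (L2_norm \<Omega> (u t))\<^sup>2)"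
proof -
  interpret B: bochner "L2 \<Omega>" "L2_inner \<Omega>" "{a<..<b}" by (rule bochner_L2_interval)
  show "integrable (leb a b) (\<lambda>t. L2_norm \<Omega> (u t))"
    using B.N_integrable assms by (simp add: L2_N_eq)
  show "integrable (leb a b) (\<lambda>t. (L2_norm \<Omega> (u t))\<^sup>2)"
    using assms by (simp add: bochner_L2_def)
qed

lemma set_integrable_indicator:
  fixes f :: "'a \<Rightarrow> real"
  shows "A \<in> sets M \<Longrightarrow> integrable M f \<Longrightarrow> integrable M (\<lambda>t. indicator A t * f t)"
  using integrable_mult_indicator[of A M f] by simp

lemma interval_sets: "A \<in> sets borel \<Longrightarrow> {a<..<b::real} \<inter> A \<in> sets (leb a b)"
  by (auto simp: sets_restrict_space)

text \<open>\<open>A\<close> may stick out of the interval: the last slab contains the final time,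
  which the open interval lacks.\<close>

lemma indicator_interval_integrable:
  fixes f :: "real \<Rightarrow> real"
  assumes A: "A \<in> sets borel" and f: "integrable (leb a b) f"
  shows "integrable (leb a b) (\<lambda>t. indicator A t * f t)"
proof -
  have "integrable (leb a b) (\<lambda>t. indicator ({a<..<b} \<inter> A) t * f t)"
    by (intro set_integrable_indicator interval_sets A f)
  then show ?thesis
    by (rule Bochner_Integration.integrable_cong[THEN iffD1, rotated -1]) (auto simp: indicator_def)
qed

lemma integral_inner_le:
  assumes w: "w \<in> L2_L2 {a<..<b} \<Omega>" and v: "v \<in> L2 \<Omega>" and A: "A \<in> sets borel"
  shows "\<bar>LINT r|leb a b. indicator A r * L2_inner \<Omega> (w r) v\<bar>
    \<le> L2_norm \<Omega> v * (LINT r|leb a b. indicator A r * L2_norm \<Omega> (w r))"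
proof -
  have "\<bar>LINT r|leb a b. indicator A r * L2_inner \<Omega> (w r) v\<bar>
    \<le> (LINT r|leb a b. L2_norm \<Omega> v * (indicator A r * L2_norm \<Omega> (w r)))"
  proof (rule integral_abs_bound[THEN order_trans], rule integral_mono_AE)
    show "AE r in leb a b. \<bar>indicator A r * L2_inner \<Omega> (w r) v\<bar>
        \<le> L2_norm \<Omega> v * (indicator A r * L2_norm \<Omega> (w r))"
      using L2_L2_AE[OF w]
    proof eventually_elim
      case (elim r)
      then show ?case using L2.cauchy_schwarz[OF elim v] by (simp add: indicator_def L2_N_eq mult.commute)
    qed
  qed (auto intro!: integrable_mult_right integrable_abs indicator_interval_integrable A
        L2_L2_inner_integrable w v L2_L2_norm_integrable)
  then show ?thesis by simp
qed

lemma integral_inner_diff: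
  assumes w: "w \<in> L2_L2 {a<..<b} \<Omega>" and v: "x \<in> L2 \<Omega>" "y \<in> L2 \<Omega>" and A: "A \<in> sets borel"
  shows "(LINT r|leb a b. indicator A r * L2_inner \<Omega> (w r) (\<lambda>z. x z - y z))
    = (LINT r|leb a b. indicator A r * L2_inner \<Omega> (w r) x)
      - (LINT r|leb a b. indicator A r * L2_inner \<Omega> (w r) y)"
proof -
  note i = indicator_interval_integrable[OF A L2_L2_inner_integrable[OF w]]
  have "(LINT r|leb a b. indicator A r * L2_inner \<Omega> (w r) (\<lambda>z. x z - y z))
    = (LINT r|leb a b. indicator A r * L2_inner \<Omega> (w r) x - indicator A r * L2_inner \<Omega> (w r) y)"
  proof (rule integral_cong_AE)
    show "AE r in leb a b. indicator A r * L2_inner \<Omega> (w r) (\<lambda>z. x z - y z)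
       = indicator A r * L2_inner \<Omega> (w r) x - indicator A r * L2_inner \<Omega> (w r) y"
      using L2_L2_AE[OF w] by eventually_elim (simp add: L2.diff_right v right_diff_distrib)
  qed (use i[OF v(1)] i[OF v(2)] i[OF L2.diff_mem[OF v]] in auto)
  then show ?thesis using i[OF v(1)] i[OF v(2)] by simp
qed

text \<open>Pairing with a fixed \<open>v\<close> reduces the claim to scalar functions. The
  constant and the exceptional null set depend on \<open>v\<close>; \<open>weak_dt_increment\<close>
  has to cope with this.\<close>

lemma weak_dt_primitive:
  assumes ab: "a < b" and u: "u \<in> L2_L2 {a<..<b} \<Omega>" and w: "is_weak_dt {a<..<b} \<Omega> u w" and v: "v \<in> L2 \<Omega>"
  shows "\<exists>c. AE t in leb a b. L2_inner \<Omega> (u t) v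
    = c + (LINT s|leb a b. indicator {a<..<t} s * L2_inner \<Omega> (w s) v)"
  using w v by (intro weak_derivative_imp_primitive ab L2_L2_inner_integrable u) (auto simp: is_weak_dt_def)

lemma primitive_diff:
  fixes f :: "real \<Rightarrow> real"
  assumes f: "integrable (leb a b) f" and st: "a \<le> s" "s \<le> t"
  shows "(LINT r|leb a b. indicator {a<..<t} r * f r) - (LINT r|leb a b. indicator {a<..<s} r * f r)
    = (LINT r|leb a b. indicator {s..<t} r * f r)"
proof -
  have "(LINT r|leb a b. indicator {a<..<t} r * f r) - (LINT r|leb a b. indicator {a<..<s} r * f r)
    = (LINT r|leb a b. indicator {a<..<t} r * f r - indicator {a<..<s} r * f r)"
    by (rule Bochner_Integration.integral_diff[symmetric]; rule indicator_interval_integrable; simp add: f)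
  also have "\<dots> = (LINT r|leb a b. indicator {s..<t} r * f r)"
    by (rule LINT_cong) (use st in \<open>auto simp: indicator_def\<close>)
  finally show ?thesis .
qed

text \<open>A supremum over uncountably many \<open>v\<close> would pile up uncountably many null
  sets. Only the countable set \<open>V\<close> of values of the simple approximants of
  \<open>u\<close> is used: the increment of \<open>u\<close> is tested with the increment of an
  approximant, which tends to it. \<open>P\<close> collects the times that are good for all of
  \<open>V\<close> at once.\<close>

proposition weak_dt_increment:
  assumes ab: "a < b" and u: "u \<in> L2_L2 {a<..<b} \<Omega>" and w: "is_weak_dt {a<..<b} \<Omega> u w"
  obtains P where "AE t in leb a b. P t"
    "\<And>s t. P s \<Longrightarrow> P t \<Longrightarrow> s \<in> {a<..<b} \<Longrightarrow> t \<in> {a<..<b} \<Longrightarrow> s \<le> t \<Longrightarrow>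
       L2_norm \<Omega> (\<lambda>x. u t x - u s x) \<le> (LINT r|leb a b. indicator {s..<t} r * L2_norm \<Omega> (w r))"
proof -
  let ?M = "leb a b"
  interpret B: bochner "L2 \<Omega>" "L2_inner \<Omega>" "{a<..<b}" by (rule bochner_L2_interval)
  have wL: "w \<in> L2_L2 {a<..<b} \<Omega>" using w by (simp add: is_weak_dt_def)
  obtain \<sigma> where \<sigma>: "\<And>k. simple_function ?M (\<sigma> k)" "\<And>k t. t \<in> {a<..<b} \<Longrightarrow> \<sigma> k t \<in> L2 \<Omega>"
    "AE t in ?M. (\<lambda>k. L2_norm \<Omega> (\<lambda>x. \<sigma> k t x - u t x)) \<longlonglongrightarrow> 0"
    using u unfolding bochner_L2_def by blast
  define V where "V = (\<Union>k. \<sigma> k ` {a<..<b})"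
  have "countable (\<sigma> k ` {a<..<b})" for k
    using simple_functionD(1)[OF \<sigma>(1)[of k]] by (simp add: countable_finite)
  then have V: "countable V" unfolding V_def by (rule countable_UN[OF countableI_type])
  have VL: "V \<subseteq> L2 \<Omega>" using \<sigma>(2) by (auto simp: V_def)
  define H where "H v t = (LINT s|?M. indicator {a<..<t} s * L2_inner \<Omega> (w s) v)" for v t
  have "\<forall>v\<in>V. \<exists>c. AE t in ?M. L2_inner \<Omega> (u t) v = c + H v t"
    using weak_dt_primitive[OF ab u w] VL unfolding H_def by blast
  then obtain c where c: "\<And>v. v \<in> V \<Longrightarrow> AE t in ?M. L2_inner \<Omega> (u t) v = c v + H v t" by metis
  then have c': "AE t in ?M. \<forall>v\<in>V. L2_inner \<Omega> (u t) v = c v + H v t"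
    by (subst AE_ball_countable[OF V]) simp
  define P where "P t \<longleftrightarrow> u t \<in> L2 \<Omega> \<and> (\<lambda>k. L2_norm \<Omega> (\<lambda>x. \<sigma> k t x - u t x)) \<longlonglongrightarrow> 0
     \<and> (\<forall>v\<in>V. L2_inner \<Omega> (u t) v = c v + H v t)" for t
  show thesis
  proof
    show "AE t in ?M. P t"
      using L2_L2_AE[OF u] \<sigma>(3) c' by eventually_elim (simp add: P_def)
    fix s t assume P: "P s" "P t" and st: "s \<in> {a<..<b}" "t \<in> {a<..<b}" "s \<le> t"
    define I where "I = (LINT r|?M. indicator {s..<t} r * L2_norm \<Omega> (w r))"
    define d where "d = (\<lambda>x. u t x - u s x)"
    define z where "z k = (\<lambda>x. \<sigma> k t x - \<sigma> k s x)" for k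
    define e where "e k = L2_norm \<Omega> (\<lambda>x. \<sigma> k t x - u t x) + L2_norm \<Omega> (\<lambda>x. \<sigma> k s x - u s x)" for k
    have mem: "u t \<in> L2 \<Omega>" "u s \<in> L2 \<Omega>" "d \<in> L2 \<Omega>" "z k \<in> L2 \<Omega>" for k
      using P \<sigma>(2) st by (auto simp: P_def d_def z_def intro: L2.diff_mem)
    have e: "e \<longlonglongrightarrow> 0" using P tendsto_add[of _ 0 _ _ 0] unfolding P_def e_def by fastforce
    have dz: "L2_norm \<Omega> (\<lambda>x. z k x - d x) \<le> e k" for k
    proof -
      have "(\<lambda>x. z k x - d x) = (\<lambda>x. (\<sigma> k t x - u t x) - (\<sigma> k s x - u s x))"
        by (auto simp: z_def d_def)
      then show ?thesis
        using L2.N_diff_le[of "\<lambda>x. \<sigma> k t x - u t x" \<Omega> "\<lambda>x. \<sigma> k s x - u s x"] mem \<sigma>(2) st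
        by (simp add: e_def L2_N_eq L2.diff_mem)
    qed
    have inner: "L2_inner \<Omega> d (z k) = (LINT r|?M. indicator {s..<t} r * L2_inner \<Omega> (w r) (z k))" for k
    proof -
      have 1: "L2_inner \<Omega> d v = (LINT r|?M. indicator {s..<t} r * L2_inner \<Omega> (w r) v)" if "v \<in> V" for v
      proof -
        have "L2_inner \<Omega> d v = H v t - H v s"
          unfolding d_def using that P VL mem by (subst L2.diff_left) (auto simp: P_def)
        then show ?thesis
          unfolding H_def using primitive_diff[OF L2_L2_inner_integrable[OF wL], of v s t] that VL st by auto
      qed
      have "\<sigma> k t \<in> V" "\<sigma> k s \<in> V" using st(1,2) unfolding V_def by blast+
      then show ?thesis
        unfolding z_def using integral_inner_diff[OF wL, of "\<sigma> k t" "\<sigma> k s" "{s..<t}"] 1 VL mem(3)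
        by (simp add: L2.diff_right subset_iff)
    qed
    have I0: "0 \<le> I" unfolding I_def
      by (rule Bochner_Integration.integral_nonneg) (simp add: L2_norm_def L2_inner_nonneg)
    have d0: "0 \<le> L2_norm \<Omega> f" for f by (simp add: L2_norm_def L2_inner_nonneg)
    have "(L2_norm \<Omega> d)\<^sup>2 \<le> (L2_norm \<Omega> d + e k) * I + L2_norm \<Omega> d * e k" for k
    proof -
      have "(L2_norm \<Omega> d)\<^sup>2 = L2_inner \<Omega> d (z k) - L2_inner \<Omega> d (\<lambda>x. z k x - d x)"
        using mem by (simp add: L2.diff_right L2.N_power2 flip: L2_N_eq)
      also have "\<dots> \<le> L2_norm \<Omega> (z k) * I + L2_norm \<Omega> d * e k"
      proof -
        have "\<bar>L2_inner \<Omega> d (z k)\<bar> \<le> L2_norm \<Omega> (z k) * I"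
          unfolding inner I_def by (rule integral_inner_le[OF wL mem(4)]) simp
        moreover have "\<bar>L2_inner \<Omega> d (\<lambda>x. z k x - d x)\<bar> \<le> L2_norm \<Omega> d * L2_norm \<Omega> (\<lambda>x. z k x - d x)"
          using L2.cauchy_schwarz[OF mem(3) L2.diff_mem[OF mem(4,3)], of k] by (simp add: L2_N_eq)
        moreover have "L2_norm \<Omega> d * L2_norm \<Omega> (\<lambda>x. z k x - d x) \<le> L2_norm \<Omega> d * e k"
          by (intro mult_left_mono dz d0)
        ultimately show ?thesis by linarith
      qed
      also have "L2_norm \<Omega> (z k) * I \<le> (L2_norm \<Omega> d + e k) * I"
        using L2.N_triangle_abs[OF mem(4,3), of k] dz[of k]
        by (intro mult_right_mono I0) (simp add: L2_N_eq)
      finally show ?thesis by simp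
    qed
    moreover have "(\<lambda>k. (L2_norm \<Omega> d + e k) * I + L2_norm \<Omega> d * e k) \<longlonglongrightarrow> (L2_norm \<Omega> d + 0) * I + L2_norm \<Omega> d * 0"
      by (intro tendsto_intros e)
    \<comment> \<open>In the limit the squared norm is at most the norm times the integral; norm
      zero is treated apart before one factor is cancelled.\<close>
    ultimately have "(L2_norm \<Omega> d)\<^sup>2 \<le> L2_norm \<Omega> d * I"
      using LIMSEQ_le_const by fastforce
    then show "L2_norm \<Omega> (\<lambda>x. u t x - u s x) \<le> (LINT r|?M. indicator {s..<t} r * L2_norm \<Omega> (w r))"
      unfolding d_def[symmetric] I_def[symmetric]
      using d0[of d] I0 by (cases "L2_norm \<Omega> d = 0") (auto simp: power2_eq_square)
  qed
qed

text \<open>The square of \<open>f\<close> vanishes off a negligible set, so its integral is 0, and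
  a continuous nonnegative function with integral 0 vanishes everywhere.\<close>

lemma continuous_AE_zero_imp_zero:
  fixes f :: "real \<Rightarrow> real"
  assumes ab: "a < b" and c: "continuous_on {a..b} f" and ae: "AE t in leb a b. f t = 0"
    and t: "t \<in> {a..b}"
  shows "f t = 0"
proof -
  have "AE t in lebesgue. t \<in> {a<..<b} \<longrightarrow> f t = 0" using ae by (simp add: AE_restrict_space_iff)
  then obtain S where S: "S \<in> null_sets lebesgue" "{t. \<not> (t \<in> {a<..<b} \<longrightarrow> f t = 0)} \<subseteq> S"
    unfolding eventually_ae_filter by auto
  \<comment> \<open>The endpoints, about which the hypothesis says nothing, are thrown into the
    negligible set.\<close>
  have neg: "negligible (S \<union> {a, b})"
    using S(1) by (simp add: negligible_iff_null_sets)
  have "((\<lambda>t. (f t)\<^sup>2) has_integral 0) (cbox a b)"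
    by (rule has_integral_negligible[OF neg]) (use S(2) in \<open>force\<close>)
  then have "(f t)\<^sup>2 = 0"
    using ab t c by (intro has_integral_0_cbox_imp_0[of a b "\<lambda>t. (f t)\<^sup>2" t]) (auto intro!: continuous_intros)
  then show ?thesis by simp
qed

text \<open>For a fixed \<open>v\<close> both sides are continuous up to the endpoints, so the
  identity known almost everywhere holds at all times. This includes the two ends of the interval,
  which later are mesh points.\<close>

lemma continuous_representative_increment:
  assumes ab: "a < b" and u: "u \<in> L2_L2 {a<..<b} \<Omega>" and w: "is_weak_dt {a<..<b} \<Omega> u w"
    and D: "\<And>t. t \<in> {a..b} \<Longrightarrow> D t \<in> L2 \<Omega>"
      "\<And>t. t \<in> {a..b} \<Longrightarrow> ((\<lambda>s. L2_norm \<Omega> (\<lambda>x. D s x - D t x)) \<longlongrightarrow> 0) (at t within {a..b})"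
    and Du: "AE t in leb a b. L2_norm \<Omega> (\<lambda>x. u t x - D t x) = 0"
    and v: "v \<in> L2 \<Omega>" and st: "a \<le> s" "s \<le> t" "t \<le> b"
  shows "L2_inner \<Omega> (\<lambda>x. D t x - D s x) v
    = (LINT r|leb a b. indicator {s..<t} r * L2_inner \<Omega> (w r) v)"
proof -
  let ?M = "leb a b"
  have wL: "w \<in> L2_L2 {a<..<b} \<Omega>" using w by (simp add: is_weak_dt_def)
  define H where "H t = (LINT s|?M. indicator {a<..<t} s * L2_inner \<Omega> (w s) v)" for t
  obtain c where c: "AE t in ?M. L2_inner \<Omega> (u t) v = c + H t"
    using weak_dt_primitive[OF ab u w v] unfolding H_def by blast
  have cont: "continuous_on {a..b} (\<lambda>t. L2_inner \<Omega> (D t) v)"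
    unfolding continuous_on_def
  proof
    fix t assume t: "t \<in> {a..b}"
    have "((\<lambda>s. L2_inner \<Omega> (D s) v - L2_inner \<Omega> (D t) v) \<longlongrightarrow> 0) (at t within {a..b})"
    proof (rule Lim_null_comparison)
      show "\<forall>\<^sub>F s in at t within {a..b}. norm (L2_inner \<Omega> (D s) v - L2_inner \<Omega> (D t) v)
          \<le> L2_norm \<Omega> (\<lambda>x. D s x - D t x) * L2_norm \<Omega> v"
        unfolding eventually_at_filter
        using L2.cauchy_schwarz[OF L2.diff_mem v] L2.diff_left[OF _ _ v] D(1) t
        by (intro always_eventually) (simp add: L2_N_eq)
      show "((\<lambda>s. L2_norm \<Omega> (\<lambda>x. D s x - D t x) * L2_norm \<Omega> v) \<longlongrightarrow> 0) (at t within {a..b})"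
        by (rule tendsto_mult_left_zero[OF D(2)[OF t]])
    qed
    then show "((\<lambda>s. L2_inner \<Omega> (D s) v) \<longlongrightarrow> L2_inner \<Omega> (D t) v) (at t within {a..b})"
      by (simp add: LIM_zero_iff)
  qed
  have "L2_inner \<Omega> (D t) v - (c + H t) = 0" if "t \<in> {a..b}" for t
  proof (rule continuous_AE_zero_imp_zero[OF ab _ _ that])
    show "continuous_on {a..b} (\<lambda>t. L2_inner \<Omega> (D t) v - (c + H t))"
      unfolding H_def by (intro continuous_intros cont continuous_on_primitive L2_L2_inner_integrable wL v)
    show "AE t in ?M. L2_inner \<Omega> (D t) v - (c + H t) = 0"
      using Du c L2_L2_AE[OF u] AE_space
    proof eventually_elim
      case (elim t)
      then have "D t \<in> L2 \<Omega>" using D(1) by auto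
      then have "\<bar>L2_inner \<Omega> (u t) v - L2_inner \<Omega> (D t) v\<bar> \<le> 0"
        using L2.cauchy_schwarz[OF L2.diff_mem v, of "u t" "D t"] L2.diff_left[OF _ _ v] elim by (simp add: L2_N_eq)
      with elim show ?case by simp
    qed
  qed
  then have "L2_inner \<Omega> (\<lambda>x. D t x - D s x) v = H t - H s"
    using D(1) v st by (simp add: L2.diff_left)
  then show ?thesis
    unfolding H_def using primitive_diff[OF L2_L2_inner_integrable[OF wL v] st(1,2)] by simp
qed

lemma is_weak_dt_const:
  assumes u: "\<And>t. t \<in> {a<..<b} \<Longrightarrow> u t = z"
  shows "is_weak_dt {a<..<b} \<Omega> u (\<lambda>t x. 0)"
proof -
  interpret B: bochner "L2 \<Omega>" "L2_inner \<Omega>" "{a<..<b}" by (rule bochner_L2_interval)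
  have "(\<lambda>t x. 0) \<in> L2_L2 {a<..<b} \<Omega>"
    using B.simple_in_bochner_L2[of "\<lambda>t x. 0"] by (simp add: L2_N_eq zero_in_L2)
  moreover have "(LINT t|leb a b. deriv \<theta> t * L2_inner \<Omega> (u t) v) = 0"
    if \<theta>: "\<theta> \<in> Cc_infty {a<..<b}" for \<theta> v
  proof -
    have "deriv \<theta> = partial_deriv 1 \<theta>"
      using partial_deriv_real[OF Cc_infty_has_real_derivative[OF \<theta>], of 1] by auto
    then have "(LINT t|leb a b. deriv \<theta> t) = 0"
      using integral_partial_deriv_eq_0[of "{a<..<b}" \<theta> 1] \<theta> by (simp add: Basis_real_def)
    moreover have "(LINT t|leb a b. deriv \<theta> t * L2_inner \<Omega> (u t) v)
        = (LINT t|leb a b. deriv \<theta> t * L2_inner \<Omega> z v)"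
      by (rule LINT_cong) (use u in auto)
    ultimately show ?thesis by simp
  qed
  ultimately show ?thesis
    by (simp add: is_weak_dt_def L2_inner_def)
qed

lemma is_weak_dt_weak_dt: "is_weak_dt J \<Omega> u w \<Longrightarrow> is_weak_dt J \<Omega> u (weak_dt J \<Omega> u)"
  unfolding weak_dt_def using someI[of "is_weak_dt J \<Omega> u"] by blast

text \<open>The chosen weak derivative of a constant need not be literally zero, but the fundamental
  lemma makes its product with each \<open>v\<close> vanish almost everywhere. The right endpoint,
  present in the slab and absent from the open interval, is a null set.\<close>

lemma weak_dt_const_inner:
  assumes u: "\<And>t. t \<in> {a<..<b} \<Longrightarrow> u t = z" and v: "v \<in> L2 \<Omega>"
  shows "(LINT t|lebesgue_on {a<..b}. L2_inner \<Omega> (weak_dt {a<..<b} \<Omega> u t) v) = 0"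
proof -
  let ?w = "weak_dt {a<..<b} \<Omega> u"
  have w: "is_weak_dt {a<..<b} \<Omega> u ?w" by (rule is_weak_dt_weak_dt[OF is_weak_dt_const[OF u]])
  then have wL: "?w \<in> L2_L2 {a<..<b} \<Omega>" by (simp add: is_weak_dt_def)
  have "AE t in leb a b. L2_inner \<Omega> (?w t) v = 0"
  proof (rule fundamental_lemma)
    show "integrable (leb a b) (\<lambda>t. L2_inner \<Omega> (?w t) v)"
      by (rule L2_L2_inner_integrable[OF wL v])
    fix \<theta> assume \<theta>: "\<theta> \<in> Cc_infty {a<..<b}"
    have "(LINT t|leb a b. \<theta> t * L2_inner \<Omega> (?w t) v)
        = - (LINT t|leb a b. deriv \<theta> t * L2_inner \<Omega> (u t) v)"
      using w \<theta> v by (simp add: is_weak_dt_def)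
    also have "\<dots> = 0"
      using is_weak_dt_const[OF u, where \<Omega> = \<Omega>] \<theta> v by (simp add: is_weak_dt_def L2_inner_def)
    finally show "(LINT t|leb a b. L2_inner \<Omega> (?w t) v * \<theta> t) = 0" by (simp add: mult.commute)
  qed simp
  then have "AE t in lebesgue. t \<in> {a<..<b} \<longrightarrow> L2_inner \<Omega> (?w t) v = 0" by (simp add: AE_restrict_space_iff)
  moreover have "AE t in lebesgue. t \<noteq> b" by (intro AE_completion AE_lborel_singleton)
  ultimately have "AE t in lebesgue. t \<in> {a<..b} \<longrightarrow> L2_inner \<Omega> (?w t) v = 0"
    by eventually_elim auto
  then have "AE t in lebesgue_on {a<..b}. L2_inner \<Omega> (?w t) v = 0" by (simp add: AE_restrict_space_iff)
  then show ?thesis by (rule integral_eq_zero_AE)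
qed

text \<open>These are the functions with which the evolution equation will be tested. Integrating
  the derivative of \<open>\<eta> t * \<theta> t\<close> shows that the weak time derivative falls
  on the scalar factor alone.\<close>

lemma smooth_multiple_H1_L2:
  assumes \<theta>: "\<theta> \<in> Cc_infty {a<..<b}" and v: "v \<in> L2 \<Omega>"
  shows "(\<lambda>t x. \<theta> t * v x) \<in> H1_L2 {a<..<b} \<Omega>"
proof -
  interpret B: bochner "L2 \<Omega>" "L2_inner \<Omega>" "{a<..<b}" by (rule bochner_L2_interval)
  interpret dom: bounded_open_domain "{a<..<b}" by (rule bounded_open_domain_interval)
  have mem: "(\<lambda>t x. f t * v x) \<in> L2_L2 {a<..<b} \<Omega>" if f: "f \<in> Cc_infty {a<..<b}" for f
  proof -
    have "bounded (f ` {a..b})"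
      by (intro compact_imp_bounded compact_continuous_image Cc_infty_continuous[OF f]) auto
    then obtain C where "\<forall>x\<in>f ` {a..b}. norm x \<le> C" unfolding bounded_iff by blast
    then have "\<And>t. t \<in> {a<..<b} \<Longrightarrow> \<bar>f t\<bar> \<le> C" by auto
    moreover have "f \<in> borel_measurable (leb a b)"
      using dom.continuous_integrable[OF Cc_infty_continuous[OF f]] by auto
    ultimately show ?thesis using B.scaled_in_bochner_L2[OF _ _ v, of f C] by (simp add: L2_N_eq)
  qed
  have "(LINT t|leb a b. deriv \<eta> t * L2_inner \<Omega> (\<lambda>x. \<theta> t * v x) v')
        = - (LINT t|leb a b. \<eta> t * L2_inner \<Omega> (\<lambda>x. deriv \<theta> t * v x) v')"
    if \<eta>: "\<eta> \<in> Cc_infty {a<..<b}" and v': "v' \<in> L2 \<Omega>" for \<eta> v'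
  proof -
    have d: "((\<lambda>t. \<eta> t * \<theta> t) has_real_derivative (deriv \<eta> t * \<theta> t + \<eta> t * deriv \<theta> t)) (at t)" for t
      by (auto intro!: derivative_eq_intros Cc_infty_has_real_derivative[OF \<theta>] Cc_infty_has_real_derivative[OF \<eta>])
    have "partial_deriv 1 (\<lambda>t. \<eta> t * \<theta> t) = (\<lambda>t. deriv \<eta> t * \<theta> t + \<eta> t * deriv \<theta> t)"
      using partial_deriv_real[OF d, of 1] by auto
    then have "0 = (LINT t|leb a b. deriv \<eta> t * \<theta> t + \<eta> t * deriv \<theta> t)"
      using integral_partial_deriv_eq_0[of "{a<..<b}" "\<lambda>t. \<eta> t * \<theta> t" 1] Cc_infty_mult[OF \<eta> \<theta>]
      by (simp add: Basis_real_def)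
    also have "\<dots> = (LINT t|leb a b. deriv \<eta> t * \<theta> t) + (LINT t|leb a b. \<eta> t * deriv \<theta> t)"
      by (intro Bochner_Integration.integral_add dom.continuous_integrable continuous_intros
        Cc_infty_continuous[OF \<theta>] Cc_infty_continuous[OF \<eta>] Cc_infty_continuous[OF Cc_infty_deriv[OF \<theta>]]
        Cc_infty_continuous[OF Cc_infty_deriv[OF \<eta>]])
    finally have "(LINT t|leb a b. deriv \<eta> t * \<theta> t)
        = - (LINT t|leb a b. \<eta> t * deriv \<theta> t)" by linarith
    then have "(LINT t|leb a b. deriv \<eta> t * \<theta> t) * L2_inner \<Omega> v v'
        = - (LINT t|leb a b. \<eta> t * deriv \<theta> t) * L2_inner \<Omega> v v'" by simp
    then show ?thesis
      using v v' by (simp add: L2.scale_left flip: mult.assoc)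
  qed
  then have "is_weak_dt {a<..<b} \<Omega> (\<lambda>t x. \<theta> t * v x) (\<lambda>t x. deriv \<theta> t * v x)"
    unfolding is_weak_dt_def using mem[OF Cc_infty_deriv[OF \<theta>]] by blast
  then show ?thesis using mem[OF \<theta>] by (auto simp: H1_L2_def)
qed

section \<open>The equations on a time slab\<close>

lemmas L2_cauchy_schwarz = L2.cauchy_schwarz[unfolded L2_N_eq]
  and L2_norm_power2 = L2.N_power2[unfolded L2_N_eq]
  and L2_norm_nonneg = L2.N_nonneg[unfolded L2_N_eq]
  and L2_norm_diff_le = L2.N_diff_le[unfolded L2_N_eq]
  and L2_norm_triangle = L2.N_triangle[unfolded L2_N_eq]
  and L2_norm_commute = L2.N_commute[unfolded L2_N_eq]
  and L2_norm_zero = L2.N_zero[unfolded L2_N_eq]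

lemma L2_inner_eq_0:
  fixes u v :: "'a::euclidean_space \<Rightarrow> real"
  assumes "u \<in> L2 \<Omega>" "v \<in> L2 \<Omega>" "L2_norm \<Omega> u = 0"
  shows "L2_inner \<Omega> u v = 0"
  using L2_cauchy_schwarz[OF assms(1,2)] assms(3) by simp

text \<open>The limit is a choice, determined only up to functions of norm zero; hence a conclusion
  in terms of the norm, and of inner products in the lemma that follows.\<close>

lemma L2_lim_eventually_const:
  assumes F: "F \<noteq> bot" and z: "z \<in> L2 \<Omega>" and u: "\<forall>\<^sub>F s in F. u s = z"
  shows "L2_lim \<Omega> F u \<in> L2 \<Omega>" "L2_norm \<Omega> (\<lambda>x. z x - L2_lim \<Omega> F u x) = 0"
proof -
  have ev: "((\<lambda>s. L2_norm \<Omega> (\<lambda>x. u s x - v x)) \<longlongrightarrow> L2_norm \<Omega> (\<lambda>x. z x - v x)) F" for v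
    by (rule tendsto_eventually) (use u in eventually_elim, simp)
  have "z \<in> L2 \<Omega> \<and> ((\<lambda>s. L2_norm \<Omega> (\<lambda>x. u s x - z x)) \<longlongrightarrow> 0) F"
    using ev[of z] z by (simp add: L2_norm_zero)
  then have *: "L2_lim \<Omega> F u \<in> L2 \<Omega> \<and> ((\<lambda>s. L2_norm \<Omega> (\<lambda>x. u s x - L2_lim \<Omega> F u x)) \<longlongrightarrow> 0) F"
    unfolding L2_lim_def
    using someI[of "\<lambda>v. v \<in> L2 \<Omega> \<and> ((\<lambda>s. L2_norm \<Omega> (\<lambda>x. u s x - v x)) \<longlongrightarrow> 0) F" z] by blast
  then show "L2_lim \<Omega> F u \<in> L2 \<Omega>" by blast
  show "L2_norm \<Omega> (\<lambda>x. z x - L2_lim \<Omega> F u x) = 0"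
    using * ev tendsto_unique[OF F] by blast
qed

lemma L2_lim_inner:
  assumes F: "F \<noteq> bot" and z: "z \<in> L2 \<Omega>" and u: "\<forall>\<^sub>F s in F. u s = z" and w: "w \<in> L2 \<Omega>"
  shows "L2_inner \<Omega> (L2_lim \<Omega> F u) w = L2_inner \<Omega> z w"
  using L2_lim_eventually_const[OF F z u] L2_inner_eq_0[of "\<lambda>x. z x - L2_lim \<Omega> F u x" \<Omega> w] z w
  by (simp add: L2.diff_mem L2.diff_left)

text \<open>Measurability of \<open>f\<close> passes to \<open>g\<close> by completeness of Lebesgue
  measure.\<close>

lemma integral_cong_lebesgue_on_AE:
  fixes f g :: "'a::euclidean_space \<Rightarrow> real"
  assumes "S \<in> sets lebesgue" "f \<in> borel_measurable (lebesgue_on S)" "AE x in lebesgue_on S. f x = g x"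
  shows "integral\<^sup>L (lebesgue_on S) f = integral\<^sup>L (lebesgue_on S) g"
  by (rule integral_cong_AE[OF assms(2) borel_measurable_lebesgue_on_AE[OF assms] assms(3)])

locale discretization = bounded_open_domain \<Omega> for \<Omega> :: "'a::euclidean_space set" +
  fixes T \<alpha> \<beta> \<delta> :: real and l :: "real \<Rightarrow> 'a \<Rightarrow> real" and d0 :: "'a \<Rightarrow> real"
    and \<phi> d :: "real \<Rightarrow> 'a \<Rightarrow> real" and M :: nat and t :: "nat \<Rightarrow> real" and \<phi>\<tau> d\<tau> :: "real \<Rightarrow> 'a \<Rightarrow> real"
  assumes T: "0 < T" and \<alpha>: "0 < \<alpha>" and \<beta>: "0 < \<beta>" and \<delta>: "0 < \<delta>"
    and d0: "d0 \<in> L2 \<Omega>"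
    and cont: "continuous_state \<Omega> T \<alpha> \<beta> \<delta> l d0 \<phi> d"
    and \<phi>H1: "\<phi> \<in> H1_L2 {0<..<T} \<Omega>"
    and mesh: "time_mesh T M t"
    and dG: "dG0_state \<Omega> T \<alpha> \<beta> \<delta> M t l d0 \<phi>\<tau> d\<tau>"
begin

section \<open>Mesh points and slabs\<close>

abbreviation "I \<equiv> {0<..<T}"
abbreviation "MI \<equiv> lebesgue_on {0<..<T}"
abbreviation ip :: "('a \<Rightarrow> real) \<Rightarrow> ('a \<Rightarrow> real) \<Rightarrow> real" where "ip \<equiv> L2_inner \<Omega>"
abbreviation nrm :: "('a \<Rightarrow> real) \<Rightarrow> real" where "nrm \<equiv> L2_norm \<Omega>"

definition slab :: "nat \<Rightarrow> real set" where "slab m = {t (m - 1)<..t m}"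

text \<open>Slab integrals are written over the whole open interval with an indicator, since the
  weak equation and the integrability results are available in this form.\<close>

abbreviation slab_int :: "nat \<Rightarrow> (real \<Rightarrow> real) \<Rightarrow> real" where
  "slab_int m f \<equiv> (LINT s|MI. indicator (slab m) s * f s)"

abbreviation "gap \<equiv> (\<lambda>s x. d s x - \<phi> s x)"
abbreviation "E\<phi> \<equiv> (\<lambda>s x. \<phi> s x - \<phi>\<tau> s x)"
abbreviation "Ed \<equiv> (\<lambda>s x. d s x - d\<tau> s x)"

definition \<tau> :: "nat \<Rightarrow> real" where "\<tau> m = t m - t (m - 1)"

lemma t_less: "i < j \<Longrightarrow> j \<le> M \<Longrightarrow> t i < t j"
proof (induction j)
  case (Suc j)
  have "\<forall>m\<in>{1..M}. t (m - 1) < t m" using mesh by (simp add: time_mesh_def)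
  from bspec[OF this, of "Suc j"] have "t j < t (Suc j)" using Suc.prems by simp
  with Suc show ?case by (cases "i = j") auto
qed simp

lemma t_le: "i \<le> j \<Longrightarrow> j \<le> M \<Longrightarrow> t i \<le> t j"
  using t_less[of i j] by (cases "i = j") auto

lemma t_0: "t 0 = 0" and t_M: "t M = T" and M_pos: "1 \<le> M"
  using mesh by (auto simp: time_mesh_def)

lemma t_bounds: "m \<le> M \<Longrightarrow> 0 \<le> t m" "m \<le> M \<Longrightarrow> t m \<le> T"
  using t_le[of 0 m] t_le[of m M] t_0 t_M by auto

lemma \<tau>_pos: "m \<in> {1..M} \<Longrightarrow> 0 < \<tau> m"
  using t_less[of "m - 1" m] by (auto simp: \<tau>_def)

lemma slab_cover:
  assumes s: "s \<in> I"
  shows "\<exists>m\<in>{1..M}. s \<in> slab m"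
proof -
  have "\<exists>m. m \<le> M \<and> s \<le> t m" using s t_M by (intro exI[of _ M]) auto
  then obtain m where m: "m \<le> M" "s \<le> t m" and min: "\<And>k. k < m \<Longrightarrow> \<not> (k \<le> M \<and> s \<le> t k)"
    using exists_least_iff[of "\<lambda>m. m \<le> M \<and> s \<le> t m"] by auto
  have "m \<noteq> 0" using m(2) s t_0 by (intro notI) auto
  then show ?thesis using m min[of "m - 1"] by (intro bexI[of _ m]) (auto simp: slab_def)
qed

lemma slab_disjoint:
  assumes "m \<in> {1..M}" "n \<in> {1..M}" "s \<in> slab m" "s \<in> slab n"
  shows "m = n"
proof (rule ccontr)
  have *: False if "i < j" "j \<le> M" "s \<in> slab i" "s \<in> slab j" for i j
  proof -
    have "i \<le> j - 1" "j - 1 \<le> M" using that by auto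
    then have "t i \<le> t (j - 1)" by (rule t_le)
    then show False using that by (simp add: slab_def)
  qed
  assume "m \<noteq> n"
  then show False using *[of m n] *[of n m] assms by (cases "m < n") auto
qed

lemma slab_borel: "slab m \<in> sets borel" by (simp add: slab_def)

lemma t_in_slab: "m \<in> {1..M} \<Longrightarrow> t m \<in> slab m"
  using \<tau>_pos[of m] by (auto simp: slab_def \<tau>_def)

lemma slab_sum_indicator: "s \<in> I \<Longrightarrow> (\<Sum>m=1..M. indicator (slab m) s :: real) = 1"
proof -
  assume "s \<in> I"
  then obtain m where m: "m \<in> {1..M}" "s \<in> slab m" using slab_cover by blast
  have "(\<Sum>k=1..M. indicator (slab k) s :: real) = (\<Sum>k=1..M. if k = m then 1 else 0)"
    using slab_disjoint m by (intro sum.cong) (auto simp: indicator_def)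
  then show ?thesis using m(1) by simp
qed

lemma slab_integral: "m \<in> {1..M} \<Longrightarrow> slab_int m (\<lambda>s. c) = \<tau> m * c"
proof -
  assume m: "m \<in> {1..M}"
  have b: "0 \<le> t (m - 1)" "t m \<le> T" "t (m - 1) < t m" using t_bounds[of m] t_bounds[of "m - 1"] \<tau>_pos[OF m] m
    by (auto simp: \<tau>_def)
  have "slab_int m (\<lambda>s. c) = (LINT s|lebesgue. indicator I s *\<^sub>R (indicator (slab m) s * c))"
    by (intro integral_restrict_space) auto
  also have "\<dots> = (LINT s|lebesgue. indicator {t (m - 1)<..t m} s * c)"
  proof (rule integral_cong_AE)
    \<comment> \<open>The final time is the only point by which the last slab exceeds
      \<open>I\<close>.\<close>
    have "AE s in lebesgue. s \<noteq> T" by (intro AE_completion AE_lborel_singleton)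
    then show "AE s in lebesgue. indicator I s *\<^sub>R (indicator (slab m) s * c) = indicator {t (m - 1)<..t m} s * c"
      by eventually_elim (use b in \<open>auto simp: slab_def indicator_def\<close>)
    show "(\<lambda>s. indicator I s *\<^sub>R (indicator (slab m) s * c)) \<in> borel_measurable lebesgue"
      using slab_borel[of m] by (intro borel_measurable_scaleR borel_measurable_times borel_measurable_indicator) auto
    show "(\<lambda>s. indicator {t (m - 1)<..t m} s * c) \<in> borel_measurable lebesgue"
      by (intro borel_measurable_times borel_measurable_indicator) auto
  qed
  also have "\<dots> = \<tau> m * c" using b by (simp add: \<tau>_def)
  finally show ?thesis .
qed

section \<open>The continuous equations integrated over a set of times\<close>

lemma \<phi>V: "\<phi> \<in> L2_H10 I \<Omega>" and dX: "d \<in> H1_L2 I \<Omega>" and init: "has_initial_value T \<Omega> d d0"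
  using cont by (auto simp: continuous_state_def Let_def)

lemma weak_form:
  assumes "\<psi> \<in> L2_H10 I \<Omega>" "\<mu> \<in> H1_L2 I \<Omega>"
  shows "\<alpha> * st_inner I \<Omega> (\<lambda>t. weak_grad \<Omega> (\<phi> t)) (\<lambda>t. weak_grad \<Omega> (\<psi> t))
         - \<beta> * st_inner I \<Omega> (\<lambda>t x. d t x - \<phi> t x) \<psi>
         + st_inner I \<Omega> (weak_dt I \<Omega> d) \<mu>
         + \<beta> / \<delta> * st_inner I \<Omega> (\<lambda>t x. d t x - \<phi> t x) \<mu>
         = st_inner I \<Omega> l \<psi>"
  using cont assms unfolding continuous_state_def Let_def by blast

lemma dL2: "d \<in> L2_L2 I \<Omega>" and \<phi>L2: "\<phi> \<in> L2_L2 I \<Omega>"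
  using dX \<phi>H1 by (auto simp: H1_L2_def)

definition wd :: "real \<Rightarrow> 'a \<Rightarrow> real" where "wd = weak_dt I \<Omega> d"
definition w\<phi> :: "real \<Rightarrow> 'a \<Rightarrow> real" where "w\<phi> = weak_dt I \<Omega> \<phi>"

lemma wd: "is_weak_dt I \<Omega> d wd" and w\<phi>: "is_weak_dt I \<Omega> \<phi> w\<phi>"
  using dX \<phi>H1 is_weak_dt_weak_dt unfolding H1_L2_def wd_def w\<phi>_def by blast+

lemma wdL2: "wd \<in> L2_L2 I \<Omega>" and w\<phi>L2: "w\<phi> \<in> L2_L2 I \<Omega>"
  using wd w\<phi> by (auto simp: is_weak_dt_def)

lemma bochner_H10: "bochner (H10 \<Omega>) H1_inner I"
  by (intro bochner.intro H10.ip_form_axioms bochner_axioms.intro) simp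

lemma \<phi>_AE: "AE s in MI. \<phi> s \<in> H10 \<Omega>"
  using \<phi>V by (simp add: bochner_L2_def)

lemma H10_L2: "v \<in> H10 \<Omega> \<Longrightarrow> v \<in> L2 \<Omega>" and H10_H1: "v \<in> H10 \<Omega> \<Longrightarrow> v \<in> H1 \<Omega>"
  using H1_sub_L2 H10_sub_H1 by auto

lemma grad_N_le: "grad.N u \<le> H1.N u" and L2_norm_le_H1: "nrm u \<le> H1.N u"
  by (auto simp: grad.N_def H1.N_def H1_inner_def L2_norm_def L2_inner_nonneg grad.nonneg)

lemma bdd_functional_grad: "w \<in> H1 \<Omega> \<Longrightarrow> bochner.bdd_functional (H10 \<Omega>) H1_inner (\<lambda>z. grad_inner z w) (grad.N w)"
proof -
  interpret B: bochner "H10 \<Omega>" H1_inner I by (rule bochner_H10)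
  assume w: "w \<in> H1 \<Omega>"
  have "\<bar>grad_inner u w\<bar> \<le> grad.N w * H1.N u" if "u \<in> H10 \<Omega>" for u
  proof -
    have "\<bar>grad_inner u w\<bar> \<le> grad.N u * grad.N w" by (rule grad.cauchy_schwarz[OF H10_H1[OF that] w])
    also have "\<dots> \<le> H1.N u * grad.N w" by (intro mult_right_mono grad_N_le grad.N_nonneg)
    finally show ?thesis by (simp add: mult.commute)
  qed
  then show ?thesis
    unfolding B.bdd_functional_def by (simp add: grad.N_nonneg grad.lincomb_left H10_H1 w)
qed

lemma bdd_functional_L2: "w \<in> L2 \<Omega> \<Longrightarrow> bochner.bdd_functional (H10 \<Omega>) H1_inner (\<lambda>z. ip z w) (nrm w)"
proof -
  interpret B: bochner "H10 \<Omega>" H1_inner I by (rule bochner_H10)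
  assume w: "w \<in> L2 \<Omega>"
  have "\<bar>ip u w\<bar> \<le> nrm w * H1.N u" if "u \<in> H10 \<Omega>" for u
  proof -
    have "\<bar>ip u w\<bar> \<le> nrm u * nrm w" by (rule L2_cauchy_schwarz[OF H10_L2[OF that] w])
    also have "\<dots> \<le> H1.N u * nrm w" by (intro mult_right_mono L2_norm_le_H1 L2_norm_nonneg)
    finally show ?thesis by (simp add: mult.commute)
  qed
  then show ?thesis
    unfolding B.bdd_functional_def by (simp add: L2_norm_nonneg L2.lincomb_left H10_L2 w)
qed

lemma grad_integrable: "v \<in> H1 \<Omega> \<Longrightarrow> integrable MI (\<lambda>s. grad_inner (\<phi> s) v)"
proof -
  interpret B: bochner "H10 \<Omega>" H1_inner I by (rule bochner_H10)
  assume "v \<in> H1 \<Omega>"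
  then show ?thesis using B.functional_integrable[OF _ bdd_functional_grad] \<phi>V by (simp add: H1_N_eq)
qed

lemma zero_H1_L2: "(\<lambda>s x. 0) \<in> H1_L2 I \<Omega>"
  using smooth_multiple_H1_L2[OF zero_in_Cc_infty zero_in_L2, of 0 T \<Omega>] by simp

lemma zero_L2_H10: "(\<lambda>s x. 0) \<in> L2_H10 I \<Omega>"
proof -
  interpret B: bochner "H10 \<Omega>" H1_inner I by (rule bochner_H10)
  show ?thesis using B.simple_in_bochner_L2[of "\<lambda>s x. 0"] zero_in_H10 by (simp add: H1_N_eq)
qed

lemma L2_inner_0_right: "L2_inner \<Omega> f (\<lambda>x. 0) = 0" for f :: "'a \<Rightarrow> 'c::euclidean_space"
  by (simp add: L2_inner_def)

lemma L2_inner_0_left: "L2_inner \<Omega> (\<lambda>x. 0) f = 0" for f :: "'a \<Rightarrow> 'c::euclidean_space"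
  by (simp add: L2_inner_def)

text \<open>Functions in L^2(0,T;H^1_0) need no regularity in time, so the indicator of
  \<open>A\<close> times \<open>v\<close> is admissible as \<open>\<psi>\<close>, together with
  \<open>\<mu>\<close> = 0.\<close>

lemma elliptic_equation:
  assumes v: "v \<in> H10 \<Omega>" and A: "A \<in> sets borel"
  shows "\<alpha> * (LINT s|MI. indicator A s * grad_inner (\<phi> s) v)
      - \<beta> * (LINT s|MI. indicator A s * ip (gap s) v)
    = (LINT s|MI. indicator A s * ip (l s) v)"
proof -
  interpret B: bochner "H10 \<Omega>" H1_inner I by (rule bochner_H10)
  define \<psi> where "\<psi> s = (if s \<in> A then v else (\<lambda>x. 0))" for s
  have "{s \<in> space MI. s \<in> A} \<in> sets MI"
  proof -
    have "{s \<in> space MI. s \<in> A} = I \<inter> A" by auto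
    then show ?thesis using interval_sets[OF A] by simp
  qed
  then have "simple_function MI \<psi>"
    unfolding \<psi>_def by (intro simple_function_If simple_function_const)
  then have "\<psi> \<in> L2_H10 I \<Omega>"
    using B.simple_in_bochner_L2[of \<psi>] v zero_in_H10 by (auto simp: \<psi>_def H1_N_eq)
  note eq = weak_form[OF this zero_H1_L2]
  have L: "ip f (\<psi> s) = indicator A s * ip f v" for f s
    by (simp add: \<psi>_def L2_inner_0_right)
  have "st_inner I \<Omega> (\<lambda>t. weak_grad \<Omega> (\<phi> t)) (\<lambda>t. weak_grad \<Omega> (\<psi> t))
     = (LINT s|MI. grad_inner (\<phi> s) (\<psi> s))"
    by (simp add: st_inner_def grad_inner_def)
  \<comment> \<open>The chosen gradient of the zero function is removed by
    \<open>grad.zero_right\<close>, which asks for \<open>\<phi> s\<close> in H^1; hence an equality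
    almost everywhere.\<close>
  also have "\<dots> = (LINT s|MI. indicator A s * grad_inner (\<phi> s) v)"
  proof (rule integral_cong_lebesgue_on_AE[symmetric])
    show "AE s in MI. indicator A s * grad_inner (\<phi> s) v = grad_inner (\<phi> s) (\<psi> s)"
      using \<phi>_AE by eventually_elim (auto simp: \<psi>_def grad.zero_right H10_H1)
    show "(\<lambda>s. indicator A s * grad_inner (\<phi> s) v) \<in> borel_measurable MI"
      using indicator_interval_integrable[OF A grad_integrable[OF H10_H1[OF v]]] by auto
  qed simp
  finally show ?thesis
    using eq by (simp add: st_inner_def L L2_inner_0_right)
qed

lemma d\<phi>_inner_integrable:
  assumes v: "v \<in> L2 \<Omega>"
  shows "integrable MI (\<lambda>s. ip (gap s) v)"
    and "A \<in> sets borel \<Longrightarrow> (LINT s|MI. indicator A s * ip (gap s) v)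
      = (LINT s|MI. indicator A s * ip (d s) v) - (LINT s|MI. indicator A s * ip (\<phi> s) v)"
proof -
  note i = L2_L2_inner_integrable[OF dL2 v] L2_L2_inner_integrable[OF \<phi>L2 v]
  have ae: "AE s in MI. ip (d s) v - ip (\<phi> s) v = ip (gap s) v"
    using L2_L2_AE[OF dL2] L2_L2_AE[OF \<phi>L2] by eventually_elim (simp add: L2.diff_left v)
  have i': "integrable MI (\<lambda>s. ip (d s) v - ip (\<phi> s) v)" using i by simp
  have m: "(\<lambda>s. ip (gap s) v) \<in> borel_measurable MI"
    by (rule borel_measurable_lebesgue_on_AE[OF _ _ ae]) (use i' in auto)
  show "integrable MI (\<lambda>s. ip (gap s) v)"
    by (rule integrable_cong_AE_imp[OF i' m]) (use ae in eventually_elim, simp)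
  assume A: "A \<in> sets borel"
  note iA = i[THEN indicator_interval_integrable[OF A]]
  have "(LINT s|MI. indicator A s * ip (gap s) v)
    = (LINT s|MI. indicator A s * ip (d s) v - indicator A s * ip (\<phi> s) v)"
  proof (rule integral_cong_lebesgue_on_AE[symmetric])
    show "AE s in MI. indicator A s * ip (d s) v - indicator A s * ip (\<phi> s) v
      = indicator A s * ip (gap s) v"
      using ae by eventually_elim (simp add: right_diff_distrib[symmetric])
  qed (use iA in auto)
  then show "(LINT s|MI. indicator A s * ip (gap s) v)
      = (LINT s|MI. indicator A s * ip (d s) v) - (LINT s|MI. indicator A s * ip (\<phi> s) v)"
    using iA by simp
qed

text \<open>\<open>\<mu>\<close> must be weakly differentiable in time, which rules out an
  indicator. Testing with a smooth \<open>\<theta>\<close> times \<open>v\<close> and the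
  fundamental lemma give the equation paired with \<open>v\<close> at almost every time, and only
  then is it integrated over \<open>A\<close>.\<close>

lemma evolution_equation:
  assumes v: "v \<in> L2 \<Omega>" and A: "A \<in> sets borel"
  shows "(LINT s|MI. indicator A s * ip (wd s) v)
     + \<beta> / \<delta> * (LINT s|MI. indicator A s * ip (gap s) v) = 0"
proof -
  let ?f = "\<lambda>s. ip (wd s) v + \<beta> / \<delta> * ip (gap s) v"
  note i = L2_L2_inner_integrable[OF wdL2 v] d\<phi>_inner_integrable(1)[OF v]
  have scale: "ip f (\<lambda>x. c * v x) = c * ip f v" for f c
    unfolding L2_inner_def by (simp add: mult.left_commute)
  have "AE s in MI. ?f s = 0"
  proof (rule fundamental_lemma)
    fix \<theta> assume \<theta>: "\<theta> \<in> Cc_infty I"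
    interpret dom: bounded_open_domain I by (rule bounded_open_domain_interval)
    note b = dom.continuous_mult_integrable[OF Cc_infty_continuous[OF \<theta>]]
    have "st_inner I \<Omega> wd (\<lambda>s x. \<theta> s * v x) + \<beta> / \<delta> * st_inner I \<Omega> (\<lambda>s x. d s x - \<phi> s x) (\<lambda>s x. \<theta> s * v x) = 0"
    proof -
      have "(LINT s|MI. L2_inner \<Omega> (weak_grad \<Omega> (\<phi> s)) (weak_grad \<Omega> (\<lambda>x. 0))) = (LINT s|MI. 0)"
      proof (rule integral_cong_lebesgue_on_AE[symmetric])
        show "AE s in MI. 0 = L2_inner \<Omega> (weak_grad \<Omega> (\<phi> s)) (weak_grad \<Omega> (\<lambda>x. 0))"
          using \<phi>_AE by eventually_elim (use grad.zero_right in \<open>simp add: grad_inner_def H10_H1\<close>)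
      qed auto
      then show ?thesis
        using weak_form[OF zero_L2_H10 smooth_multiple_H1_L2[OF \<theta> v]]
        by (simp add: st_inner_def L2_inner_0_right wd_def)
    qed
    then have "(LINT s|MI. \<theta> s * ip (wd s) v)
        + \<beta> / \<delta> * (LINT s|MI. \<theta> s * ip (gap s) v) = 0"
      by (simp add: st_inner_def scale)
    moreover have "(LINT s|MI. ?f s * \<theta> s) = (LINT s|MI. \<theta> s * ip (wd s) v
        + \<beta> / \<delta> * (\<theta> s * ip (gap s) v))"
      by (rule LINT_cong) (simp_all add: algebra_simps)
    moreover have "\<dots> = (LINT s|MI. \<theta> s * ip (wd s) v)
        + \<beta> / \<delta> * (LINT s|MI. \<theta> s * ip (gap s) v)"
      using b[OF i(1)] b[OF i(2)] by simp
    ultimately show "(LINT s|MI. ?f s * \<theta> s) = 0" by simp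
  qed (use i in auto)
  then have "AE s in MI. indicator A s * ?f s = 0" by eventually_elim simp
  then have "(LINT s|MI. indicator A s * ?f s) = 0" by (rule integral_eq_zero_AE)
  moreover have "(LINT s|MI. indicator A s * ?f s) = (LINT s|MI. indicator A s * ip (wd s) v
      + \<beta> / \<delta> * (indicator A s * ip (gap s) v))"
    by (rule LINT_cong) (simp_all add: algebra_simps)
  moreover have "\<dots> = (LINT s|MI. indicator A s * ip (wd s) v)
     + \<beta> / \<delta> * (LINT s|MI. indicator A s * ip (gap s) v)"
    using i[THEN indicator_interval_integrable[OF A]] by simp
  ultimately show ?thesis by simp
qed

section \<open>The discrete equations on one slab\<close>

lemma piecewise_const_slab:
  assumes u: "u \<in> piecewise_const M t Y" and m: "m \<in> {1..M}"
  shows "u (t m) \<in> Y" and "s \<in> slab m \<Longrightarrow> u s = u (t m)"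
proof -
  obtain v where v: "v \<in> Y" "\<And>s. s \<in> slab m \<Longrightarrow> u s = v"
    using u m unfolding piecewise_const_def slab_def by blast
  show "u (t m) \<in> Y" using v t_in_slab[OF m] by simp
  show "s \<in> slab m \<Longrightarrow> u s = u (t m)" using v t_in_slab[OF m] by simp
qed

lemma \<phi>\<tau>_pc: "\<phi>\<tau> \<in> piecewise_const M t (H10 \<Omega>)" and d\<tau>_pc: "d\<tau> \<in> piecewise_const M t (L2 \<Omega>)"
  using dG unfolding dG0_state_def by blast+

lemmas \<phi>\<tau>_H10 = piecewise_const_slab(1)[OF \<phi>\<tau>_pc] and \<phi>\<tau>_slab = piecewise_const_slab(2)[OF \<phi>\<tau>_pc]
  and d\<tau>_L2 = piecewise_const_slab(1)[OF d\<tau>_pc] and d\<tau>_slab = piecewise_const_slab(2)[OF d\<tau>_pc]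

text \<open>\<open>F\<close> is either the right limit at the left end or the left limit at the
  right end of the slab, so that one proof yields both traces.\<close>

lemma L2_lim_slab:
  assumes m: "m \<in> {1..M}" and u: "\<And>s. s \<in> slab m \<Longrightarrow> u s = z" and z: "z \<in> L2 \<Omega>"
    and F: "F = at_right (t (m - 1)) \<or> F = at_left (t m)"
  shows "L2_lim \<Omega> F u \<in> L2 \<Omega>" "w \<in> L2 \<Omega> \<Longrightarrow> ip (L2_lim \<Omega> F u) w = ip z w"
proof -
  have "\<forall>\<^sub>F s in F. s \<in> {t (m - 1)<..<t m}"
    using F \<tau>_pos[OF m] eventually_at_right_real[of "t (m - 1)" "t m"] eventually_at_left_real[of "t (m - 1)" "t m"]
    by (auto simp: \<tau>_def)
  then have ev: "\<forall>\<^sub>F s in F. u s = z" by eventually_elim (auto intro!: u simp: slab_def)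
  have "F \<noteq> bot"
    using F by (elim disjE) simp_all
  then show "L2_lim \<Omega> F u \<in> L2 \<Omega>" "w \<in> L2 \<Omega> \<Longrightarrow> ip (L2_lim \<Omega> F u) w = ip z w"
    using L2_lim_eventually_const(1)[OF _ z ev] L2_lim_inner[OF _ z ev] by simp_all
qed

lemmas trace_plus_slab = L2_lim_slab[OF _ _ _ disjI1[OF refl], folded trace_plus_def]
  and trace_minus_slab = L2_lim_slab[OF _ _ _ disjI2[OF refl], folded trace_minus_def]

definition slab_fun :: "nat \<Rightarrow> ('a \<Rightarrow> real) \<Rightarrow> real \<Rightarrow> 'a \<Rightarrow> real" where
  "slab_fun m v s = (if s \<in> slab m then v else (\<lambda>x. 0))"

lemma slab_fun_slab:
  "n \<in> {1..M} \<Longrightarrow> m \<in> {1..M} \<Longrightarrow> s \<in> slab n \<Longrightarrow> slab_fun m v s = (if n = m then v else (\<lambda>x. 0))"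
  using slab_disjoint[of m n s] by (auto simp: slab_fun_def)

lemma slab_fun_piecewise_const:
  assumes "m \<in> {1..M}" "v \<in> Y" "(\<lambda>x. 0) \<in> Y"
  shows "slab_fun m v \<in> piecewise_const M t Y"
  unfolding piecewise_const_def
proof (intro CollectI ballI)
  fix n assume "n \<in> {1..M}"
  then show "\<exists>w\<in>Y. \<forall>s\<in>{t (n - 1)<..t n}. slab_fun m v s = w"
    using assms slab_fun_slab[of n m _ v] unfolding slab_def
    by (intro bexI[of _ "if n = m then v else (\<lambda>x. 0)"]) auto
qed

lemma trace_plus_slab_fun:
  assumes n: "n \<in> {1..M}" and m: "m \<in> {1..M}" and v: "v \<in> L2 \<Omega>" and w: "w \<in> L2 \<Omega>"
  shows "ip w (trace_plus \<Omega> (slab_fun m v) (t (n - 1))) = (if n = m then ip w v else 0)"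
  using trace_plus_slab(2)[OF n, of "slab_fun m v" "if n = m then v else (\<lambda>x. 0)" w] slab_fun_slab[OF n m, of _ v] v w
    zero_in_L2[of \<Omega>] L2_inner_commute[of \<Omega> w] by (auto simp: L2_inner_0_left)

lemma L2_inner_slab_fun: "ip f (slab_fun m v s) = indicator (slab m) s * ip f v"
  for f v :: "'a \<Rightarrow> real"
  by (simp add: slab_fun_def L2_inner_0_right)

lemma weak_dt_term:
  assumes n: "n \<in> {1..M}" and m: "m \<in> {1..M}" and v: "v \<in> L2 \<Omega>"
  shows "st_inner {t (n - 1)<..t n} \<Omega> (weak_dt {t (n - 1)<..<t n} \<Omega> d\<tau>) (slab_fun m v) = 0"
proof -
  let ?w = "weak_dt {t (n - 1)<..<t n} \<Omega> d\<tau>" and ?z = "if n = m then v else (\<lambda>x. 0)"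
  have "st_inner {t (n - 1)<..t n} \<Omega> ?w (slab_fun m v) = (LINT s|lebesgue_on {t (n - 1)<..t n}. ip (?w s) ?z)"
    unfolding st_inner_def
    by (rule LINT_cong) (use slab_fun_slab[OF n m, of _ v] in \<open>auto simp: slab_def\<close>)
  also have "\<dots> = 0"
    using v zero_in_L2 by (intro weak_dt_const_inner[of _ _ _ "d\<tau> (t n)"]) (auto intro!: d\<tau>_slab[OF n] simp: slab_def)
  finally show ?thesis .
qed

lemma dG_equation:
  assumes "\<psi> \<in> piecewise_const M t (H10 \<Omega>)" "\<mu> \<in> piecewise_const M t (L2 \<Omega>)"
  shows "dG_form \<Omega> T \<alpha> \<beta> \<delta> M t (\<phi>\<tau>, d\<tau>) (\<psi>, \<mu>) = st_inner I \<Omega> l \<psi> + ip d0 (trace_plus \<Omega> \<mu> (t 0))"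
  using dG assms unfolding dG0_state_def by blast

text \<open>The value \<open>d\<^sub>0\<close> at \<open>m = 0\<close> turns the initial term of the form into one more jump.\<close>

definition dd :: "nat \<Rightarrow> 'a \<Rightarrow> real" where "dd m = (if m = 0 then d0 else d\<tau> (t m))"

lemma dd_L2: "m \<le> M \<Longrightarrow> dd m \<in> L2 \<Omega>"
  using d0 d\<tau>_L2[of m] by (auto simp: dd_def)

text \<open>Starting with n = 2 guarantees that slab n - 1 exists, so that both one-sided limits
  agree, under inner products, with values of \<open>d\<tau>\<close>.\<close>

lemma jump_slab_fun:
  assumes n: "n \<in> {2..M}" and m: "m \<in> {1..M}" and v: "v \<in> L2 \<Omega>"
  shows "ip (jump \<Omega> d\<tau> (t (n - 1))) (trace_plus \<Omega> (slab_fun m v) (t (n - 1)))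
    = (if n = m then ip (\<lambda>x. dd n x - dd (n - 1) x) v else 0)"
proof -
  have n1: "n \<in> {1..M}" "n - 1 \<in> {1..M}" using n by auto
  note p = trace_plus_slab[of n d\<tau> "d\<tau> (t n)", OF n1(1) d\<tau>_slab[OF n1(1)] d\<tau>_L2[OF n1(1)]]
  note q = trace_minus_slab[of "n - 1" d\<tau> "d\<tau> (t (n - 1))", OF n1(2) d\<tau>_slab[OF n1(2)] d\<tau>_L2[OF n1(2)]]
  have "jump \<Omega> d\<tau> (t (n - 1)) \<in> L2 \<Omega>"
    unfolding jump_def by (rule L2.diff_mem[OF p(1) q(1)])
  moreover have "ip (jump \<Omega> d\<tau> (t (n - 1))) v = ip (\<lambda>x. dd n x - dd (n - 1) x) v"
    unfolding jump_def using p q v n n1 d\<tau>_L2 by (simp add: L2.diff_left dd_def)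
  ultimately show ?thesis using trace_plus_slab_fun[OF n1(1) m v] by auto
qed

lemma slab_restrict_integral:
  assumes m: "m \<in> {1..M}" and u: "\<And>s. s \<in> slab m \<Longrightarrow> f s = c"
  shows "slab_int m f = \<tau> m * c"
proof -
  have "slab_int m f = slab_int m (\<lambda>s. c)"
    by (rule LINT_cong) (use u in \<open>auto simp: indicator_def\<close>)
  then show ?thesis using slab_integral[OF m] by simp
qed

lemma piecewise_const_zero: "(\<lambda>x. 0) \<in> Y \<Longrightarrow> (\<lambda>s x. 0) \<in> piecewise_const M t Y"
  by (auto simp: piecewise_const_def)

lemma discrete_elliptic_equation:
  assumes m: "m \<in> {1..M}" and v: "v \<in> H10 \<Omega>"
  shows "\<alpha> * (\<tau> m * grad_inner (\<phi>\<tau> (t m)) v) - \<beta> * (\<tau> m * ip (\<lambda>x. d\<tau> (t m) x - \<phi>\<tau> (t m) x) v)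
    = slab_int m (\<lambda>s. ip (l s) v)"
proof -
  \<comment> \<open>Written as a slab function with value zero, the zero function is covered by the
    lemmas on traces; its trace is a choice and need not be literally zero.\<close>
  have z: "(\<lambda>s x. 0) = slab_fun m (\<lambda>x. 0)" by (auto simp: slab_fun_def)
  note eq = dG_equation[OF slab_fun_piecewise_const[OF m v zero_in_H10] piecewise_const_zero[OF zero_in_L2]]
  have g: "(LINT s|MI. L2_inner \<Omega> (weak_grad \<Omega> (\<phi>\<tau> s)) (weak_grad \<Omega> (slab_fun m v s))) = \<tau> m * grad_inner (\<phi>\<tau> (t m)) v"
  proof -
    have "(LINT s|MI. L2_inner \<Omega> (weak_grad \<Omega> (\<phi>\<tau> s)) (weak_grad \<Omega> (slab_fun m v s)))
      = slab_int m (\<lambda>s. grad_inner (\<phi>\<tau> s) v)"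
    proof (rule LINT_cong)
      fix s assume "s \<in> space MI"
      then obtain n where n: "n \<in> {1..M}" "s \<in> slab n" using slab_cover[of s] by auto
      have "\<phi>\<tau> s \<in> H1 \<Omega>" using \<phi>\<tau>_slab[OF n] \<phi>\<tau>_H10[OF n(1)] H10_H1 by simp
      then show "L2_inner \<Omega> (weak_grad \<Omega> (\<phi>\<tau> s)) (weak_grad \<Omega> (slab_fun m v s)) = indicator (slab m) s * grad_inner (\<phi>\<tau> s) v"
        using grad.zero_right[of "\<phi>\<tau> s"] by (simp add: slab_fun_def grad_inner_def)
    qed simp
    also have "\<dots> = \<tau> m * grad_inner (\<phi>\<tau> (t m)) v"
      using \<phi>\<tau>_slab[OF m] by (intro slab_restrict_integral m) simp
    finally show ?thesis .
  qed
  have b: "st_inner I \<Omega> (\<lambda>s x. d\<tau> s x - \<phi>\<tau> s x) (slab_fun m v) = \<tau> m * ip (\<lambda>x. d\<tau> (t m) x - \<phi>\<tau> (t m) x) v"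
    unfolding st_inner_def L2_inner_slab_fun
    using \<phi>\<tau>_slab[OF m] d\<tau>_slab[OF m] by (intro slab_restrict_integral m) simp
  have 1: "(\<Sum>n=2..M. ip (jump \<Omega> d\<tau> (t (n - 1))) (trace_plus \<Omega> (\<lambda>s x. 0) (t (n - 1)))) = 0"
    unfolding z using jump_slab_fun[OF _ m zero_in_L2] by (intro sum.neutral) (simp add: L2_inner_0_right)
  have 2: "ip w (trace_plus \<Omega> (\<lambda>s x. 0) (t 0)) = 0" if "w \<in> L2 \<Omega>" for w
    unfolding z using trace_plus_slab_fun[OF _ m zero_in_L2 that, of 1] M_pos by (auto simp: L2_inner_0_right)
  have 3: "trace_plus \<Omega> d\<tau> (t 0) \<in> L2 \<Omega>"
    using trace_plus_slab(1)[of 1 d\<tau> "d\<tau> (t 1)"] d\<tau>_slab[of 1] d\<tau>_L2[of 1] M_pos by simp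
  have 4: "st_inner J \<Omega> u (\<lambda>s x. 0) = 0" for J and u :: "real \<Rightarrow> 'a \<Rightarrow> real"
    by (simp add: st_inner_def L2_inner_0_right)
  show ?thesis
    using eq unfolding dG_form_def Let_def prod.case 1 2[OF 3] 2[OF d0] 4 b
    by (simp add: st_inner_def g L2_inner_slab_fun)
qed

lemma discrete_evolution_equation:
  assumes m: "m \<in> {1..M}" and v: "v \<in> L2 \<Omega>"
  shows "ip (\<lambda>x. dd m x - dd (m - 1) x) v
    + \<beta> / \<delta> * (\<tau> m * ip (\<lambda>x. d\<tau> (t m) x - \<phi>\<tau> (t m) x) v) = 0"
proof -
  note eq = dG_equation[OF piecewise_const_zero[OF zero_in_H10] slab_fun_piecewise_const[OF m v zero_in_L2]]
  have g: "st_inner I \<Omega> (\<lambda>s. weak_grad \<Omega> (\<phi>\<tau> s)) (\<lambda>s. weak_grad \<Omega> (\<lambda>x. 0)) = 0"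
  proof -
    have "st_inner I \<Omega> (\<lambda>s. weak_grad \<Omega> (\<phi>\<tau> s)) (\<lambda>s. weak_grad \<Omega> (\<lambda>x. 0)) = (LINT s|MI. 0)"
      unfolding st_inner_def
    proof (rule LINT_cong)
      fix s assume "s \<in> space MI"
      then obtain n where n: "n \<in> {1..M}" "s \<in> slab n" using slab_cover[of s] by auto
      have "\<phi>\<tau> s \<in> H1 \<Omega>" using \<phi>\<tau>_slab[OF n] \<phi>\<tau>_H10[OF n(1)] H10_H1 by simp
      then show "L2_inner \<Omega> (weak_grad \<Omega> (\<phi>\<tau> s)) (weak_grad \<Omega> (\<lambda>x. 0)) = 0"
        using grad.zero_right[of "\<phi>\<tau> s"] by (simp add: grad_inner_def)
    qed simp
    then show ?thesis by simp
  qed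
  have b: "st_inner I \<Omega> (\<lambda>s x. d\<tau> s x - \<phi>\<tau> s x) (slab_fun m v) = \<tau> m * ip (\<lambda>x. d\<tau> (t m) x - \<phi>\<tau> (t m) x) v"
    unfolding st_inner_def L2_inner_slab_fun
    using \<phi>\<tau>_slab[OF m] d\<tau>_slab[OF m] by (intro slab_restrict_integral m) simp
  have 0: "(\<Sum>n=1..M. st_inner {t (n - 1)<..t n} \<Omega> (weak_dt {t (n - 1)<..<t n} \<Omega> d\<tau>) (slab_fun m v)) = 0"
    using weak_dt_term[OF _ m v] by (intro sum.neutral) simp
  \<comment> \<open>The sum of jumps starts with n = 2. For m = 1 it contributes nothing, and fact
    \<open>5\<close> supplies the increment from the initial trace and the datum
    \<open>d0\<close>.\<close>
  have 1: "(\<Sum>n=2..M. ip (jump \<Omega> d\<tau> (t (n - 1))) (trace_plus \<Omega> (slab_fun m v) (t (n - 1))))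
     = (if m = 1 then 0 else ip (\<lambda>x. dd m x - dd (m - 1) x) v)"
  proof -
    have "(\<Sum>n=2..M. ip (jump \<Omega> d\<tau> (t (n - 1))) (trace_plus \<Omega> (slab_fun m v) (t (n - 1))))
      = (\<Sum>n=2..M. if n = m then ip (\<lambda>x. dd m x - dd (m - 1) x) v else 0)"
      using jump_slab_fun[OF _ m v] by (intro sum.cong) auto
    then show ?thesis using m by auto
  qed
  have one: "1 \<in> {1..M}" using M_pos by simp
  have 2: "ip w (trace_plus \<Omega> (slab_fun m v) (t 0)) = (if m = 1 then ip w v else 0)" if "w \<in> L2 \<Omega>" for w
    using trace_plus_slab_fun[OF one m v that] by (auto split: if_splits)
  have 3: "trace_plus \<Omega> d\<tau> (t 0) \<in> L2 \<Omega>" "ip (trace_plus \<Omega> d\<tau> (t 0)) v = ip (d\<tau> (t 1)) v"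
    using trace_plus_slab[OF one, of d\<tau> "d\<tau> (t 1)", OF d\<tau>_slab[OF one] d\<tau>_L2[OF one]] v by simp_all
  have 4: "st_inner J \<Omega> u (\<lambda>s x. 0) = 0" for J and u :: "real \<Rightarrow> 'a \<Rightarrow> real"
    by (simp add: st_inner_def L2_inner_0_right)
  have 5: "ip (\<lambda>x. dd 1 x - dd 0 x) v = ip (d\<tau> (t 1)) v - ip d0 v"
    using d0 d\<tau>_L2[OF one] v by (simp add: dd_def L2.diff_left)
  show ?thesis
    using eq 5 unfolding dG_form_def Let_def prod.case 0 1 2[OF 3(1)] 2[OF d0] 4 b g 3(2)
    by (auto split: if_splits)
qed

end

section \<open>The error estimate\<close>

text \<open>The scalar core of the energy argument: a and a' are the norms of e_m and e_(m-1), p is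
  their inner product, G the norm of the gradient of \<epsilon>_m, X the norm of e_m - \<epsilon>_m,
  R the bound on the oscillation of \<open>d\<close>, and k the accuracy of the mean value of
  \<open>\<phi>\<close>; \<open>rg\<close> and \<open>f\<close> are the resulting defects. The
  equation is doubled: then \<open>2 * p\<close> at most the sum of the two squares produces their
  difference, and half of the doubled X term remains after Young's inequality.\<close>

lemma energy_step:
  fixes a a' p rg f G X R k \<tau> \<alpha> \<beta> \<delta> :: real
  assumes pos: "0 < \<tau>" "0 < \<alpha>" "0 < \<beta>" "0 < \<delta>"
    and eq: "\<alpha> * rg + \<alpha> * \<tau> * G\<^sup>2 + \<delta> * (a\<^sup>2 - p) + \<beta> * f + \<beta> * \<tau> * X\<^sup>2 = 0"
    and rg: "\<bar>rg\<bar> \<le> G * (\<tau> * k)" and f: "\<bar>f\<bar> \<le> \<tau> * (R + k) * X" and p: "p \<le> a' * a"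
  shows "\<delta> * (a\<^sup>2 - a'\<^sup>2) + \<beta> * \<tau> * X\<^sup>2 \<le> \<beta> * \<tau> * (R + k)\<^sup>2 + \<alpha> * \<tau> * k\<^sup>2 / 2"
proof -
  have "p \<le> a * a'" using p by (simp add: mult.commute)
  then have "2 * p \<le> a\<^sup>2 + a'\<^sup>2" using sum_squares_bound[of a a'] by linarith
  then have "\<delta> * (2 * p) \<le> \<delta> * (a\<^sup>2 + a'\<^sup>2)" using pos by (intro mult_left_mono) auto
  then have 1: "\<delta> * (a\<^sup>2 - a'\<^sup>2) \<le> 2 * (\<delta> * (a\<^sup>2 - p))" by (simp add: algebra_simps)
  \<comment> \<open>This square gives 4 G k at most 4 G^2 + k^2, so the gradient term absorbs the
    defect and only a multiple of k^2 is left.\<close>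
  have "0 \<le> \<alpha> * \<tau> * (2 * G - k)\<^sup>2" using pos by simp
  then have 2: "4 * (\<alpha> * (G * (\<tau> * k))) \<le> 4 * (\<alpha> * \<tau> * G\<^sup>2) + \<alpha> * \<tau> * k\<^sup>2"
    by (simp add: algebra_simps power2_eq_square)
  have 3: "- (\<alpha> * (G * (\<tau> * k))) \<le> \<alpha> * rg"
    using rg pos mult_left_mono[of "- rg" "G * (\<tau> * k)" \<alpha>] by (simp add: abs_le_iff)
  have 4: "- (\<beta> * (\<tau> * (R + k) * X)) \<le> \<beta> * f"
    using f pos mult_left_mono[of "- f" "\<tau> * (R + k) * X" \<beta>] by (simp add: abs_le_iff)
  have "0 \<le> \<beta> * \<tau> * ((R + k) - X)\<^sup>2" using pos by simp
  then have 5: "2 * (\<beta> * (\<tau> * (R + k) * X)) \<le> \<beta> * \<tau> * (R + k)\<^sup>2 + \<beta> * \<tau> * X\<^sup>2"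
    by (simp add: algebra_simps power2_eq_square)
  show ?thesis using eq 1 2 3 4 5 by linarith
qed

text \<open>Serves to remove the accuracy \<open>k\<close> of the approximate mean values from the
  final bounds.\<close>

lemma le_limit_at_right_0:
  fixes g :: "real \<Rightarrow> real"
  assumes "\<And>k. 0 < k \<Longrightarrow> A \<le> g k" "isCont g 0"
  shows "A \<le> g 0"
proof (rule tendsto_lowerbound[of g])
  show "(g \<longlongrightarrow> g 0) (at_right 0)"
    using assms(2) by (simp add: isCont_def filterlim_at_split)
  show "\<forall>\<^sub>F k in at_right 0. A \<le> g k"
    using eventually_at_right_less[of "0::real"] by eventually_elim (rule assms(1))
qed simp

lemma square_sum3_le: "(x + y + z :: real)\<^sup>2 \<le> 3 * (x\<^sup>2 + y\<^sup>2 + z\<^sup>2)"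
  using zero_le_power2[of "x - y"] zero_le_power2[of "y - z"] zero_le_power2[of "x - z"]
  by (simp add: power2_eq_square algebra_simps)

lemma square_sum2_le: "(x + y :: real)\<^sup>2 \<le> 2 * (x\<^sup>2 + y\<^sup>2)"
  using zero_le_power2[of "x - y"] by (simp add: power2_eq_square algebra_simps)

lemma le_of_square_le:
  fixes x y :: real
  assumes "x\<^sup>2 \<le> x * y" "0 \<le> x" "0 \<le> y"
  shows "x \<le> y"
  using assms by (cases "x = 0") (auto simp: power2_eq_square)

context discretization
begin

text \<open>One witness of the existential in \<open>has_initial_value\<close> is fixed for good,
  because the errors at different mesh points must refer to the same representative.\<close>

definition D :: "real \<Rightarrow> 'a \<Rightarrow> real" where
  "D = (SOME D. (\<forall>t\<in>{0..T}. D t \<in> L2 \<Omega> \<and>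
        ((\<lambda>s. nrm (\<lambda>x. D s x - D t x)) \<longlongrightarrow> 0) (at t within {0..T})) \<and>
     (AE t in lebesgue_on {0<..<T}. nrm (\<lambda>x. d t x - D t x) = 0) \<and>
     nrm (\<lambda>x. D 0 x - d0 x) = 0)"

lemma
  shows D_L2: "s \<in> {0..T} \<Longrightarrow> D s \<in> L2 \<Omega>"
    and D_cont: "s \<in> {0..T} \<Longrightarrow> ((\<lambda>r. nrm (\<lambda>x. D r x - D s x)) \<longlongrightarrow> 0) (at s within {0..T})"
    and D_AE: "AE s in MI. nrm (\<lambda>x. d s x - D s x) = 0"
    and D_0: "nrm (\<lambda>x. D 0 x - d0 x) = 0"
  using someI_ex[OF init[unfolded has_initial_value_def], folded D_def] by blast+

lemma D_t_L2: "m \<le> M \<Longrightarrow> D (t m) \<in> L2 \<Omega>"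
  using t_bounds[of m] by (intro D_L2) auto

lemma slab_bounds: "m \<in> {1..M} \<Longrightarrow> 0 \<le> t (m - 1) \<and> t m \<le> T \<and> t (m - 1) < t m"
  using t_bounds[of m] t_bounds[of "m - 1"] \<tau>_pos[of m] by (auto simp: \<tau>_def)

lemma slab_const_integrable: "integrable MI (\<lambda>s. indicator (slab m) s * (b::real))"
proof -
  interpret finite_measure MI by (rule finite_measure_lebesgue_on) simp
  show ?thesis by (intro indicator_interval_integrable slab_borel) simp
qed

section \<open>Integrals and oscillation over one slab\<close>

lemma slab_integral_close:
  assumes m: "m \<in> {1..M}" and f: "integrable MI f" and ae: "AE s in MI. s \<in> slab m \<longrightarrow> \<bar>f s - c\<bar> \<le> B"
  shows "\<bar>slab_int m f - \<tau> m * c\<bar> \<le> \<tau> m * B"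
proof -
  note ci = slab_const_integrable
  note fi = indicator_interval_integrable[OF slab_borel f, of m]
  have "slab_int m f - \<tau> m * c
      = (LINT s|MI. indicator (slab m) s * f s - indicator (slab m) s * c)"
    unfolding slab_integral[OF m, symmetric] using fi ci by simp
  also have "\<bar>\<dots>\<bar> \<le> slab_int m (\<lambda>s. B)"
  proof (rule integral_abs_bound[THEN order_trans], rule integral_mono_AE)
    show "AE s in MI. \<bar>indicator (slab m) s * f s - indicator (slab m) s * c\<bar> \<le> indicator (slab m) s * B"
      using ae by eventually_elim (auto simp: indicator_def)
  qed (use fi ci in auto)
  also have "\<dots> = \<tau> m * B" by (rule slab_integral[OF m])
  finally show ?thesis .
qed

lemma slab_integral_le:
  assumes m: "m \<in> {1..M}" and f: "integrable MI f" and ae: "AE s in MI. s \<in> slab m \<longrightarrow> f s \<le> B"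
  shows "slab_int m f \<le> \<tau> m * B"
proof -
  have "slab_int m f \<le> slab_int m (\<lambda>s. B)"
  proof (rule integral_mono_AE)
    show "AE s in MI. indicator (slab m) s * f s \<le> indicator (slab m) s * B"
      using ae by eventually_elim (auto simp: indicator_def)
  qed (intro indicator_interval_integrable slab_borel f slab_const_integrable)+
  also have "\<dots> = \<tau> m * B" by (rule slab_integral[OF m])
  finally show ?thesis .
qed

lemma slab_cauchy_schwarz:
  assumes m: "m \<in> {1..M}" and f: "integrable MI f" "integrable MI (\<lambda>s. (f s)\<^sup>2)"
  shows "(slab_int m f)\<^sup>2 \<le> \<tau> m * slab_int m (\<lambda>s. (f s)\<^sup>2)"
proof -
  let ?A = "I \<inter> slab m"
  have eq: "(LINT s|MI. indicator ?A s * g s) = slab_int m (\<lambda>s. g s)" for g :: "real \<Rightarrow> real"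
    by (rule LINT_cong) (auto simp: indicator_def)
  have "measure MI ?A = (LINT s|MI. indicator ?A s * 1)" by (simp add: Int_ac)
  also have "\<dots> = \<tau> m" unfolding eq slab_integral[OF m] by simp
  finally show ?thesis
    using set_integral_cauchy_schwarz[OF _ interval_sets[OF slab_borel[of m]] f] eq by simp
qed

text \<open>The total variation bound on a slab. By the Cauchy-Schwarz inequality its square is at
  most the slab length times the integral of the squared norm.\<close>

definition Rd :: "nat \<Rightarrow> real" where "Rd m = slab_int m (\<lambda>s. nrm (wd s))"
definition R\<phi> :: "nat \<Rightarrow> real" where "R\<phi> m = slab_int m (\<lambda>s. nrm (w\<phi> s))"

lemma R_nonneg: "0 \<le> Rd m" "0 \<le> R\<phi> m"
  unfolding Rd_def R\<phi>_def by (auto intro!: Bochner_Integration.integral_nonneg simp: L2_norm_nonneg)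

lemma indicator_mono_integral:
  fixes f :: "real \<Rightarrow> real"
  assumes "A \<subseteq> B" "A \<in> sets borel" "B \<in> sets borel" "integrable MI f" "\<And>s. 0 \<le> f s"
  shows "(LINT s|MI. indicator A s * f s) \<le> (LINT s|MI. indicator B s * f s)"
  using assms by (intro integral_mono indicator_interval_integrable) (auto simp: indicator_def)

text \<open>The increment identity is tested with the increment itself, and one factor of its norm
  is cancelled.\<close>

lemma D_increment:
  assumes m: "m \<in> {1..M}" and s: "s \<in> slab m"
  shows "nrm (\<lambda>x. D (t m) x - D s x) \<le> Rd m"
proof -
  have st: "0 \<le> s" "s \<le> t m" "t m \<le> T" using s slab_bounds[OF m] by (auto simp: slab_def)
  define v where "v = (\<lambda>x. D (t m) x - D s x)"
  have v: "v \<in> L2 \<Omega>" unfolding v_def using st by (intro L2.diff_mem D_L2) auto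
  have "(nrm v)\<^sup>2 = ip v v" by (rule L2_norm_power2)
  also have "\<dots> = (LINT r|MI. indicator {s..<t m} r * ip (wd r) v)"
    using continuous_representative_increment[OF T dL2 wd D_L2 D_cont D_AE v st] by (simp add: v_def)
  also have "\<dots> \<le> nrm v * (LINT r|MI. indicator {s..<t m} r * nrm (wd r))"
    using integral_inner_le[OF wdL2 v, of "{s..<t m}"] by simp
  also have "\<dots> \<le> nrm v * Rd m"
    unfolding Rd_def
    by (intro mult_left_mono indicator_mono_integral L2_L2_norm_integrable wdL2 slab_borel L2_norm_nonneg)
       (use s in \<open>auto simp: slab_def\<close>)
  finally show ?thesis
    unfolding v_def[symmetric] by (rule le_of_square_le) (auto simp: L2_norm_nonneg R_nonneg)
qed

text \<open>Two times from a set \<open>P\<close> of full measure are compared, since no continuous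
  representative of \<open>\<phi>\<close> is at hand. \<open>P\<close> is chosen once for all slabs,
  and commutativity of the distance frees the bound from the order of the two times.\<close>

lemma \<phi>_increment:
  obtains P where "AE s in MI. P s" "\<And>s. P s \<Longrightarrow> \<phi> s \<in> L2 \<Omega>"
    "\<And>m s r. m \<in> {1..M} \<Longrightarrow> P s \<Longrightarrow> P r \<Longrightarrow> s \<in> slab m \<inter> I \<Longrightarrow> r \<in> slab m \<inter> I \<Longrightarrow>
      nrm (\<lambda>x. \<phi> s x - \<phi> r x) \<le> R\<phi> m"
proof -
  obtain P where P: "AE s in MI. P s"
    "\<And>s t. P s \<Longrightarrow> P t \<Longrightarrow> s \<in> I \<Longrightarrow> t \<in> I \<Longrightarrow> s \<le> t \<Longrightarrow>
       nrm (\<lambda>x. \<phi> t x - \<phi> s x) \<le> (LINT r|MI. indicator {s..<t} r * nrm (w\<phi> r))"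
    by (rule weak_dt_increment[OF T \<phi>L2 w\<phi>]) (rule that)
  have le: "nrm (\<lambda>x. \<phi> r x - \<phi> s x) \<le> R\<phi> m"
    if "P s" "P r" "s \<in> slab m \<inter> I" "r \<in> slab m \<inter> I" "s \<le> r" for m s r
  proof -
    have "nrm (\<lambda>x. \<phi> r x - \<phi> s x) \<le> (LINT q|MI. indicator {s..<r} q * nrm (w\<phi> q))"
      using P(2)[OF that(1,2)] that by auto
    also have "\<dots> \<le> R\<phi> m"
      unfolding R\<phi>_def
      by (intro indicator_mono_integral L2_L2_norm_integrable w\<phi>L2 slab_borel L2_norm_nonneg)
         (use that in \<open>auto simp: slab_def\<close>)
    finally show ?thesis .
  qed
  show thesis
  proof (rule that[of "\<lambda>s. P s \<and> \<phi> s \<in> L2 \<Omega>"])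
    show "AE s in MI. P s \<and> \<phi> s \<in> L2 \<Omega>"
      using P(1) L2_L2_AE[OF \<phi>L2] by eventually_elim simp
    fix m s r assume *: "P s \<and> \<phi> s \<in> L2 \<Omega>" "P r \<and> \<phi> r \<in> L2 \<Omega>" "s \<in> slab m \<inter> I" "r \<in> slab m \<inter> I"
    show "nrm (\<lambda>x. \<phi> s x - \<phi> r x) \<le> R\<phi> m"
    proof (cases "r \<le> s")
      case True then show ?thesis using le[of r s m] * by simp
    next
      case False
      then show ?thesis using le[of s r m] * L2_norm_commute[of "\<phi> s" \<Omega> "\<phi> r"] by simp
    qed
  qed simp
qed

definition err :: "nat \<Rightarrow> 'a \<Rightarrow> real" where "err m = (\<lambda>x. D (t m) x - dd m x)"

lemma err_L2: "m \<le> M \<Longrightarrow> err m \<in> L2 \<Omega>"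
  unfolding err_def by (intro L2.diff_mem D_t_L2 dd_L2)

lemma err_0: "nrm (err 0) = 0"
  using D_0 by (simp add: err_def dd_def t_0)

text \<open>\<open>approx_integral\<close> is used with accuracy \<open>\<tau> m * k\<close> and its
  result scaled by \<open>1 / \<tau> m\<close>, so that k becomes the accuracy of the mean value.
  One \<open>v\<close> serves both estimates, because the gradient form and the L^2 product with a
  fixed function are both bounded in the H^1 norm.\<close>

lemma slab_average:
  assumes m: "m \<in> {1..M}" and k: "0 < k"
  obtains v where "v \<in> H10 \<Omega>"
    "\<And>w. w \<in> H1 \<Omega> \<Longrightarrow> \<bar>slab_int m (\<lambda>s. grad_inner (\<phi> s) w) - \<tau> m * grad_inner v w\<bar> \<le> grad.N w * (\<tau> m * k)"
    "\<And>w. w \<in> L2 \<Omega> \<Longrightarrow> \<bar>slab_int m (\<lambda>s. ip (\<phi> s) w) - \<tau> m * ip v w\<bar> \<le> nrm w * (\<tau> m * k)"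
proof -
  interpret B: bochner "H10 \<Omega>" H1_inner I by (rule bochner_H10)
  have eq: "(LINT s|MI. indicator (I \<inter> slab m) s * g s) = slab_int m (\<lambda>s. g s)" for g :: "real \<Rightarrow> real"
    by (rule LINT_cong) (auto simp: indicator_def)
  have \<tau>: "0 < \<tau> m" by (rule \<tau>_pos[OF m])
  have "\<phi> \<in> B.space_L2" using \<phi>V by (simp add: H1_N_eq)
  then obtain v' where v': "v' \<in> H10 \<Omega>" "\<And>L c. B.bdd_functional L c \<Longrightarrow>
     \<bar>(LINT s|MI. indicator (I \<inter> slab m) s * L (\<phi> s)) - L v'\<bar> \<le> c * (\<tau> m * k)"
    by (rule B.approx_integral[OF _ interval_sets[OF slab_borel[of m]] mult_pos_pos[OF \<tau> k]]) (rule that)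
  show thesis
  proof
    show v: "(\<lambda>x. 1 / \<tau> m * v' x) \<in> H10 \<Omega>" by (rule H10.scale_mem[OF v'(1)])
    fix w assume w: "w \<in> H1 \<Omega>"
    have "\<tau> m * grad_inner (\<lambda>x. 1 / \<tau> m * v' x) w = grad_inner v' w"
      unfolding grad.scale_left[OF H10_H1[OF v'(1)] w] using \<tau> by simp
    then show "\<bar>slab_int m (\<lambda>s. grad_inner (\<phi> s) w) - \<tau> m * grad_inner (\<lambda>x. 1 / \<tau> m * v' x) w\<bar> \<le> grad.N w * (\<tau> m * k)"
      using v'(2)[OF bdd_functional_grad[OF w]] eq by simp
  next
    fix w :: "'a \<Rightarrow> real" assume w: "w \<in> L2 \<Omega>"
    have "\<tau> m * ip (\<lambda>x. 1 / \<tau> m * v' x) w = ip v' w"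
      unfolding L2.scale_left[OF H10_L2[OF v'(1)] w] using \<tau> by simp
    then show "\<bar>slab_int m (\<lambda>s. ip (\<phi> s) w) - \<tau> m * ip (\<lambda>x. 1 / \<tau> m * v' x) w\<bar> \<le> nrm w * (\<tau> m * k)"
      using v'(2)[OF bdd_functional_L2[OF w]] eq by simp
  qed
qed

text \<open>Testing with the difference \<open>z\<close> of \<open>\<phi> s\<close> and
  \<open>v\<close> gives its squared norm: the slab integral of the pairing with \<open>z\<close> is
  close to \<open>\<tau> m * ip (\<phi> s) z\<close> by the oscillation bound and to
  \<open>\<tau> m * ip v z\<close> by the accuracy of \<open>v\<close>.\<close>

lemma slab_average_close:
  assumes m: "m \<in> {1..M}" and v: "v \<in> L2 \<Omega>" and k: "0 < k"
    and av: "\<And>w. w \<in> L2 \<Omega> \<Longrightarrow> \<bar>slab_int m (\<lambda>s. ip (\<phi> s) w) - \<tau> m * ip v w\<bar> \<le> nrm w * (\<tau> m * k)"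
  shows "AE s in MI. s \<in> slab m \<longrightarrow> \<phi> s \<in> L2 \<Omega> \<and> nrm (\<lambda>x. \<phi> s x - v x) \<le> R\<phi> m + k"
proof -
  obtain P where P: "AE s in MI. P s" "\<And>s. P s \<Longrightarrow> \<phi> s \<in> L2 \<Omega>"
    "\<And>m s r. m \<in> {1..M} \<Longrightarrow> P s \<Longrightarrow> P r \<Longrightarrow> s \<in> slab m \<inter> I \<Longrightarrow> r \<in> slab m \<inter> I \<Longrightarrow>
      nrm (\<lambda>x. \<phi> s x - \<phi> r x) \<le> R\<phi> m"
    by (rule \<phi>_increment) (rule that)
  show ?thesis
    using P(1) AE_space
  proof eventually_elim
    case (elim s)
    show ?case
    proof
      assume s: "s \<in> slab m"
      define z where "z = (\<lambda>x. \<phi> s x - v x)"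
      have \<phi>s: "\<phi> s \<in> L2 \<Omega>" using P(2) elim by simp
      have z: "z \<in> L2 \<Omega>" unfolding z_def by (rule L2.diff_mem[OF \<phi>s v])
      have "\<bar>slab_int m (\<lambda>r. ip (\<phi> r) z) - \<tau> m * ip (\<phi> s) z\<bar>
          \<le> \<tau> m * (R\<phi> m * nrm z)"
      proof (rule slab_integral_close[OF m L2_L2_inner_integrable[OF \<phi>L2 z]])
        show "AE r in MI. r \<in> slab m \<longrightarrow> \<bar>ip (\<phi> r) z - ip (\<phi> s) z\<bar> \<le> R\<phi> m * nrm z"
          using P(1) AE_space
        proof eventually_elim
          case (elim r)
          show ?case
          proof
            assume r: "r \<in> slab m"
            have \<phi>r: "\<phi> r \<in> L2 \<Omega>" using P(2) elim by simp
            have "\<bar>ip (\<phi> r) z - ip (\<phi> s) z\<bar> \<le> nrm (\<lambda>x. \<phi> r x - \<phi> s x) * nrm z"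
              using L2_cauchy_schwarz[OF L2.diff_mem[OF \<phi>r \<phi>s] z] by (simp add: L2.diff_left \<phi>r \<phi>s z)
            also have "\<dots> \<le> R\<phi> m * nrm z"
              using P(3)[OF m, of r s] elim \<open>P s\<close> \<open>s \<in> space MI\<close> r s
              by (intro mult_right_mono L2_norm_nonneg) auto
            finally show "\<bar>ip (\<phi> r) z - ip (\<phi> s) z\<bar> \<le> R\<phi> m * nrm z" .
          qed
        qed
      qed
      moreover have "(nrm z)\<^sup>2 = ip (\<phi> s) z - ip v z"
        unfolding L2_norm_power2 using L2.diff_left[OF \<phi>s v z] by (simp add: z_def)
      then have "\<tau> m * (nrm z)\<^sup>2 = \<tau> m * ip (\<phi> s) z - \<tau> m * ip v z"
        by (simp add: right_diff_distrib)
      ultimately have "\<tau> m * (nrm z)\<^sup>2 \<le> \<tau> m * (R\<phi> m * nrm z) + nrm z * (\<tau> m * k)"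
        using av[OF z] by linarith
      also have "\<dots> = \<tau> m * (nrm z * (R\<phi> m + k))" by (simp add: algebra_simps)
      finally have "\<tau> m * (nrm z)\<^sup>2 \<le> \<tau> m * (nrm z * (R\<phi> m + k))" .
      then have "(nrm z)\<^sup>2 \<le> nrm z * (R\<phi> m + k)"
        using \<tau>_pos[OF m] by simp
      then have "nrm z \<le> R\<phi> m + k"
        by (rule le_of_square_le) (use R_nonneg(2)[of m] k in \<open>auto simp: L2_norm_nonneg\<close>)
      then show "\<phi> s \<in> L2 \<Omega> \<and> nrm (\<lambda>x. \<phi> s x - v x) \<le> R\<phi> m + k"
        using \<phi>s by (simp add: z_def)
    qed
  qed
qed

text \<open>The integrals contain \<open>d\<close>, while the increment bound is for
  \<open>D\<close>; the two are linked almost everywhere only.\<close>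

lemma D_slab_close:
  assumes m: "m \<in> {1..M}"
  shows "AE s in MI. s \<in> slab m \<longrightarrow> d s \<in> L2 \<Omega> \<and> nrm (\<lambda>x. d s x - D (t m) x) \<le> Rd m"
  using D_AE L2_L2_AE[OF dL2] AE_space
proof eventually_elim
  case (elim s)
  show ?case
  proof
    assume s: "s \<in> slab m"
    have L: "d s \<in> L2 \<Omega>" "D s \<in> L2 \<Omega>" "D (t m) \<in> L2 \<Omega>"
      using elim D_L2 D_t_L2 m by auto
    have "nrm (\<lambda>x. d s x - D (t m) x) \<le> nrm (\<lambda>x. d s x - D s x) + nrm (\<lambda>x. D s x - D (t m) x)"
      by (rule L2_norm_triangle[OF L])
    also have "\<dots> \<le> Rd m" using D_increment[OF m s] elim L2_norm_commute[OF L(2,3)] by simp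
    finally show "d s \<in> L2 \<Omega> \<and> nrm (\<lambda>x. d s x - D (t m) x) \<le> Rd m" using L by simp
  qed
qed

lemma D_integral_close:
  assumes m: "m \<in> {1..M}" and w: "w \<in> L2 \<Omega>"
  shows "\<bar>slab_int m (\<lambda>s. ip (d s) w) - \<tau> m * ip (D (t m)) w\<bar> \<le> \<tau> m * (Rd m * nrm w)"
proof (rule slab_integral_close[OF m L2_L2_inner_integrable[OF dL2 w]])
  show "AE s in MI. s \<in> slab m \<longrightarrow> \<bar>ip (d s) w - ip (D (t m)) w\<bar> \<le> Rd m * nrm w"
    using D_slab_close[OF m]
  proof eventually_elim
    case (elim s)
    show ?case
    proof
      assume "s \<in> slab m"
      with elim have L: "d s \<in> L2 \<Omega>" "nrm (\<lambda>x. d s x - D (t m) x) \<le> Rd m" by auto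
      have D: "D (t m) \<in> L2 \<Omega>" using D_t_L2 m by simp
      have "\<bar>ip (d s) w - ip (D (t m)) w\<bar> \<le> nrm (\<lambda>x. d s x - D (t m) x) * nrm w"
        using L2_cauchy_schwarz[OF L2.diff_mem[OF L(1) D] w] by (simp add: L2.diff_left L D w)
      also have "\<dots> \<le> Rd m * nrm w" by (intro mult_right_mono L2_norm_nonneg L)
      finally show "\<bar>ip (d s) w - ip (D (t m)) w\<bar> \<le> Rd m * nrm w" .
    qed
  qed
qed

text \<open>Integrating the time derivative over the slab turns the evolution equation into one for
  nodal values of \<open>D\<close>, from which its discrete counterpart is subtracted.\<close>

lemma err_equation:
  assumes m: "m \<in> {1..M}" and w: "w \<in> L2 \<Omega>"
  shows "ip (err m) w - ip (err (m - 1)) w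
    + \<beta> / \<delta> * (slab_int m (\<lambda>s. ip (gap s) w)
       - \<tau> m * ip (\<lambda>x. d\<tau> (t m) x - \<phi>\<tau> (t m) x) w) = 0"
proof -
  have L: "D (t m) \<in> L2 \<Omega>" "D (t (m - 1)) \<in> L2 \<Omega>" "dd m \<in> L2 \<Omega>" "dd (m - 1) \<in> L2 \<Omega>"
    using m by (auto intro!: D_t_L2 dd_L2)
  have "ip (\<lambda>x. D (t m) x - D (t (m - 1)) x) w = (LINT r|MI. indicator {t (m - 1)..<t m} r * ip (wd r) w)"
    using continuous_representative_increment[OF T dL2 wd D_L2 D_cont D_AE w] slab_bounds[OF m] by auto
  also have "\<dots> = slab_int m (\<lambda>r. ip (wd r) w)"
  proof (rule integral_cong_lebesgue_on_AE)
    \<comment> \<open>The increment is an integral over an interval closed on the left, the slab is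
      closed on the right; they differ in two mesh points.\<close>
    have "AE r in lebesgue. r \<noteq> t (m - 1)" "AE r in lebesgue. r \<noteq> t m" by (intro AE_completion AE_lborel_singleton)+
    then have "AE r in lebesgue. indicator {t (m - 1)..<t m} r * ip (wd r) w = indicator (slab m) r * ip (wd r) w"
      by eventually_elim (auto simp: slab_def indicator_def)
    then show "AE r in MI. indicator {t (m - 1)..<t m} r * ip (wd r) w = indicator (slab m) r * ip (wd r) w"
      by (subst AE_restrict_space_iff) auto
    show "(\<lambda>r. indicator {t (m - 1)..<t m} r * ip (wd r) w) \<in> borel_measurable MI"
      using indicator_interval_integrable[OF _ L2_L2_inner_integrable[OF wdL2 w], of "{t (m - 1)..<t m}"] by auto
  qed simp
  finally show ?thesis
    using evolution_equation[OF w slab_borel[of m]] discrete_evolution_equation[OF m w] L w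
    by (simp add: err_def L2.diff_left right_diff_distrib)
qed

text \<open>\<open>X\<close> is the norm of e_m - \<epsilon>_m and depends on the approximate mean
  value, thus on \<open>k\<close>, which is why it is obtained and not defined beforehand. It is
  also what links the error of \<open>\<phi>\<close> to the nodal error, since the norm of
  \<epsilon>_m is at most that of e_m plus \<open>X\<close>.\<close>

lemma energy_estimate:
  assumes m: "m \<in> {1..M}" and k: "0 < k"
  obtains X where
    "\<delta> * ((nrm (err m))\<^sup>2 - (nrm (err (m - 1)))\<^sup>2) + \<beta> * \<tau> m * X\<^sup>2
       \<le> \<beta> * \<tau> m * (Rd m + k)\<^sup>2 + \<alpha> * \<tau> m * k\<^sup>2 / 2"
    "AE s in MI. s \<in> slab m \<longrightarrow> nrm (E\<phi> s) \<le> (R\<phi> m + k) + X + nrm (err m)"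
proof -
  have \<tau>: "0 < \<tau> m" by (rule \<tau>_pos[OF m])
  obtain v where v: "v \<in> H10 \<Omega>"
    "\<And>w. w \<in> H1 \<Omega> \<Longrightarrow> \<bar>slab_int m (\<lambda>s. grad_inner (\<phi> s) w) - \<tau> m * grad_inner v w\<bar> \<le> grad.N w * (\<tau> m * k)"
    "\<And>w. w \<in> L2 \<Omega> \<Longrightarrow> \<bar>slab_int m (\<lambda>s. ip (\<phi> s) w) - \<tau> m * ip v w\<bar> \<le> nrm w * (\<tau> m * k)"
    by (rule slab_average[OF m k]) (rule that)
  let ?p = "\<phi>\<tau> (t m)"
  define \<epsilon> where "\<epsilon> = (\<lambda>x. v x - ?p x)"
  define e where "e = err m"
  define e' where "e' = err (m - 1)"
  define X where "X = nrm (\<lambda>x. e x - \<epsilon> x)"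
  \<comment> \<open>The consistency error of the coupling term: its slab integral minus the value
    formed with the nodal value of \<open>d\<close> and the approximate mean value of
    \<open>\<phi>\<close>.\<close>
  define F where "F w = slab_int m (\<lambda>s. ip (gap s) w)
       - \<tau> m * (ip (D (t m)) w - ip v w)" for w
  have p: "?p \<in> H10 \<Omega>" by (rule \<phi>\<tau>_H10[OF m])
  have \<epsilon>: "\<epsilon> \<in> H10 \<Omega>" unfolding \<epsilon>_def by (rule H10.diff_mem[OF v(1) p])
  have e: "e \<in> L2 \<Omega>" and e': "e' \<in> L2 \<Omega>" unfolding e_def e'_def using m by (auto intro: err_L2)
  have L: "v \<in> L2 \<Omega>" "?p \<in> L2 \<Omega>" "\<epsilon> \<in> L2 \<Omega>" "D (t m) \<in> L2 \<Omega>" "d\<tau> (t m) \<in> L2 \<Omega>"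
    using v(1) p \<epsilon> m by (auto intro!: H10_L2 D_t_L2 d\<tau>_L2)
  have e_eq: "e = (\<lambda>x. D (t m) x - d\<tau> (t m) x)" using m by (simp add: e_def err_def dd_def)
  have Fbound: "\<bar>F w\<bar> \<le> \<tau> m * (Rd m + k) * nrm w" if w: "w \<in> L2 \<Omega>" for w
  proof -
    have "F w = (slab_int m (\<lambda>s. ip (d s) w) - \<tau> m * ip (D (t m)) w)
      - (slab_int m (\<lambda>s. ip (\<phi> s) w) - \<tau> m * ip v w)"
      unfolding F_def d\<phi>_inner_integrable(2)[OF w slab_borel] by (simp add: algebra_simps)
    then show ?thesis
      using D_integral_close[OF m w] v(3)[OF w] by (simp add: algebra_simps)
  qed
  \<comment> \<open>The two equations are tested with different functions; linearity merges their
    consistency errors into one for e - \<epsilon>, whose norm the energy controls.\<close>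
  have Flin: "F (\<lambda>x. e x - \<epsilon> x) = F e - F \<epsilon>"
    unfolding F_def d\<phi>_inner_integrable(2)[OF L2.diff_mem[OF e L(3)] slab_borel] d\<phi>_inner_integrable(2)[OF e slab_borel]
      d\<phi>_inner_integrable(2)[OF L(3) slab_borel]
      integral_inner_diff[OF dL2 e L(3) slab_borel] integral_inner_diff[OF \<phi>L2 e L(3) slab_borel]
      L2.diff_right[OF e L(3) L(4)] L2.diff_right[OF e L(3) L(1)]
    by (simp add: algebra_simps)
  have Feq: "slab_int m (\<lambda>s. ip (gap s) w)
       - \<tau> m * ip (\<lambda>x. d\<tau> (t m) x - ?p x) w = F w + \<tau> m * (ip e w - ip \<epsilon> w)"
    if w: "w \<in> L2 \<Omega>" for w
    unfolding F_def e_eq \<epsilon>_def using L w by (simp add: L2.diff_left algebra_simps)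
  define rg where "rg = slab_int m (\<lambda>s. grad_inner (\<phi> s) \<epsilon>) - \<tau> m * grad_inner v \<epsilon>"
  have g\<epsilon>: "grad_inner v \<epsilon> - grad_inner ?p \<epsilon> = (grad.N \<epsilon>)\<^sup>2"
    unfolding grad.N_power2 using grad.diff_left[OF H10_H1[OF v(1)] H10_H1[OF p] H10_H1[OF \<epsilon>]] by (simp add: \<epsilon>_def)
  have I: "\<alpha> * rg + \<alpha> * \<tau> m * (grad.N \<epsilon>)\<^sup>2 = \<beta> * (F \<epsilon> + \<tau> m * (ip e \<epsilon> - ip \<epsilon> \<epsilon>))"
    unfolding Feq[OF L(3), symmetric] g\<epsilon>[symmetric] rg_def
    using elliptic_equation[OF \<epsilon> slab_borel[of m]] discrete_elliptic_equation[OF m \<epsilon>]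
    by (simp add: algebra_simps)
  \<comment> \<open>Multiplication by \<open>\<delta>\<close> turns the factor
    \<open>\<beta> / \<delta>\<close> into \<open>\<beta>\<close>, so that the coupling terms of
    \<open>I\<close> and \<open>II\<close> complete a square.\<close>
  have II: "\<delta> * (ip e e - ip e' e) + \<beta> * (F e + \<tau> m * (ip e e - ip \<epsilon> e)) = 0"
  proof -
    have "\<delta> * (ip e e - ip e' e + \<beta> / \<delta> * (F e + \<tau> m * (ip e e - ip \<epsilon> e))) = 0"
      using err_equation[OF m e] unfolding Feq[OF e] e_def[symmetric] e'_def[symmetric] by simp
    then show ?thesis using \<delta> by (simp add: algebra_simps)
  qed
  have X2: "X\<^sup>2 = ip e e - 2 * ip e \<epsilon> + ip \<epsilon> \<epsilon>"
    unfolding X_def L2_norm_power2 using e L L2.sym[OF e L(3)] by (simp add: L2.diff_left L2.diff_right L2.diff_mem)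
  show thesis
  proof (rule that[of X])
    show "\<delta> * ((nrm (err m))\<^sup>2 - (nrm (err (m - 1)))\<^sup>2) + \<beta> * \<tau> m * X\<^sup>2
       \<le> \<beta> * \<tau> m * (Rd m + k)\<^sup>2 + \<alpha> * \<tau> m * k\<^sup>2 / 2"
      unfolding e_def[symmetric] e'_def[symmetric]
    proof (rule energy_step[OF \<tau> \<alpha> \<beta> \<delta>])
      show "\<alpha> * rg + \<alpha> * \<tau> m * (grad.N \<epsilon>)\<^sup>2 + \<delta> * ((nrm e)\<^sup>2 - ip e' e) + \<beta> * F (\<lambda>x. e x - \<epsilon> x) + \<beta> * \<tau> m * X\<^sup>2 = 0"
        using I II unfolding Flin X2 L2_norm_power2 L2.sym[OF L(3) e] by (simp add: algebra_simps)
      show "\<bar>rg\<bar> \<le> grad.N \<epsilon> * (\<tau> m * k)" unfolding rg_def by (rule v(2)[OF H10_H1[OF \<epsilon>]])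
      show "\<bar>F (\<lambda>x. e x - \<epsilon> x)\<bar> \<le> \<tau> m * (Rd m + k) * X"
        unfolding X_def by (rule Fbound[OF L2.diff_mem[OF e L(3)]])
      show "ip e' e \<le> nrm e' * nrm e" using L2_cauchy_schwarz[OF e' e] by simp
    qed
    show "AE s in MI. s \<in> slab m \<longrightarrow> nrm (E\<phi> s) \<le> (R\<phi> m + k) + X + nrm (err m)"
    proof -
      have ae: "AE s in MI. s \<in> slab m \<longrightarrow> \<phi> s \<in> L2 \<Omega> \<and> nrm (\<lambda>x. \<phi> s x - v x) \<le> R\<phi> m + k"
        by (rule slab_average_close[OF m L(1) k v(3)])
      show ?thesis using ae
      proof eventually_elim
        case (elim s)
        show ?case
        proof
          assume s: "s \<in> slab m"
          with elim have \<phi>s: "\<phi> s \<in> L2 \<Omega>" "nrm (\<lambda>x. \<phi> s x - v x) \<le> R\<phi> m + k" by auto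
          have "nrm (E\<phi> s) \<le> nrm (\<lambda>x. \<phi> s x - v x) + nrm \<epsilon>"
            unfolding \<phi>\<tau>_slab[OF m s] \<epsilon>_def by (rule L2_norm_triangle[OF \<phi>s(1) L(1,2)])
          also have "nrm \<epsilon> \<le> nrm e + X"
            using L2_norm_diff_le[OF e L2.diff_mem[OF e L(3)]] by (simp add: X_def)
          finally show "nrm (E\<phi> s) \<le> (R\<phi> m + k) + X + nrm (err m)"
            using \<phi>s(2) by (simp add: e_def)
        qed
    qed
    qed
  qed
qed

text \<open>Against a fixed second function the square expands into integrable terms; the piecewise
  constant one is then handled slab by slab.\<close>

lemma error_integrable:
  assumes u: "u \<in> L2_L2 I \<Omega>" and w: "w \<in> piecewise_const M t (L2 \<Omega>)"
  shows "integrable MI (\<lambda>s. (nrm (\<lambda>x. u s x - w s x))\<^sup>2)"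
proof -
  have i: "integrable MI (\<lambda>s. (nrm (\<lambda>x. u s x - z x))\<^sup>2)" if z: "z \<in> L2 \<Omega>" for z
  proof -
    interpret finite_measure MI by (rule finite_measure_lebesgue_on) simp
    let ?g = "\<lambda>s. (nrm (u s))\<^sup>2 - 2 * ip (u s) z + ip z z"
    have g: "integrable MI ?g"
      using L2_L2_norm_integrable(2)[OF u] L2_L2_inner_integrable[OF u z] by simp
    have ae: "AE s in MI. ?g s = (nrm (\<lambda>x. u s x - z x))\<^sup>2"
      using L2_L2_AE[OF u]
    proof eventually_elim
      case (elim s)
      then show ?case
        unfolding L2_norm_power2 using z L2.sym[OF elim z] by (simp add: L2.diff_left L2.diff_right L2.diff_mem)
    qed
    show ?thesis
      by (rule integrable_cong_AE_imp[OF g borel_measurable_lebesgue_on_AE[OF _ _ ae]]) (use g ae in auto)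
  qed
  have int: "integrable MI (\<lambda>s. \<Sum>m=1..M. indicator (slab m) s * (nrm (\<lambda>x. u s x - w (t m) x))\<^sup>2)"
    by (intro Bochner_Integration.integrable_sum indicator_interval_integrable slab_borel i piecewise_const_slab(1)[OF w])
  have eq: "(\<Sum>m=1..M. indicator (slab m) s * (nrm (\<lambda>x. u s x - w (t m) x))\<^sup>2)
      = (nrm (\<lambda>x. u s x - w s x))\<^sup>2" if "s \<in> space MI" for s
  proof -
    have "(\<Sum>m=1..M. indicator (slab m) s * (nrm (\<lambda>x. u s x - w (t m) x))\<^sup>2)
      = (\<Sum>m=1..M. indicator (slab m) s * (nrm (\<lambda>x. u s x - w s x))\<^sup>2)"
      using piecewise_const_slab(2)[OF w] by (intro sum.cong) (auto simp: indicator_def)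
    then show ?thesis using slab_sum_indicator that by (simp flip: sum_distrib_right)
  qed
  show ?thesis using int by (subst (asm) Bochner_Integration.integrable_cong[OF refl eq])
qed

section \<open>Summation over the slabs\<close>

lemma integral_eq_slab_sum:
  fixes f :: "real \<Rightarrow> real"
  assumes "integrable MI f"
  shows "(LINT s|MI. f s) = (\<Sum>m=1..M. slab_int m f)"
proof -
  have "(\<Sum>m=1..M. slab_int m f) = (LINT s|MI. (\<Sum>m=1..M. indicator (slab m) s * f s))"
    by (rule Bochner_Integration.integral_sum[symmetric]) (intro indicator_interval_integrable slab_borel assms)
  also have "\<dots> = (LINT s|MI. f s)"
    by (rule LINT_cong) (use slab_sum_indicator in \<open>auto simp flip: sum_distrib_right\<close>)
  finally show ?thesis by simp
qed

lemma \<phi>\<tau>_pc_L2: "\<phi>\<tau> \<in> piecewise_const M t (L2 \<Omega>)"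
  using \<phi>\<tau>_pc H10_L2 unfolding piecewise_const_def by blast

definition Wd :: "nat \<Rightarrow> real" where "Wd m = slab_int m (\<lambda>s. (nrm (wd s))\<^sup>2)"
definition W\<phi> :: "nat \<Rightarrow> real" where "W\<phi> m = slab_int m (\<lambda>s. (nrm (w\<phi> s))\<^sup>2)"

lemma Rd_le: "m \<in> {1..M} \<Longrightarrow> (Rd m)\<^sup>2 \<le> \<tau> m * Wd m" and R\<phi>_le: "m \<in> {1..M} \<Longrightarrow> (R\<phi> m)\<^sup>2 \<le> \<tau> m * W\<phi> m"
  unfolding Rd_def Wd_def R\<phi>_def W\<phi>_def
  by (intro slab_cauchy_schwarz L2_L2_norm_integrable wdL2 w\<phi>L2; simp)+

lemma W_nonneg: "0 \<le> Wd m" "0 \<le> W\<phi> m"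
  unfolding Wd_def W\<phi>_def by (auto intro!: Bochner_Integration.integral_nonneg)

text \<open>In the energy inequality the nonnegative term with \<open>X\<close> is discarded and k
  tends to 0.\<close>

lemma err_step:
  assumes m: "m \<in> {1..M}"
  shows "(nrm (err m))\<^sup>2 - (nrm (err (m - 1)))\<^sup>2 \<le> \<beta> / \<delta> * (\<tau> m * (Rd m)\<^sup>2)"
proof -
  have "\<delta> * ((nrm (err m))\<^sup>2 - (nrm (err (m - 1)))\<^sup>2)
      \<le> \<beta> * \<tau> m * (Rd m + 0)\<^sup>2 + \<alpha> * \<tau> m * 0\<^sup>2 / 2"
  proof (rule le_limit_at_right_0)
    fix k :: real assume "0 < k"
    then obtain X where "\<delta> * ((nrm (err m))\<^sup>2 - (nrm (err (m - 1)))\<^sup>2) + \<beta> * \<tau> m * X\<^sup>2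
       \<le> \<beta> * \<tau> m * (Rd m + k)\<^sup>2 + \<alpha> * \<tau> m * k\<^sup>2 / 2"
      by (rule energy_estimate[OF m]) (rule that)
    moreover have "0 \<le> \<beta> * \<tau> m * X\<^sup>2" using \<beta> \<tau>_pos[OF m] by simp
    ultimately show "\<delta> * ((nrm (err m))\<^sup>2 - (nrm (err (m - 1)))\<^sup>2)
      \<le> \<beta> * \<tau> m * (Rd m + k)\<^sup>2 + \<alpha> * \<tau> m * k\<^sup>2 / 2" by linarith
  qed (intro continuous_intros; simp)
  then show ?thesis using \<delta> by (simp add: field_simps)
qed

text \<open>The energy inequality is used once more, now to bound
  \<open>\<tau> m * X\<^sup>2\<close>. The nodal errors enter as a difference, which telescopes in
  the sum over m. The factor 3 comes from squaring a bound with three terms.\<close>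

lemma \<phi>_error_step:
  assumes m: "m \<in> {1..M}"
  shows "slab_int m (\<lambda>s. (nrm (E\<phi> s))\<^sup>2)
    \<le> 3 * (\<tau> m * (R\<phi> m)\<^sup>2 + \<tau> m * (Rd m)\<^sup>2
        + \<delta> / \<beta> * ((nrm (err (m - 1)))\<^sup>2 - (nrm (err m))\<^sup>2) + \<tau> m * (nrm (err m))\<^sup>2)"
    (is "?E \<le> _")
proof -
  let ?a = "nrm (err m)" and ?a' = "nrm (err (m - 1))"
  let ?g = "\<lambda>k. 3 * (\<tau> m * (R\<phi> m + k)\<^sup>2 + (\<tau> m * (Rd m + k)\<^sup>2 + \<alpha> / \<beta> * \<tau> m * k\<^sup>2 / 2
        + \<delta> / \<beta> * (?a'\<^sup>2 - ?a\<^sup>2)) + \<tau> m * ?a\<^sup>2)"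
  have \<tau>: "0 < \<tau> m" by (rule \<tau>_pos[OF m])
  have isCont_g: "isCont ?g 0" using \<beta> by simp
  have "?E \<le> ?g 0"
  proof (rule le_limit_at_right_0[of _ ?g])
    fix k :: real assume k: "0 < k"
    then obtain X where X: "\<delta> * (?a\<^sup>2 - ?a'\<^sup>2) + \<beta> * \<tau> m * X\<^sup>2 \<le> \<beta> * \<tau> m * (Rd m + k)\<^sup>2 + \<alpha> * \<tau> m * k\<^sup>2 / 2"
      "AE s in MI. s \<in> slab m \<longrightarrow> nrm (E\<phi> s) \<le> (R\<phi> m + k) + X + ?a"
      by (rule energy_estimate[OF m]) (rule that)
    have "?E \<le> \<tau> m * (3 * ((R\<phi> m + k)\<^sup>2 + X\<^sup>2 + ?a\<^sup>2))"
    proof (rule slab_integral_le[OF m error_integrable[OF \<phi>L2 \<phi>\<tau>_pc_L2]])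
      show "AE s in MI. s \<in> slab m \<longrightarrow> (nrm (E\<phi> s))\<^sup>2 \<le> 3 * ((R\<phi> m + k)\<^sup>2 + X\<^sup>2 + ?a\<^sup>2)"
        using X(2)
      proof eventually_elim
        case (elim s)
        show ?case
        proof
          assume "s \<in> slab m"
          with elim have "(nrm (E\<phi> s))\<^sup>2 \<le> ((R\<phi> m + k) + X + ?a)\<^sup>2"
            by (intro power_mono L2_norm_nonneg) auto
          also have "\<dots> \<le> 3 * ((R\<phi> m + k)\<^sup>2 + X\<^sup>2 + ?a\<^sup>2)" by (rule square_sum3_le)
          finally show "(nrm (E\<phi> s))\<^sup>2 \<le> 3 * ((R\<phi> m + k)\<^sup>2 + X\<^sup>2 + ?a\<^sup>2)" .
        qed
      qed
    qed
    moreover have "\<tau> m * X\<^sup>2 \<le> \<tau> m * (Rd m + k)\<^sup>2 + \<alpha> / \<beta> * \<tau> m * k\<^sup>2 / 2 + \<delta> / \<beta> * (?a'\<^sup>2 - ?a\<^sup>2)"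
      (is "_ \<le> ?rhs")
    proof -
      have "\<beta> * ?rhs = \<beta> * \<tau> m * (Rd m + k)\<^sup>2 + \<alpha> * \<tau> m * k\<^sup>2 / 2 - \<delta> * (?a\<^sup>2 - ?a'\<^sup>2)"
        using \<beta> by (simp add: distrib_left right_diff_distrib)
      then have "\<beta> * (\<tau> m * X\<^sup>2) \<le> \<beta> * ?rhs" using X(1) by (simp add: mult.assoc)
      then show ?thesis using \<beta> by simp
    qed
    ultimately show "?E \<le> ?g k" by (simp add: algebra_simps)
  qed (rule isCont_g)
  then show ?thesis by (simp add: algebra_simps)
qed

lemma d_error_step:
  assumes m: "m \<in> {1..M}"
  shows "slab_int m (\<lambda>s. (nrm (Ed s))\<^sup>2)
    \<le> \<tau> m * (2 * ((Rd m)\<^sup>2 + (nrm (err m))\<^sup>2))"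
proof (rule slab_integral_le[OF m error_integrable[OF dL2 d\<tau>_pc]])
  show "AE s in MI. s \<in> slab m \<longrightarrow> (nrm (Ed s))\<^sup>2 \<le> 2 * ((Rd m)\<^sup>2 + (nrm (err m))\<^sup>2)"
    using D_slab_close[OF m]
  proof eventually_elim
    case (elim s)
    show ?case
    proof
      assume s: "s \<in> slab m"
      with elim have L: "d s \<in> L2 \<Omega>" "nrm (\<lambda>x. d s x - D (t m) x) \<le> Rd m" by auto
      have "nrm (\<lambda>x. d s x - d\<tau> (t m) x) \<le> nrm (\<lambda>x. d s x - D (t m) x) + nrm (\<lambda>x. D (t m) x - d\<tau> (t m) x)"
        using m by (intro L2_norm_triangle L(1) D_t_L2 d\<tau>_L2) auto
      moreover have "err m = (\<lambda>x. D (t m) x - d\<tau> (t m) x)" using m by (simp add: err_def dd_def)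
      ultimately have "nrm (Ed s) \<le> Rd m + nrm (err m)"
        using L(2) d\<tau>_slab[OF m s] by simp
      then have "(nrm (Ed s))\<^sup>2 \<le> (Rd m + nrm (err m))\<^sup>2"
        by (intro power_mono L2_norm_nonneg)
      also have "\<dots> \<le> 2 * ((Rd m)\<^sup>2 + (nrm (err m))\<^sup>2)" by (rule square_sum2_le)
      finally show "(nrm (Ed s))\<^sup>2 \<le> 2 * ((Rd m)\<^sup>2 + (nrm (err m))\<^sup>2)" .
    qed
  qed
qed

definition h :: real where "h = mesh_size M t"

lemma \<tau>_le_h: "m \<in> {1..M} \<Longrightarrow> \<tau> m \<le> h"
  unfolding h_def mesh_size_def \<tau>_def by (intro Max_ge) auto

lemma h_pos: "0 < h"
  using \<tau>_le_h[of 1] \<tau>_pos[of 1] M_pos by simp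

lemma sum_\<tau>: "(\<Sum>m=1..M. \<tau> m) = T"
proof -
  have "n \<le> M \<Longrightarrow> (\<Sum>m=1..n. \<tau> m) = t n" for n
    by (induction n) (auto simp: \<tau>_def t_0)
  then show ?thesis using t_M by simp
qed

text \<open>One factor \<open>\<tau> m\<close> is the length of the slab over which a constant bound
  is integrated, the other comes from the Cauchy-Schwarz inequality.\<close>

lemma \<tau>_R_le:
  assumes m: "m \<in> {1..M}"
  shows "\<tau> m * (Rd m)\<^sup>2 \<le> h\<^sup>2 * Wd m" "\<tau> m * (R\<phi> m)\<^sup>2 \<le> h\<^sup>2 * W\<phi> m"
proof -
  have \<tau>: "0 < \<tau> m" "(\<tau> m)\<^sup>2 \<le> h\<^sup>2" using \<tau>_pos[OF m] \<tau>_le_h[OF m] by (auto intro: power_mono)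
  have "\<tau> m * (Rd m)\<^sup>2 \<le> \<tau> m * (\<tau> m * Wd m)" using Rd_le[OF m] \<tau> by simp
  also have "\<dots> = (\<tau> m)\<^sup>2 * Wd m" by (simp add: power2_eq_square)
  also have "\<dots> \<le> h\<^sup>2 * Wd m" by (intro mult_right_mono \<tau> W_nonneg)
  finally show "\<tau> m * (Rd m)\<^sup>2 \<le> h\<^sup>2 * Wd m" .
  have "\<tau> m * (R\<phi> m)\<^sup>2 \<le> \<tau> m * (\<tau> m * W\<phi> m)" using R\<phi>_le[OF m] \<tau> by simp
  also have "\<dots> = (\<tau> m)\<^sup>2 * W\<phi> m" by (simp add: power2_eq_square)
  also have "\<dots> \<le> h\<^sup>2 * W\<phi> m" by (intro mult_right_mono \<tau> W_nonneg)
  finally show "\<tau> m * (R\<phi> m)\<^sup>2 \<le> h\<^sup>2 * W\<phi> m" .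
qed

definition Wd_total :: real where "Wd_total = (\<Sum>m=1..M. Wd m)"
definition W\<phi>_total :: real where "W\<phi>_total = (\<Sum>m=1..M. W\<phi> m)"

lemma st_norm_eq:
  fixes u :: "real \<Rightarrow> 'a \<Rightarrow> real"
  shows "st_norm I \<Omega> u = sqrt (LINT s|MI. (nrm (u s))\<^sup>2)"
  by (simp add: st_norm_def st_inner_def L2_norm_power2)

lemma st_norm_weak_dt:
  "st_norm I \<Omega> (weak_dt I \<Omega> d) = sqrt Wd_total" "st_norm I \<Omega> (weak_dt I \<Omega> \<phi>) = sqrt W\<phi>_total"
  unfolding st_norm_eq wd_def[symmetric] w\<phi>_def[symmetric] Wd_total_def W\<phi>_total_def Wd_def W\<phi>_def
  using integral_eq_slab_sum[OF L2_L2_norm_integrable(2)[OF wdL2]]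
    integral_eq_slab_sum[OF L2_L2_norm_integrable(2)[OF w\<phi>L2]] by simp_all

text \<open>The right-hand side of \<open>err_step\<close> does not contain the error, so the steps
  simply add up from the initial error, which has norm zero.\<close>

lemma err_bound:
  assumes "n \<le> M"
  shows "(nrm (err n))\<^sup>2 \<le> \<beta> / \<delta> * (h\<^sup>2 * Wd_total)"
proof -
  have "(nrm (err n))\<^sup>2 \<le> \<beta> / \<delta> * (h\<^sup>2 * (\<Sum>m=1..n. Wd m))" using assms
  proof (induction n)
    case 0 then show ?case by (simp add: err_0)
  next
    case (Suc n)
    have "\<beta> / \<delta> * (\<tau> (Suc n) * (Rd (Suc n))\<^sup>2) \<le> \<beta> / \<delta> * (h\<^sup>2 * Wd (Suc n))"
      using \<tau>_R_le(1)[of "Suc n"] Suc.prems \<beta> \<delta> by (intro mult_left_mono) auto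
    then show ?case using Suc err_step[of "Suc n"] by (simp add: distrib_left)
  qed
  also have "\<dots> \<le> \<beta> / \<delta> * (h\<^sup>2 * Wd_total)"
    unfolding Wd_total_def using \<beta> \<delta> assms W_nonneg by (intro mult_left_mono sum_mono2) auto
  finally show ?thesis .
qed

lemma err_weighted_sum: "(\<Sum>m=1..M. \<tau> m * (nrm (err m))\<^sup>2) \<le> T * (\<beta> / \<delta> * (h\<^sup>2 * Wd_total))"
proof -
  have "(\<Sum>m=1..M. \<tau> m * (nrm (err m))\<^sup>2) \<le> (\<Sum>m=1..M. \<tau> m * (\<beta> / \<delta> * (h\<^sup>2 * Wd_total)))"
    using err_bound less_imp_le[OF \<tau>_pos] by (intro sum_mono mult_left_mono) auto
  also have "\<dots> = T * (\<beta> / \<delta> * (h\<^sup>2 * Wd_total))" by (simp only: sum_\<tau> flip: sum_distrib_right)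
  finally show ?thesis .
qed

lemma \<tau>_R_sum: "(\<Sum>m=1..M. \<tau> m * (Rd m)\<^sup>2) \<le> h\<^sup>2 * Wd_total" "(\<Sum>m=1..M. \<tau> m * (R\<phi> m)\<^sup>2) \<le> h\<^sup>2 * W\<phi>_total"
  unfolding Wd_total_def W\<phi>_total_def sum_distrib_left by (intro sum_mono \<tau>_R_le; simp)+

lemma \<phi>_error:
  "(LINT s|MI. (nrm (E\<phi> s))\<^sup>2)
    \<le> 3 * (h\<^sup>2 * W\<phi>_total + h\<^sup>2 * Wd_total + T * (\<beta> / \<delta> * (h\<^sup>2 * Wd_total)))"
proof -
  let ?a = "\<lambda>m. (nrm (err m))\<^sup>2"
  have tele: "(\<Sum>m=1..n. ?a (m - 1) - ?a m) = - ?a n" for n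
    by (induction n) (auto simp: err_0)
  have "(LINT s|MI. (nrm (E\<phi> s))\<^sup>2)
    \<le> (\<Sum>m=1..M. 3 * (\<tau> m * (R\<phi> m)\<^sup>2 + \<tau> m * (Rd m)\<^sup>2 + \<delta> / \<beta> * (?a (m - 1) - ?a m) + \<tau> m * ?a m))"
    unfolding integral_eq_slab_sum[OF error_integrable[OF \<phi>L2 \<phi>\<tau>_pc_L2]]
    by (intro sum_mono \<phi>_error_step)
  also have "\<dots> = 3 * ((\<Sum>m=1..M. \<tau> m * (R\<phi> m)\<^sup>2) + (\<Sum>m=1..M. \<tau> m * (Rd m)\<^sup>2)
      + \<delta> / \<beta> * (\<Sum>m=1..M. ?a (m - 1) - ?a m) + (\<Sum>m=1..M. \<tau> m * ?a m))"
    by (simp only: sum.distrib flip: sum_distrib_left)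
  also have "\<dots> \<le> 3 * (h\<^sup>2 * W\<phi>_total + h\<^sup>2 * Wd_total + 0 + T * (\<beta> / \<delta> * (h\<^sup>2 * Wd_total)))"
  proof (intro mult_left_mono add_mono \<tau>_R_sum err_weighted_sum)
    show "\<delta> / \<beta> * (\<Sum>m=1..M. ?a (m - 1) - ?a m) \<le> 0"
      unfolding tele using \<beta> \<delta> by simp
  qed simp
  finally show ?thesis by simp
qed

lemma d_error:
  "(LINT s|MI. (nrm (Ed s))\<^sup>2) \<le> 2 * (h\<^sup>2 * Wd_total + T * (\<beta> / \<delta> * (h\<^sup>2 * Wd_total)))"
proof -
  have "(LINT s|MI. (nrm (Ed s))\<^sup>2) \<le> (\<Sum>m=1..M. \<tau> m * (2 * ((Rd m)\<^sup>2 + (nrm (err m))\<^sup>2)))"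
    unfolding integral_eq_slab_sum[OF error_integrable[OF dL2 d\<tau>_pc]] by (intro sum_mono d_error_step)
  also have "\<dots> = 2 * ((\<Sum>m=1..M. \<tau> m * (Rd m)\<^sup>2) + (\<Sum>m=1..M. \<tau> m * (nrm (err m))\<^sup>2))"
    by (simp add: sum_distrib_left sum.distrib distrib_left mult.left_commute)
  also have "\<dots> \<le> 2 * (h\<^sup>2 * Wd_total + T * (\<beta> / \<delta> * (h\<^sup>2 * Wd_total)))"
    by (intro mult_left_mono add_mono \<tau>_R_sum err_weighted_sum) simp
  finally show ?thesis .
qed

text \<open>Both squared errors are at most K h^2 times the sum of \<open>W\<phi>_total\<close> and
  \<open>Wd_total\<close>, with K = 3 + 3 T \<beta> / \<delta>: 3 is the larger of the factors 3 and
  2 from the squared triangle inequalities, and T \<beta> / \<delta> stems from the nodal errors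
  weighted with the slab lengths. The factor 2 outside the root counts the two errors.\<close>

proposition error_estimate:
  "st_norm I \<Omega> (\<lambda>s x. \<phi> s x - \<phi>\<tau> s x) + st_norm I \<Omega> (\<lambda>s x. d s x - d\<tau> s x)
    \<le> 2 * sqrt (3 + 3 * T * \<beta> / \<delta>) * mesh_size M t * (st_norm I \<Omega> (weak_dt I \<Omega> \<phi>) + st_norm I \<Omega> (weak_dt I \<Omega> d))"
proof -
  let ?K = "3 + 3 * T * \<beta> / \<delta>"
  have nn: "0 \<le> Wd_total" "0 \<le> W\<phi>_total"
    unfolding Wd_total_def W\<phi>_total_def by (intro sum_nonneg W_nonneg)+
  define c where "c = T * \<beta> / \<delta>"
  have pos: "0 \<le> c" using T \<beta> \<delta> by (simp add: c_def)
  have K: "?K = 3 + 3 * c" and cx: "T * (\<beta> / \<delta> * x) = c * x" for x by (simp_all add: c_def)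
  have hW: "0 \<le> h\<^sup>2 * W\<phi>_total" "0 \<le> h\<^sup>2 * Wd_total" using nn by simp_all
  note hW mult_nonneg_nonneg[OF pos hW(1)] mult_nonneg_nonneg[OF pos hW(2)]
  then have 1: "3 * (h\<^sup>2 * W\<phi>_total + h\<^sup>2 * Wd_total + T * (\<beta> / \<delta> * (h\<^sup>2 * Wd_total))) \<le> ?K * h\<^sup>2 * (W\<phi>_total + Wd_total)"
    and 2: "2 * (h\<^sup>2 * Wd_total + T * (\<beta> / \<delta> * (h\<^sup>2 * Wd_total))) \<le> ?K * h\<^sup>2 * (W\<phi>_total + Wd_total)"
    unfolding K cx by (simp_all add: algebra_simps)
  have K0: "0 \<le> ?K" unfolding K using pos by simp
  have "sqrt (?K * h\<^sup>2 * (W\<phi>_total + Wd_total)) = sqrt ?K * h * sqrt (W\<phi>_total + Wd_total)"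
    using h_pos by (simp add: real_sqrt_mult)
  also have "\<dots> \<le> sqrt ?K * h * (sqrt W\<phi>_total + sqrt Wd_total)"
    using K0 h_pos nn by (intro mult_left_mono sqrt_add_le_add_sqrt) auto
  finally have 3: "sqrt (?K * h\<^sup>2 * (W\<phi>_total + Wd_total)) \<le> sqrt ?K * h * (sqrt W\<phi>_total + sqrt Wd_total)" .
  have "st_norm I \<Omega> (\<lambda>s x. \<phi> s x - \<phi>\<tau> s x) \<le> sqrt (?K * h\<^sup>2 * (W\<phi>_total + Wd_total))"
    unfolding st_norm_eq by (rule real_sqrt_le_mono[OF order_trans[OF \<phi>_error 1]])
  moreover have "st_norm I \<Omega> (\<lambda>s x. d s x - d\<tau> s x) \<le> sqrt (?K * h\<^sup>2 * (W\<phi>_total + Wd_total))"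
    unfolding st_norm_eq by (rule real_sqrt_le_mono[OF order_trans[OF d_error 2]])
  ultimately show ?thesis using 3 unfolding st_norm_weak_dt h_def[symmetric] by simp
qed

end

theorem theorem3p11:
  fixes \<Omega> :: "(real ^ 'n) set" and T \<alpha> \<beta> \<delta> :: real
  assumes "CARD('n) \<in> {2, 3}"
    and "convex_polytopal_domain \<Omega>"
    and "T > 0" and "\<alpha> > 0" and "\<beta> > 0" and "\<delta> > 0"
  shows "\<exists>C>0. \<forall>l d0 \<phi> d M t \<phi>\<tau> d\<tau>.
     l \<in> L2_L2 {0<..<T} \<Omega> \<longrightarrow>
     d0 \<in> L2 \<Omega> \<longrightarrow>
     continuous_state \<Omega> T \<alpha> \<beta> \<delta> l d0 \<phi> d \<longrightarrow>
     \<phi> \<in> H1_L2 {0<..<T} \<Omega> \<longrightarrow>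
     time_mesh T M t \<longrightarrow>
     dG0_state \<Omega> T \<alpha> \<beta> \<delta> M t l d0 \<phi>\<tau> d\<tau> \<longrightarrow>
     st_norm {0<..<T} \<Omega> (\<lambda>s x. \<phi> s x - \<phi>\<tau> s x) + st_norm {0<..<T} \<Omega> (\<lambda>s x. d s x - d\<tau> s x)
     \<le> C * mesh_size M t *
         (st_norm {0<..<T} \<Omega> (weak_dt {0<..<T} \<Omega> \<phi>) + st_norm {0<..<T} \<Omega> (weak_dt {0<..<T} \<Omega> d))"
proof (intro exI[of _ "2 * sqrt (3 + 3 * T * \<beta> / \<delta>)"] conjI allI impI)
  have "0 < 3 + 3 * T * \<beta> / \<delta>" using assms(3-6) by (intro add_pos_nonneg) auto
  then show "0 < 2 * sqrt (3 + 3 * T * \<beta> / \<delta>)" by simp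
  fix l d0 \<phi> d M t \<phi>\<tau> d\<tau>
  assume *: "l \<in> L2_L2 {0<..<T} \<Omega>" "d0 \<in> L2 \<Omega>" "continuous_state \<Omega> T \<alpha> \<beta> \<delta> l d0 \<phi> d"
    "\<phi> \<in> H1_L2 {0<..<T} \<Omega>" "time_mesh T M t" "dG0_state \<Omega> T \<alpha> \<beta> \<delta> M t l d0 \<phi>\<tau> d\<tau>"
  have "bounded \<Omega>"
    using assms(2) unfolding convex_polytopal_domain_def
    by (intro bounded_subset[OF polytope_imp_bounded closure_subset]) simp
  then interpret discretization \<Omega> T \<alpha> \<beta> \<delta> l d0 \<phi> d M t \<phi>\<tau> d\<tau>
    using assms * by unfold_locales (auto simp: convex_polytopal_domain_def)
  show "st_norm {0<..<T} \<Omega> (\<lambda>s x. \<phi> s x - \<phi>\<tau> s x) + st_norm {0<..<T} \<Omega> (\<lambda>s x. d s x - d\<tau> s x)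
     \<le> 2 * sqrt (3 + 3 * T * \<beta> / \<delta>) * mesh_size M t *
         (st_norm {0<..<T} \<Omega> (weak_dt {0<..<T} \<Omega> \<phi>) + st_norm {0<..<T} \<Omega> (weak_dt {0<..<T} \<Omega> d))"
    by (rule error_estimate)
qed

end
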